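(* Let $\mu\in\mathscr{P}_{\log}(\mathbb{C})$. The following are equivalent: (1) $U^\mu(z)\le0$ for all $z\in\mathbb{C}$; (2) there exists a sequence of compact subsets $K_n\subset\mathbb{C}$ of capacity one such that the equilibrium measures $\mu_{K_n}$ converge log-weakly to $\mu$.
   Context: $\mathscr{P}_{\log}(\mathbb{C})$ is the set of Borel probability measures $\mu$ on $\mathbb{C}$ with $\int\log^+|z|\,d\mu<\infty$. For such $\mu$ its potential is $U^\mu(z)=\int-\log|w-z|\,d\mu(w)\in\mathbb{R}\cup\{+\infty\}$. A sequence $(\mu_n)\subset\mathscr{P}_{\log}(\mathbb{C})$ converges log-weakly to $\mu$ if $\int f\,d\mu_n\to\int f\,d\mu$ for every continuous $f\colon\mathbb{C}\to\mathbb{R}$ with $|f(z)|\le A+B\log^+|z|$ for some constants $A,B$. For a compact $K\subset\mathbb{C}$ and a probability measure $\nu$ on $K$, the energy is $I(\nu)=\iint-\log|w-z|\,d\nu(w)d\nu(z)$; if $K$ is non-polar (some $\nu$ has $I(\nu)<\infty$) there is a unique probability measure $\mu_K$ on $K$ minimizing $I$ (the equilibrium measure), and $\operatorname{cap}(K)=e^{-I(\mu_K)}$. *)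

theory Defs
  imports "HOL-Probability.Probability"
begin

definition log_plus :: "real \<Rightarrow> real" where
  "log_plus x = max 0 (ln x)"

definition P_log :: "complex measure set" where
  "P_log = {\<mu>. prob_space \<mu> \<and> sets \<mu> = sets borel \<and> integrable \<mu> (\<lambda>z. log_plus (cmod z))}"

text \<open>The integral of an extended-real-valued function, as the difference of the integrals of its
  positive and negative parts. Below, the negative part always has finite integral (for the
  potential of a measure in \<^const>\<open>P_log\<close>, and for the energy of a probability measure on a compact
  set), so the difference never has the form \<infinity> - \<infinity>.\<close>

definition ereal_integral :: "'a measure \<Rightarrow> ('a \<Rightarrow> ereal) \<Rightarrow> ereal" where
  "ereal_integral M f =
     enn2ereal (\<integral>\<^sup>+ x. e2ennreal (f x) \<partial>M) - enn2ereal (\<integral>\<^sup>+ x. e2ennreal (- f x) \<partial>M)"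

text \<open>The value on the diagonal has to be set explicitly, since \<^term>\<open>ln (0::real) = 0\<close>.\<close>

definition log_kernel :: "complex \<Rightarrow> complex \<Rightarrow> ereal" where
  "log_kernel w z = (if w = z then \<infinity> else ereal (- ln (cmod (w - z))))"

definition potential :: "complex measure \<Rightarrow> complex \<Rightarrow> ereal" where
  "potential \<mu> z = ereal_integral \<mu> (\<lambda>w. log_kernel w z)"

definition log_energy :: "complex measure \<Rightarrow> ereal" where
  "log_energy \<nu> = ereal_integral \<nu> (\<lambda>z. ereal_integral \<nu> (\<lambda>w. log_kernel w z))"

text \<open>Measures on a compact set \<open>K\<close> are represented as Borel measures on the plane
  that give full mass to \<open>K\<close>.\<close>

definition prob_measures_on :: "complex set \<Rightarrow> complex measure set" where
  "prob_measures_on K = {\<nu>. prob_space \<nu> \<and> sets \<nu> = sets borel \<and> emeasure \<nu> K = 1}"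

definition non_polar :: "complex set \<Rightarrow> bool" where
  "non_polar K \<longleftrightarrow> (\<exists>\<nu>\<in>prob_measures_on K. log_energy \<nu> < \<infinity>)"

text \<open>Meaningful only for non-polar compact \<open>K\<close>, where the minimizer exists and is unique.\<close>

definition equilibrium_measure :: "complex set \<Rightarrow> complex measure" where
  "equilibrium_measure K =
     (THE \<nu>. \<nu> \<in> prob_measures_on K \<and> (\<forall>\<nu>'\<in>prob_measures_on K. log_energy \<nu> \<le> log_energy \<nu>'))"

text \<open>Polar sets have capacity \<open>0\<close> by convention. For non-polar compact sets the minimal energy is
  a real number, so that \<^const>\<open>real_of_ereal\<close> loses nothing.\<close>

definition log_capacity :: "complex set \<Rightarrow> real" where
  "log_capacity K =
     (if non_polar K then exp (- real_of_ereal (log_energy (equilibrium_measure K))) else 0)"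

definition log_weakly_converges :: "(nat \<Rightarrow> complex measure) \<Rightarrow> complex measure \<Rightarrow> bool" where
  "log_weakly_converges \<mu>s \<mu> \<longleftrightarrow>
     (\<forall>n. \<mu>s n \<in> P_log) \<and> \<mu> \<in> P_log \<and>
     (\<forall>f :: complex \<Rightarrow> real.
        continuous_on UNIV f \<longrightarrow>
        (\<exists>A B. \<forall>z. \<bar>f z\<bar> \<le> A + B * log_plus (cmod z)) \<longrightarrow>
        (\<lambda>n. integral\<^sup>L (\<mu>s n) f) \<longlonglongrightarrow> integral\<^sup>L \<mu> f)"

end

theory Submission
  imports Defs "HOL-Computational_Algebra.Fundamental_Theorem_Algebra"
begin

text \<open>
  If \<open>\<mu>\<close> is a log-weak limit of equilibrium measures of sets of capacity one, then the bound \<open>U \<le> 0\<close> of the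
  equilibrium potentials passes to the limit by testing against continuous truncations of the kernel.
  The bound itself comes from Fekete points: the Lagrange basis polynomials add up to \<open>1\<close>, which bounds the
  nodal polynomial from below off the nodes, so that a weak limit of Fekete measures is a minimiser of the
  energy with the required potential. It is the only one since the logarithmic energy is positive definite on
  neutral measures, being an integral of Gaussian energies by Frullani's formula.

  Conversely, a monic polynomial \<open>p\<close> of degree \<open>m\<close> has a lemniscate \<open>\<bar>p\<bar> \<le> 1\<close> of capacity one, with equilibrium
  potential \<open>min (U, 0)\<close> where \<open>U = - ln \<bar>p\<bar> / m\<close> is the potential of the roots. If the root distributions
  converge to \<open>\<mu>\<close> and the potential of \<open>\<mu>\<close> is nonpositive, the cutoff disappears in the limit, so the
  equilibrium measures converge to \<open>\<mu>\<close> as well.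
\<close>

section \<open>Regularised potentials and energies\<close>

text \<open>The logarithmic kernel is unbounded on the diagonal, so weak convergence only shows that
  the potential of a limit is at most the lower limit of the potentials. Bounds
  \<open>U \<le> c\<close> are therefore used in the form that \<open>rpot d\<close> is at most
  \<open>c\<close> for every \<open>d > 0\<close>, which passes to weak limits. A substitute for the
  opposite inequality comes from averaging over a short horizontal segment: the averaged kernel has
  a continuous majorant, so a bound on the limit potential at \<open>z\<close> yields a point near
  \<open>z\<close> where the approximating potentials are almost as small, and the Lipschitz bound
  for \<open>rpot d\<close> carries the estimate back to \<open>z\<close>. Horizontal lines meet a
  level curve of a polynomial in finitely many points, so the curve, where the lemniscate potential
  is not identified exactly, can be avoided. Frostman's theorem is replaced by polynomials:
  lemniscates bound energies from below, hence also sup norms of monic polynomials, and this feeds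
  the Fekete points. For mass near infinity, \<mu> is conditioned on a large disc and slightly
  dilated, which keeps the potential nonpositive.\<close>

text \<open>A continuous kernel that increases to \<^const>\<open>log_kernel\<close>, diagonal included, as \<open>d\<close> decreases to \<open>0\<close>.\<close>

definition lker :: "real \<Rightarrow> complex \<Rightarrow> complex \<Rightarrow> real" where
  "lker d w z = - ln ((cmod (w - z))\<^sup>2 + d) / 2"

definition rpot :: "real \<Rightarrow> complex measure \<Rightarrow> complex \<Rightarrow> real" where
  "rpot d \<nu> z = (\<integral>w. lker d w z \<partial>\<nu>)"

definition renergy :: "real \<Rightarrow> complex measure \<Rightarrow> complex measure \<Rightarrow> real" where
  "renergy d \<nu> \<nu>' = (\<integral>z. rpot d \<nu> z \<partial>\<nu>')"

lemma cmod_sq_add_pos: "0 < d \<Longrightarrow> 0 < (cmod z)\<^sup>2 + d"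
  by (simp add: add_nonneg_pos)

lemma lker_antimono: "0 < d \<Longrightarrow> d \<le> d' \<Longrightarrow> lker d' w z \<le> lker d w z"
  unfolding lker_def using cmod_sq_add_pos[of d "w - z"] by (simp add: divide_right_mono)

lemma lker_le: "0 < d \<Longrightarrow> lker d w z \<le> - ln d / 2"
  unfolding lker_def by (simp add: divide_right_mono add_nonneg_pos)

lemma lker_commute: "lker d w z = lker d z w"
  unfolding lker_def by (simp add: norm_minus_commute)

lemma lker_ge:
  assumes "0 < d" "cmod (w - z) \<le> r"
  shows "- ln (r\<^sup>2 + d) / 2 \<le> lker d w z"
proof -
  have "(cmod (w - z))\<^sup>2 \<le> r\<^sup>2" using assms(2) by (simp add: power_mono)
  thus ?thesis unfolding lker_def using cmod_sq_add_pos[OF assms(1), of "w - z"]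
    by (simp add: divide_right_mono)
qed

lemma lker_le_neg_ln:
  assumes "0 < d" "0 < r" "r \<le> cmod (w - z)"
  shows "lker d w z \<le> - ln r"
proof -
  have "ln (r\<^sup>2) \<le> ln ((cmod (w - z))\<^sup>2 + d)"
    using assms by (intro ln_mono) (auto intro!: add_nonneg_pos simp: power_mono add_increasing2)
  thus ?thesis using assms(2) by (simp add: lker_def ln_realpow)
qed

text \<open>\<open>lker d w z\<close> is minus the logarithm of the Euclidean norm of the pair
  \<open>cmod (w - z)\<close>, \<open>sqrt d\<close>. That norm is 1-Lipschitz in \<open>z\<close>
  by Minkowski's inequality and at least \<open>sqrt d\<close>, where the logarithm has slope at
  most \<open>1 / sqrt d\<close>. The constant is free of \<open>w\<close>, so it survives
  integration and lets a bound on a potential move to a nearby point.\<close>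

lemma lker_lipschitz:
  assumes d: "0 < d"
  shows "\<bar>lker d w z - lker d w z'\<bar> \<le> cmod (z - z') / sqrt d"
proof -
  have *: "lker d w z' - lker d w z \<le> cmod (z - z') / sqrt d" for z z'
  proof -
    define a where "a = sqrt ((cmod (w - z))\<^sup>2 + d)"
    define b where "b = sqrt ((cmod (w - z'))\<^sup>2 + d)"
    have pos: "sqrt d \<le> b" "sqrt d > 0" "a > 0" using d cmod_sq_add_pos[OF d, of "w - z"] by (auto simp: a_def b_def)
    hence bp: "b > 0" by linarith
    have "a = sqrt ((cmod (w - z))\<^sup>2 + (sqrt d)\<^sup>2)" using d by (simp add: a_def)
    also have "\<dots> \<le> sqrt ((cmod (w - z') + cmod (z - z'))\<^sup>2 + (sqrt d + 0)\<^sup>2)"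
      using norm_triangle_ineq[of "w - z'" "z' - z"]
      by (auto intro!: real_sqrt_le_mono power_mono simp: norm_minus_commute)
    also have "\<dots> \<le> sqrt ((cmod (w - z'))\<^sup>2 + (sqrt d)\<^sup>2) + sqrt ((cmod (z - z'))\<^sup>2 + 0\<^sup>2)"
      by (rule real_sqrt_sum_squares_triangle_ineq)
    also have "\<dots> = b + cmod (z - z')" using d by (simp add: b_def)
    finally have ab: "a - b \<le> cmod (z - z')" by simp
    have "lker d w z = - ln a" "lker d w z' = - ln b"
      unfolding lker_def a_def b_def using cmod_sq_add_pos[OF d, of "w - z"] cmod_sq_add_pos[OF d, of "w - z'"]
      by (simp_all add: ln_sqrt)
    hence "lker d w z' - lker d w z = ln (a / b)" using pos bp by (simp add: ln_div)
    also have "\<dots> \<le> a / b - 1" using pos bp by (intro ln_le_minus_one) simp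
    also have "\<dots> = (a - b) / b" using bp by (simp add: field_simps)
    also have "\<dots> \<le> cmod (z - z') / b" using ab bp by (intro divide_right_mono) auto
    also have "\<dots> \<le> cmod (z - z') / sqrt d" using pos bp by (intro divide_left_mono mult_pos_pos) auto
    finally show ?thesis .
  qed
  show ?thesis using *[of z z'] *[of z' z] by (auto simp: norm_minus_commute abs_le_iff)
qed

lemma continuous_on_lker [continuous_intros]:
  assumes "0 < d" "continuous_on A f" "continuous_on A g"
  shows "continuous_on A (\<lambda>x. lker d (f x) (g x))"
proof -
  have "(cmod (f x - g x))\<^sup>2 + d \<noteq> 0" for x
    using cmod_sq_add_pos[OF assms(1), of "f x - g x"] by linarith
  thus ?thesis unfolding lker_def by (intro continuous_intros assms) auto
qed

lemma borel_measurable_lker [measurable (raw)]: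
  assumes "f \<in> borel_measurable M" "g \<in> borel_measurable M"
  shows "(\<lambda>x. lker d (f x) (g x)) \<in> borel_measurable M"
  unfolding lker_def using assms by measurable

section \<open>Logarithmic growth and the limit of vanishing regularisation\<close>

lemma log_plus_nonneg: "0 \<le> log_plus x"
  by (simp add: log_plus_def)

lemma log_plus_alt: "0 \<le> x \<Longrightarrow> log_plus x = ln (max 1 x)"
  by (auto simp: log_plus_def max_def le_less)

lemma ln_add_le_log_plus:
  assumes "0 \<le> x" "0 \<le> c" "0 < x + c"
  shows "ln (x + c) \<le> ln (1 + c) + log_plus x"
proof -
  have "x + c \<le> max 1 x * (1 + c)"
    using assms mult_nonneg_nonneg[of x c] mult_right_mono[of 1 x c] by (auto simp: max_def algebra_simps)
  hence "ln (x + c) \<le> ln (max 1 x * (1 + c))" using assms by (intro ln_mono) auto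
  also have "\<dots> = ln (1 + c) + log_plus x" using assms by (subst ln_mult) (auto simp: log_plus_alt)
  finally show ?thesis .
qed

text \<open>Growth of the shape \<open>A + B * log_plus\<close> makes the kernel an admissible test
  function for log-weak convergence and integrable for every measure in \<open>P_log\<close>. The
  factor 1 is written out so that the bound matches that shape.\<close>

lemma abs_lker_le:
  assumes d: "0 < d"
  shows "\<bar>lker d w z\<bar> \<le> (\<bar>ln d\<bar> / 2 + ln (1 + (cmod z + sqrt d))) + 1 * log_plus (cmod w)"
proof -
  have "(cmod (w - z))\<^sup>2 + d \<le> (cmod (w - z) + sqrt d)\<^sup>2"
    using d by (simp add: power2_sum)
  also have "\<dots> \<le> (cmod w + (cmod z + sqrt d))\<^sup>2"
    using d norm_triangle_ineq4[of w z] by (intro power_mono) auto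
  finally have "ln ((cmod (w - z))\<^sup>2 + d) \<le> ln ((cmod w + (cmod z + sqrt d))\<^sup>2)"
    using cmod_sq_add_pos[OF d, of "w - z"] by (simp add: ln_mono)
  also have "\<dots> = 2 * ln (cmod w + (cmod z + sqrt d))"
    using d by (subst ln_realpow) (auto intro!: add_nonneg_pos)
  also have "\<dots> \<le> 2 * (ln (1 + (cmod z + sqrt d)) + log_plus (cmod w))"
    using d by (intro mult_left_mono ln_add_le_log_plus add_nonneg_pos) auto
  finally have "- lker d w z \<le> ln (1 + (cmod z + sqrt d)) + log_plus (cmod w)"
    by (simp add: lker_def)
  moreover have "lker d w z \<le> \<bar>ln d\<bar> / 2" using lker_le[OF d, of w z] by linarith
  moreover have "0 \<le> ln (1 + (cmod z + sqrt d))" using d by (intro ln_ge_zero) auto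
  ultimately show ?thesis using log_plus_nonneg[of "cmod w"] by linarith
qed

lemma inverse_Suc_decr: "m \<le> n \<Longrightarrow> inverse (real (Suc n)) \<le> inverse (real (Suc m))"
  by (simp add: le_imp_inverse_le)

text \<open>On the diagonal the regularised kernel is half of \<open>ln (n + 1)\<close> and tends to
  infinity, so the value that \<open>log_kernel\<close> sets by hand there is the monotone limit as
  well.\<close>

lemma log_kernel_eq_SUP: "log_kernel w z = (SUP n. ereal (lker (inverse (real (Suc n))) w z))"
proof -
  have "incseq (\<lambda>n. ereal (lker (inverse (real (Suc n))) w z))"
    by (auto simp: incseq_def intro!: lker_antimono inverse_Suc_decr simp del: of_nat_Suc)
  hence S: "(\<lambda>n. ereal (lker (inverse (real (Suc n))) w z)) \<longlonglongrightarrow> (SUP n. ereal (lker (inverse (real (Suc n))) w z))"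
    by (rule LIMSEQ_SUP)
  have "(\<lambda>n. ereal (lker (inverse (real (Suc n))) w z)) \<longlonglongrightarrow> log_kernel w z"
  proof (cases "w = z")
    case True
    have "filterlim (\<lambda>n. ln (real (Suc n)) * (1 / 2)) at_top sequentially"
      by (rule filterlim_at_top_mult_tendsto_pos[OF tendsto_const])
        (auto intro!: filterlim_compose[OF ln_at_top] filterlim_compose[OF filterlim_real_sequentially] filterlim_Suc simp del: of_nat_Suc)
    hence "filterlim (\<lambda>n. - ln (inverse (real (Suc n))) / 2) at_top sequentially"
      by (simp add: ln_inverse del: of_nat_Suc)
    thus ?thesis using True by (simp add: log_kernel_def lker_def tendsto_PInfty_eq_at_top del: of_nat_Suc)
  next
    case False
    have "(\<lambda>n. lker (inverse (real (Suc n))) w z) \<longlonglongrightarrow> - ln ((cmod (w - z))\<^sup>2 + 0) / 2"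
      unfolding lker_def using False by (intro tendsto_intros LIMSEQ_inverse_real_of_nat) auto
    also have "- ln ((cmod (w - z))\<^sup>2 + 0) / 2 = - ln (cmod (w - z))"
      using False by (simp add: ln_realpow)
    finally show ?thesis using False by (simp add: log_kernel_def)
  qed
  thus ?thesis using LIMSEQ_unique[OF S] by simp
qed

text \<open>The positive parts increase; the negative parts decrease and are dominated by that of
  \<open>f 0\<close>, whose integral is finite. Hence the difference in
  \<open>ereal_integral\<close> is never infinity minus infinity and passes to the limit.\<close>

lemma ereal_integral_SUP:
  fixes f :: "nat \<Rightarrow> 'a \<Rightarrow> real"
  assumes int: "\<And>n. integrable M (f n)" and inc: "\<And>m n x. m \<le> n \<Longrightarrow> f m x \<le> f n x"
  shows "ereal_integral M (\<lambda>x. SUP n. ereal (f n x)) = (SUP n. ereal (integral\<^sup>L M (f n)))"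
proof -
  let ?F = "\<lambda>x. SUP n. ereal (f n x)"
  have lim: "(\<lambda>n. ereal (f n x)) \<longlonglongrightarrow> ?F x" for x
    by (rule LIMSEQ_SUP) (auto simp: incseq_def inc)
  have [measurable]: "f n \<in> borel_measurable M" for n using int by auto
  have pos: "(\<lambda>n. \<integral>\<^sup>+x. ennreal (f n x) \<partial>M) \<longlonglongrightarrow> (\<integral>\<^sup>+x. e2ennreal (?F x) \<partial>M)"
  proof (rule nn_integral_LIMSEQ)
    show "incseq (\<lambda>n x. ennreal (f n x))" by (auto simp: incseq_def le_fun_def inc intro: ennreal_leI)
    fix x show "(\<lambda>n. ennreal (f n x)) \<longlonglongrightarrow> e2ennreal (?F x)"
      using tendsto_e2ennrealI[OF lim[of x]] by (simp add: e2ennreal_ereal)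
  qed simp
  have neg: "(\<lambda>n. \<integral>\<^sup>+x. ennreal (- f n x) \<partial>M) \<longlonglongrightarrow> (\<integral>\<^sup>+x. e2ennreal (- ?F x) \<partial>M)"
  proof (rule nn_integral_dominated_convergence[where w = "\<lambda>x. ennreal (- f 0 x)"])
    show "(\<integral>\<^sup>+x. ennreal (- f 0 x) \<partial>M) < \<infinity>"
      using int[of 0] by (auto simp: real_integrable_def less_top)
    show "AE x in M. (\<lambda>n. ennreal (- f n x)) \<longlonglongrightarrow> e2ennreal (- ?F x)"
    proof (rule AE_I2)
      fix x have "(\<lambda>n. - ereal (f n x)) \<longlonglongrightarrow> - ?F x" by (intro tendsto_intros lim)
      from tendsto_e2ennrealI[OF this] show "(\<lambda>n. ennreal (- f n x)) \<longlonglongrightarrow> e2ennreal (- ?F x)"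
        by (simp add: e2ennreal_ereal)
    qed
    show "AE x in M. ennreal (- f j x) \<le> ennreal (- f 0 x)" for j
      by (intro AE_I2 ennreal_leI) (simp add: inc)
    show "(\<lambda>x. e2ennreal (- ?F x)) \<in> borel_measurable M" by measurable
  qed simp_all
  have fin: "(\<integral>\<^sup>+x. e2ennreal (- ?F x) \<partial>M) < \<infinity>"
  proof -
    have "(\<integral>\<^sup>+x. e2ennreal (- ?F x) \<partial>M) \<le> (\<integral>\<^sup>+x. ennreal (- f 0 x) \<partial>M)"
    proof (rule nn_integral_mono)
      fix x have "ereal (f 0 x) \<le> ?F x" by (rule SUP_upper) simp
      hence "- ?F x \<le> ereal (- f 0 x)" by (simp add: ereal_uminus_le_reorder flip: uminus_ereal.simps)
      thus "e2ennreal (- ?F x) \<le> ennreal (- f 0 x)" by (metis e2ennreal_ereal e2ennreal_mono)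
    qed
    also have "\<dots> < \<infinity>" using int[of 0] by (auto simp: real_integrable_def less_top)
    finally show ?thesis .
  qed
  have "(\<lambda>n. enn2ereal (\<integral>\<^sup>+x. ennreal (f n x) \<partial>M) - enn2ereal (\<integral>\<^sup>+x. ennreal (- f n x) \<partial>M)) \<longlonglongrightarrow>
    enn2ereal (\<integral>\<^sup>+x. e2ennreal (?F x) \<partial>M) - enn2ereal (\<integral>\<^sup>+x. e2ennreal (- ?F x) \<partial>M)"
  proof (rule tendsto_diff_ereal_general)
    have "enn2ereal (\<integral>\<^sup>+x. e2ennreal (- ?F x) \<partial>M) \<noteq> \<infinity>"
      using fin by (metis enn2ereal_top infinity_ennreal_def less_irrefl enn2ereal_eq_top_iff top_ereal_def)
    moreover have "enn2ereal (\<integral>\<^sup>+x. e2ennreal (?F x) \<partial>M) \<noteq> - \<infinity>"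
      using enn2ereal_nonneg[of "\<integral>\<^sup>+x. e2ennreal (?F x) \<partial>M"] by auto
    ultimately show "\<not> ((enn2ereal (\<integral>\<^sup>+x. e2ennreal (?F x) \<partial>M) = \<infinity> \<and> enn2ereal (\<integral>\<^sup>+x. e2ennreal (- ?F x) \<partial>M) = \<infinity>) \<or>
        (enn2ereal (\<integral>\<^sup>+x. e2ennreal (?F x) \<partial>M) = - \<infinity> \<and> enn2ereal (\<integral>\<^sup>+x. e2ennreal (- ?F x) \<partial>M) = - \<infinity>))"
      by auto
  qed (use pos neg in auto)
  moreover have "enn2ereal (\<integral>\<^sup>+x. ennreal (f n x) \<partial>M) - enn2ereal (\<integral>\<^sup>+x. ennreal (- f n x) \<partial>M) = ereal (integral\<^sup>L M (f n))" for n
  proof -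
    have "(\<integral>\<^sup>+x. ennreal (f n x) \<partial>M) \<noteq> \<infinity>" "(\<integral>\<^sup>+x. ennreal (- f n x) \<partial>M) \<noteq> \<infinity>"
      using int[of n] by (auto simp: real_integrable_def)
    then obtain a b where ab: "(\<integral>\<^sup>+x. ennreal (f n x) \<partial>M) = ennreal a" "(\<integral>\<^sup>+x. ennreal (- f n x) \<partial>M) = ennreal b" "0 \<le> a" "0 \<le> b"
      by (metis ennreal_cases infinity_ennreal_def)
    show ?thesis unfolding real_lebesgue_integral_def[OF int[of n]] ab using ab(3,4) by (simp add: enn2ereal_ennreal)
  qed
  moreover have "(\<lambda>n. ereal (integral\<^sup>L M (f n))) \<longlonglongrightarrow> (SUP n. ereal (integral\<^sup>L M (f n)))"
    by (rule LIMSEQ_SUP) (auto simp: incseq_def intro!: integral_mono int inc)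
  ultimately show ?thesis unfolding ereal_integral_def by (simp add: LIMSEQ_unique)
qed

lemma P_logD:
  assumes "\<mu> \<in> P_log"
  shows "prob_space \<mu>" "sets \<mu> = sets borel" "space \<mu> = UNIV" "integrable \<mu> (\<lambda>z. log_plus (cmod z))"
  using assms sets_eq_imp_space_eq[of \<mu> borel] by (auto simp: P_log_def)

lemma P_log_measurable: "\<mu> \<in> P_log \<Longrightarrow> f \<in> borel_measurable borel \<Longrightarrow> f \<in> borel_measurable \<mu>"
  using P_logD(2)[of \<mu>] measurable_cong_sets[of \<mu> borel borel borel] by auto

lemma integrable_log_growth:
  fixes f :: "complex \<Rightarrow> real"
  assumes \<mu>: "\<mu> \<in> P_log" and f: "f \<in> borel_measurable borel"
    and le: "\<And>z. \<bar>f z\<bar> \<le> A + B * log_plus (cmod z)"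
  shows "integrable \<mu> f"
proof (rule Bochner_Integration.integrable_bound)
  interpret prob_space \<mu> by (rule P_logD[OF \<mu>])
  show "integrable \<mu> (\<lambda>z. A + B * log_plus (cmod z))" using P_logD(4)[OF \<mu>] by simp
  show "AE x in \<mu>. norm (f x) \<le> norm (A + B * log_plus (cmod x))"
  proof (rule AE_I2)
    fix x show "norm (f x) \<le> norm (A + B * log_plus (cmod x))" using le[of x] by simp
  qed
qed (rule P_log_measurable[OF \<mu> f])

lemma borel_measurable_continuous_UNIV: "continuous_on UNIV f \<Longrightarrow> f \<in> borel_measurable borel"
  by (rule borel_measurable_continuous_onI)

lemma integrable_lker:
  assumes "\<mu> \<in> P_log" "0 < d"
  shows "integrable \<mu> (\<lambda>w. lker d w z)"
  by (rule integrable_log_growth[OF assms(1) _ abs_lker_le[OF assms(2)]]) simp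

lemma rpot_antimono:
  assumes "\<mu> \<in> P_log" "0 < d" "d \<le> d'"
  shows "rpot d' \<mu> z \<le> rpot d \<mu> z"
  unfolding rpot_def using assms by (intro integral_mono integrable_lker lker_antimono) auto

lemma rpot_lipschitz:
  assumes \<mu>: "\<mu> \<in> P_log" and d: "0 < d"
  shows "\<bar>rpot d \<mu> z - rpot d \<mu> z'\<bar> \<le> cmod (z - z') / sqrt d"
proof -
  interpret prob_space \<mu> by (rule P_logD[OF \<mu>])
  have "\<bar>rpot d \<mu> z - rpot d \<mu> z'\<bar> = \<bar>\<integral>w. lker d w z - lker d w z' \<partial>\<mu>\<bar>"
    unfolding rpot_def using integrable_lker[OF \<mu> d] by simp
  also have "\<dots> \<le> (\<integral>w. \<bar>lker d w z - lker d w z'\<bar> \<partial>\<mu>)" by (rule integral_abs_bound)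
  also have "\<dots> \<le> (\<integral>w. cmod (z - z') / sqrt d \<partial>\<mu>)"
    using lker_lipschitz[OF d] integrable_lker[OF \<mu> d] by (intro integral_mono) auto
  finally show ?thesis by (simp add: prob_space)
qed

lemma continuous_on_rpot:
  assumes "\<mu> \<in> P_log" "0 < d"
  shows "continuous_on A (rpot d \<mu>)"
proof (rule continuous_onI)
  fix x e assume "0 < (e::real)"
  show "\<exists>\<eta>>0. \<forall>x'\<in>A. dist x' x < \<eta> \<longrightarrow> dist (rpot d \<mu> x') (rpot d \<mu> x) \<le> e"
  proof (intro exI[of _ "e * sqrt d"] conjI ballI impI)
    fix x' assume "dist x' x < e * sqrt d"
    hence "cmod (x' - x) / sqrt d \<le> e" using assms by (simp add: dist_norm field_simps)
    thus "dist (rpot d \<mu> x') (rpot d \<mu> x) \<le> e" using rpot_lipschitz[OF assms, of x' x] by (simp add: dist_real_def)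
  qed (use \<open>0 < e\<close> assms in auto)
qed

text \<open>An index \<open>n\<close> with \<open>1 / (n + 1) < d\<close> turns the supremum along
  the sequence into a condition on all \<open>d > 0\<close>. Later bounds on potentials and energies
  are stated in this form, free of extended reals.\<close>

lemma SUP_inverse_Suc_le_iff:
  fixes g :: "real \<Rightarrow> real"
  assumes "\<And>d d'. 0 < d \<Longrightarrow> d \<le> d' \<Longrightarrow> g d' \<le> g d"
  shows "(SUP n. ereal (g (inverse (real (Suc n))))) \<le> ereal c \<longleftrightarrow> (\<forall>d>0. g d \<le> c)"
proof
  assume *: "(SUP n. ereal (g (inverse (real (Suc n))))) \<le> ereal c"
  show "\<forall>d>0. g d \<le> c"
  proof (intro allI impI)
    fix d :: real assume "0 < d"
    then obtain n where n: "inverse (real (Suc n)) < d" using reals_Archimedean by blast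
    hence "g d \<le> g (inverse (real (Suc n)))" by (intro assms) auto
    also have "\<dots> \<le> c" using * by (simp add: SUP_le_iff)
    finally show "g d \<le> c" .
  qed
qed (auto simp: SUP_le_iff simp del: of_nat_Suc)

lemma potential_eq_SUP:
  assumes "\<mu> \<in> P_log"
  shows "potential \<mu> z = (SUP n. ereal (rpot (inverse (real (Suc n))) \<mu> z))"
  unfolding potential_def log_kernel_eq_SUP rpot_def
  by (rule ereal_integral_SUP)
    (auto intro!: integrable_lker assms lker_antimono inverse_Suc_decr simp del: of_nat_Suc)

lemma potential_le_iff:
  assumes "\<mu> \<in> P_log"
  shows "potential \<mu> z \<le> ereal c \<longleftrightarrow> (\<forall>d>0. rpot d \<mu> z \<le> c)"
  unfolding potential_eq_SUP[OF assms]
  by (rule SUP_inverse_Suc_le_iff) (rule rpot_antimono[OF assms])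

section \<open>Probability measures carried by a compact set\<close>

lemma prob_measures_onD:
  assumes "\<nu> \<in> prob_measures_on K"
  shows "prob_space \<nu>" "sets \<nu> = sets borel" "space \<nu> = UNIV" "emeasure \<nu> K = 1"
  using assms sets_eq_imp_space_eq[of \<nu> borel] by (auto simp: prob_measures_on_def)

lemma prob_measures_on_AE:
  assumes \<nu>: "\<nu> \<in> prob_measures_on K" and K: "closed K"
  shows "AE w in \<nu>. w \<in> K"
proof -
  interpret prob_space \<nu> by (rule prob_measures_onD[OF \<nu>])
  have "K \<in> sets \<nu>" using prob_measures_onD(2)[OF \<nu>] K by auto
  thus ?thesis using prob_measures_onD(4)[OF \<nu>] by (simp add: emeasure_eq_measure prob_eq_1)
qed

lemma prob_measures_onI:
  assumes "prob_space \<nu>" "sets \<nu> = sets borel" "closed K" "AE w in \<nu>. w \<in> K"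
  shows "\<nu> \<in> prob_measures_on K"
proof -
  interpret prob_space \<nu> by fact
  have "K \<in> sets \<nu>" using assms by auto
  thus ?thesis using assms by (auto simp: prob_measures_on_def emeasure_eq_1_AE)
qed

lemma prob_measures_on_mono:
  assumes "\<nu> \<in> prob_measures_on K" "closed K" "closed K'" "K \<subseteq> K'"
  shows "\<nu> \<in> prob_measures_on K'"
  using prob_measures_on_AE[OF assms(1,2)] prob_measures_onD[OF assms(1)] assms(3,4)
  by (intro prob_measures_onI) (auto elim: AE_mp)

lemma prob_measures_on_measurable:
  "\<nu> \<in> prob_measures_on K \<Longrightarrow> f \<in> borel_measurable borel \<Longrightarrow> f \<in> borel_measurable \<nu>"
  using prob_measures_onD(2)[of \<nu> K] measurable_cong_sets[of \<nu> borel borel borel] by auto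

lemma prob_measures_on_integrable_bounded:
  fixes f :: "complex \<Rightarrow> real"
  assumes \<nu>: "\<nu> \<in> prob_measures_on K" and K: "closed K" and f: "f \<in> borel_measurable borel"
    and le: "\<And>w. w \<in> K \<Longrightarrow> \<bar>f w\<bar> \<le> B"
  shows "integrable \<nu> f"
proof -
  interpret prob_space \<nu> by (rule prob_measures_onD[OF \<nu>])
  show ?thesis
    using prob_measures_on_AE[OF \<nu> K] le
    by (intro integrable_const_bound[of _ B] prob_measures_on_measurable[OF \<nu> f]) (auto elim: AE_mp)
qed

lemma prob_measures_on_integrable:
  fixes f :: "complex \<Rightarrow> real"
  assumes \<nu>: "\<nu> \<in> prob_measures_on K" and K: "compact K" and f: "continuous_on UNIV f"
  shows "integrable \<nu> f"
proof -
  have "compact (f ` K)" using f K compact_continuous_image continuous_on_subset by blast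
  then obtain B where "\<And>w. w \<in> K \<Longrightarrow> \<bar>f w\<bar> \<le> B" using compact_imp_bounded[of "f ` K"] by (auto simp: bounded_iff)
  thus ?thesis using prob_measures_on_integrable_bounded[OF \<nu> compact_imp_closed[OF K]] borel_measurable_continuous_UNIV[OF f] by blast
qed

lemma prob_measures_on_P_log:
  assumes \<nu>: "\<nu> \<in> prob_measures_on K" and K: "compact K"
  shows "\<nu> \<in> P_log"
proof -
  have "continuous_on UNIV (\<lambda>z. ln (max 1 (cmod z)))" by (intro continuous_intros) auto
  hence "continuous_on UNIV (\<lambda>z. log_plus (cmod z))" by (simp add: log_plus_alt)
  thus ?thesis using prob_measures_on_integrable[OF \<nu> K] prob_measures_onD[OF \<nu>] by (auto simp: P_log_def)
qed

lemma prob_measures_on_integral_le: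
  fixes f :: "complex \<Rightarrow> real"
  assumes \<nu>: "\<nu> \<in> prob_measures_on K" and K: "closed K" and f: "integrable \<nu> f" and le: "\<And>w. w \<in> K \<Longrightarrow> f w \<le> c"
  shows "(\<integral>w. f w \<partial>\<nu>) \<le> c"
proof -
  interpret prob_space \<nu> by (rule prob_measures_onD[OF \<nu>])
  have "(\<integral>w. f w \<partial>\<nu>) \<le> (\<integral>w. c \<partial>\<nu>)"
    using prob_measures_on_AE[OF \<nu> K] le by (intro integral_mono_AE f) (auto elim: AE_mp)
  thus ?thesis by (simp add: prob_space)
qed

lemma prob_measures_on_integral_ge:
  fixes f :: "complex \<Rightarrow> real"
  assumes \<nu>: "\<nu> \<in> prob_measures_on K" and K: "closed K" and f: "integrable \<nu> f" and le: "\<And>w. w \<in> K \<Longrightarrow> c \<le> f w"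
  shows "c \<le> (\<integral>w. f w \<partial>\<nu>)"
  using prob_measures_on_integral_le[OF \<nu> K, of "\<lambda>w. - f w" "- c"] f le by auto

lemma prob_measures_on_integral_cong:
  fixes f :: "complex \<Rightarrow> real"
  assumes \<nu>: "\<nu> \<in> prob_measures_on K" and K: "closed K"
    and [measurable]: "f \<in> borel_measurable borel" "g \<in> borel_measurable borel" and eq: "\<And>w. w \<in> K \<Longrightarrow> f w = g w"
  shows "(\<integral>w. f w \<partial>\<nu>) = (\<integral>w. g w \<partial>\<nu>)"
  using prob_measures_on_AE[OF \<nu> K] eq
  by (intro integral_cong_AE prob_measures_on_measurable[OF \<nu>]) (auto elim: AE_mp)

lemma integrable_rpot:
  assumes "\<nu> \<in> prob_measures_on K" "compact K" "\<mu> \<in> P_log" "0 < d"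
  shows "integrable \<nu> (rpot d \<mu>)"
  by (rule prob_measures_on_integrable[OF assms(1,2) continuous_on_rpot[OF assms(3,4)]])

text \<open>Two monotone limits along the same sequence: the potential in the inner integral is the
  supremum of the \<open>rpot\<close>, and integrating that supremum against \<nu> gives the
  supremum of the \<open>renergy\<close>.\<close>

lemma log_energy_le_iff:
  assumes \<nu>: "\<nu> \<in> prob_measures_on K" and K: "compact K"
  shows "log_energy \<nu> \<le> ereal c \<longleftrightarrow> (\<forall>d>0. renergy d \<nu> \<nu> \<le> c)"
proof -
  note P = prob_measures_on_P_log[OF \<nu> K]
  have "log_energy \<nu> = ereal_integral \<nu> (potential \<nu>)"
    unfolding log_energy_def potential_def ..
  also have "\<dots> = ereal_integral \<nu> (\<lambda>z. SUP n. ereal (rpot (inverse (real (Suc n))) \<nu> z))"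
    by (intro arg_cong[of _ _ "ereal_integral \<nu>"] ext potential_eq_SUP[OF P])
  also have "\<dots> = (SUP n. ereal (renergy (inverse (real (Suc n))) \<nu> \<nu>))"
    unfolding renergy_def
    by (rule ereal_integral_SUP) (auto intro!: integrable_rpot[OF \<nu> K P] rpot_antimono[OF P] inverse_Suc_decr simp del: of_nat_Suc)
  finally have E: "log_energy \<nu> = (SUP n. ereal (renergy (inverse (real (Suc n))) \<nu> \<nu>))" .
  have "renergy d' \<nu> \<nu> \<le> renergy d \<nu> \<nu>" if "0 < d" "d \<le> d'" for d d'
    unfolding renergy_def using that by (intro integral_mono integrable_rpot[OF \<nu> K P] rpot_antimono[OF P]) auto
  thus ?thesis unfolding E by (rule SUP_inverse_Suc_le_iff)
qed

text \<open>The product measure lives on \<open>K' \<times> K\<close>, where a continuous kernel is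
  bounded; this gives integrability also for kernels that are unbounded on the plane.\<close>

lemma Fubini_prob_measures_on:
  fixes k :: "complex \<Rightarrow> complex \<Rightarrow> real"
  assumes \<nu>: "\<nu> \<in> prob_measures_on K" "compact K" and \<nu>': "\<nu>' \<in> prob_measures_on K'" "compact K'"
    and k: "continuous_on UNIV (\<lambda>(z, w). k z w)"
  shows "(\<integral>z. (\<integral>w. k z w \<partial>\<nu>) \<partial>\<nu>') = (\<integral>w. (\<integral>z. k z w \<partial>\<nu>') \<partial>\<nu>)"
proof -
  interpret A: prob_space \<nu> by (rule prob_measures_onD[OF \<nu>(1)])
  interpret B: prob_space \<nu>' by (rule prob_measures_onD[OF \<nu>'(1)])
  interpret pair_prob_space \<nu>' \<nu> ..
  have sets: "sets (\<nu>' \<Otimes>\<^sub>M \<nu>) = sets borel"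
    using sets_pair_measure_cong[OF prob_measures_onD(2)[OF \<nu>'(1)] prob_measures_onD(2)[OF \<nu>(1)]] unfolding borel_prod .
  have KK: "K' \<in> sets \<nu>'" "K \<in> sets \<nu>"
    using borel_compact[OF \<nu>(2)] borel_compact[OF \<nu>'(2)]
    by (simp_all add: prob_measures_onD(2)[OF \<nu>(1)] prob_measures_onD(2)[OF \<nu>'(1)])
  have "emeasure (\<nu>' \<Otimes>\<^sub>M \<nu>) (K' \<times> K) = 1"
    using KK prob_measures_onD(4)[OF \<nu>(1)] prob_measures_onD(4)[OF \<nu>'(1)] by (simp add: A.emeasure_pair_measure_Times)
  hence AE: "AE x in \<nu>' \<Otimes>\<^sub>M \<nu>. x \<in> K' \<times> K"
    using KK by (simp add: P.emeasure_eq_measure P.prob_eq_1 del: mem_Times_iff)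
  have "compact ((\<lambda>(z, w). k z w) ` (K' \<times> K))"
    using \<nu> \<nu>' by (intro compact_continuous_image continuous_on_subset[OF k] compact_Times) auto
  then obtain B where "\<forall>y \<in> (\<lambda>(z, w). k z w) ` (K' \<times> K). norm y \<le> B"
    using compact_imp_bounded bounded_iff by metis
  hence B: "\<bar>case x of (z, w) \<Rightarrow> k z w\<bar> \<le> B" if "x \<in> K' \<times> K" for x using that by force
  have "integrable (\<nu>' \<Otimes>\<^sub>M \<nu>) (\<lambda>(z, w). k z w)"
  proof (rule P.integrable_const_bound)
    show "AE x in \<nu>' \<Otimes>\<^sub>M \<nu>. norm (case x of (z, w) \<Rightarrow> k z w) \<le> B" using AE
    proof eventually_elim
      case (elim x) show ?case using B[OF elim] by (simp add: case_prod_unfold)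
    qed
    show "(\<lambda>(z, w). k z w) \<in> borel_measurable (\<nu>' \<Otimes>\<^sub>M \<nu>)"
      using borel_measurable_continuous_UNIV[OF k] unfolding measurable_cong_sets[OF sets refl] .
  qed
  from Fubini_integral[OF this] show ?thesis by simp
qed

lemma renergy_commute:
  assumes "\<nu> \<in> prob_measures_on K" "compact K" "\<nu>' \<in> prob_measures_on K'" "compact K'" "0 < d"
  shows "renergy d \<nu> \<nu>' = renergy d \<nu>' \<nu>"
proof -
  have "continuous_on UNIV (\<lambda>(z, w). lker d w z)"
    unfolding case_prod_unfold by (intro continuous_intros assms)
  from Fubini_prob_measures_on[OF assms(1-4) this] show ?thesis
    unfolding renergy_def rpot_def by (subst (2) lker_commute) simp
qed

section \<open>The energy principle\<close>

text \<open>The quotient is the integral of \<open>exp (- (t * u))\<close> over \<open>u\<close> in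
  \<open>{a..b}\<close>. After exchanging the nonnegative integrals, the one in \<open>t\<close>
  gives \<open>1 / u\<close> and the one in \<open>u\<close> the logarithm.\<close>

lemma Frullani_exp:
  fixes a b :: real
  assumes a: "0 < a" and ab: "a \<le> b"
  shows "has_bochner_integral lborel (\<lambda>t. indicator {0<..} t * ((exp (- (t * a)) - exp (- (t * b))) / t)) (ln (b / a))"
proof -
  let ?f = "\<lambda>t. indicator {0<..} t * ((exp (- (t * a)) - exp (- (t * b))) / t)"
  have nn: "0 \<le> ?f t" for t :: real using a ab by (auto simp: indicator_def intro!: divide_nonneg_pos mult_left_mono)
  have "(\<integral>\<^sup>+t. ennreal (?f t) \<partial>lborel) =
      (\<integral>\<^sup>+t. (\<integral>\<^sup>+u. ennreal (exp (- (t * u))) * indicator {0<..} t * indicator {a..b} u \<partial>lborel) \<partial>lborel)"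
  proof (rule nn_integral_cong)
    fix t :: real
    show "ennreal (?f t) = (\<integral>\<^sup>+u. ennreal (exp (- (t * u))) * indicator {0<..} t * indicator {a..b} u \<partial>lborel)"
    proof (cases "0 < t")
      case True
      have "(\<integral>\<^sup>+u. ennreal (exp (- (t * u))) * indicator {a..b} u \<partial>lborel) =
          ennreal (- exp (- (t * b)) / t - - exp (- (t * a)) / t)"
        using True ab by (intro nn_integral_FTC_Icc) (auto intro!: derivative_eq_intros)
      thus ?thesis using True by (simp add: diff_divide_distrib)
    qed simp
  qed
  also have "\<dots> = (\<integral>\<^sup>+u. (\<integral>\<^sup>+t. ennreal (exp (- (t * u))) * indicator {0<..} t * indicator {a..b} u \<partial>lborel) \<partial>lborel)"
    by (rule lborel_pair.Fubini') measurable
  also have "\<dots> = (\<integral>\<^sup>+u. ennreal (1 / u) * indicator {a..b} u \<partial>lborel)"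
  proof (rule nn_integral_cong)
    fix u :: real
    show "(\<integral>\<^sup>+t. ennreal (exp (- (t * u))) * indicator {0<..} t * indicator {a..b} u \<partial>lborel) = ennreal (1 / u) * indicator {a..b} u"
    proof (cases "u \<in> {a..b}")
      case True
      hence u: "0 < u" using a by auto
      have "(\<integral>\<^sup>+t. ennreal (exp (- (t * u))) * indicator {0<..} t \<partial>lborel) = (\<integral>\<^sup>+t. ennreal (exp (- (t * u))) * indicator {0..} t \<partial>lborel)"
        by (intro nn_integral_cong_AE) (use AE_lborel_singleton[of "0::real"] in \<open>auto elim!: eventually_mono simp: indicator_def\<close>)
      also have "\<dots> = ennreal (0 - - exp (- (0 * u)) / u)"
      proof (rule nn_integral_FTC_atLeast)
        show "((\<lambda>t. - exp (- (t * u)) / u) \<longlongrightarrow> 0) at_top" proof -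
          have "filterlim (\<lambda>t. t * u) at_top at_top"
            using u by (intro filterlim_at_top_mult_tendsto_pos[OF tendsto_const]) (auto simp: filterlim_ident mult.commute)
          hence "((\<lambda>t. exp (- (t * u))) \<longlongrightarrow> 0) at_top"
            by (intro filterlim_compose[OF exp_at_bot] filterlim_uminus_at_bot_at_top[THEN filterlim_compose])
          thus ?thesis using tendsto_divide[OF tendsto_minus tendsto_const, of _ 0 at_top u] u by auto
        qed
      qed (use u in \<open>auto intro!: derivative_eq_intros\<close>)
      finally show ?thesis using True by simp
    qed simp
  qed
  also have "\<dots> = ennreal (ln b - ln a)"
    using a ab by (intro nn_integral_FTC_Icc) (auto intro!: derivative_eq_intros)
  also have "\<dots> = ennreal (ln (b / a))" using a ab by (simp add: ln_div)
  finally show ?thesis using a ab nn by (intro has_bochner_integral_nn_integral) auto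
qed

section \<open>Gaussian energies\<close>

definition gauss :: "real \<Rightarrow> complex \<Rightarrow> complex \<Rightarrow> real" where
  "gauss t w z = exp (- (t * (cmod (w - z))\<^sup>2))"

definition gauss_energy :: "real \<Rightarrow> complex measure \<Rightarrow> complex measure \<Rightarrow> real" where
  "gauss_energy t \<nu> \<nu>' = (\<integral>z. (\<integral>w. gauss t w z \<partial>\<nu>) \<partial>\<nu>')"

definition frullani_weight :: "real \<Rightarrow> real \<Rightarrow> real \<Rightarrow> real" where
  "frullani_weight d d' t = indicator {0<..} t * ((exp (- (t * d)) - exp (- (t * d'))) / t)"

lemma borel_measurable_frullani_weight [measurable]: "frullani_weight d d' \<in> borel_measurable borel"
  unfolding frullani_weight_def by measurable

lemma borel_measurable_gauss [measurable (raw)]: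
  assumes [measurable]: "t \<in> borel_measurable M" "f \<in> borel_measurable M" "g \<in> borel_measurable M"
  shows "(\<lambda>x. gauss (t x) (f x) (g x)) \<in> borel_measurable M"
  unfolding gauss_def by measurable

text \<open>Frullani's formula for the two shifted squared distances; the common Gaussian factor
  splits off and leaves a weight free of the points. The weight is nonnegative, so a difference of
  regularised kernels is a positive mixture of Gaussians and inherits their positive
  definiteness.\<close>

lemma lker_diff:
  assumes "0 < d" "d \<le> d'"
  shows "lker d w z - lker d' w z = (\<integral>t. frullani_weight d d' t * gauss t w z \<partial>lborel) / 2"
proof -
  let ?r = "(cmod (w - z))\<^sup>2"
  have p: "0 < ?r + d" "0 < ?r + d'" using assms cmod_sq_add_pos[of _ "w - z"] by auto
  have "has_bochner_integral lborel (\<lambda>t. indicator {0<..} t * ((exp (- (t * (?r + d))) - exp (- (t * (?r + d')))) / t)) (ln ((?r + d') / (?r + d)))"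
    using assms p by (intro Frullani_exp) auto
  moreover have "indicator {0<..} t * ((exp (- (t * (?r + d))) - exp (- (t * (?r + d')))) / t) = frullani_weight d d' t * gauss t w z" for t
  proof -
    have "exp (- (t * (?r + x))) = exp (- (t * x)) * exp (- (t * ?r))" for x
      by (simp add: exp_add[symmetric] algebra_simps)
    thus ?thesis by (simp add: frullani_weight_def gauss_def left_diff_distrib diff_divide_distrib right_diff_distrib)
  qed
  ultimately have "(\<integral>t. frullani_weight d d' t * gauss t w z \<partial>lborel) = ln ((?r + d') / (?r + d))"
    by (simp add: has_bochner_integral_iff)
  thus ?thesis using p by (simp add: lker_def ln_div field_simps)
qed

lemma integrable_frullani_weight: "0 < d \<Longrightarrow> d \<le> d' \<Longrightarrow> integrable lborel (frullani_weight d d')"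
  using Frullani_exp[of d d'] by (simp add: has_bochner_integral_iff frullani_weight_def[abs_def])

lemma Fubini_weighted:
  fixes g :: "real \<Rightarrow> real" and \<phi> :: "complex \<Rightarrow> real \<Rightarrow> real"
  assumes "prob_space \<nu>" and sets[measurable_cong]: "sets \<nu> = sets borel"
    and g: "integrable lborel g" and [measurable]: "case_prod \<phi> \<in> borel_measurable (borel \<Otimes>\<^sub>M borel)"
    and le: "\<And>x t. \<bar>\<phi> x t\<bar> \<le> 1"
  shows "integrable \<nu> (\<lambda>x. \<integral>t. g t * \<phi> x t \<partial>lborel)"
    "(\<integral>x. (\<integral>t. g t * \<phi> x t \<partial>lborel) \<partial>\<nu>) = (\<integral>t. g t * (\<integral>x. \<phi> x t \<partial>\<nu>) \<partial>lborel)"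
    "integrable lborel (\<lambda>t. g t * (\<integral>x. \<phi> x t \<partial>\<nu>))"
proof -
  interpret N: prob_space \<nu> by fact
  interpret pair_sigma_finite \<nu> lborel ..
  have [measurable]: "g \<in> borel_measurable borel" using g by auto
  have I: "integrable (\<nu> \<Otimes>\<^sub>M lborel) (\<lambda>(x, t). g t * \<phi> x t)"
  proof (rule Bochner_Integration.integrable_bound)
    show "integrable (\<nu> \<Otimes>\<^sub>M lborel) (\<lambda>(x, t). g t)"
    proof (rule Fubini_integrable)
      show "integrable \<nu> (\<lambda>x. \<integral>t. norm (case (x, t) of (x, t) \<Rightarrow> g t) \<partial>lborel)" by simp
      show "AE x in \<nu>. integrable lborel (\<lambda>t. case (x, t) of (x, t) \<Rightarrow> g t)" using g by simp
    qed measurable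
    show "AE x in \<nu> \<Otimes>\<^sub>M lborel. norm (case x of (x, t) \<Rightarrow> g t * \<phi> x t) \<le> norm (case x of (x, t) \<Rightarrow> g t)"
      using le by (intro AE_I2) (auto simp: abs_mult intro!: mult_right_le_one_le)
  qed measurable
  show "integrable \<nu> (\<lambda>x. \<integral>t. g t * \<phi> x t \<partial>lborel)"
    using integrable_fst'[OF I] by simp
  show "(\<integral>x. (\<integral>t. g t * \<phi> x t \<partial>lborel) \<partial>\<nu>) = (\<integral>t. g t * (\<integral>x. \<phi> x t \<partial>\<nu>) \<partial>lborel)"
    using Fubini_integral[OF I] by simp
  show "integrable lborel (\<lambda>t. g t * (\<integral>x. \<phi> x t \<partial>\<nu>))"
    using integrable_snd[OF I] by simp
qed

lemma gauss_bounds: "0 \<le> t \<Longrightarrow> 0 \<le> gauss t w z \<and> gauss t w z \<le> 1"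
  by (simp add: gauss_def)

text \<open>Two applications of the weighted Fubini theorem, one per measure, move the mixture of
  \<open>lker_diff\<close> outside both integrals.\<close>

lemma renergy_diff:
  assumes \<nu>: "\<nu> \<in> prob_measures_on K" "compact K" and \<nu>': "\<nu>' \<in> prob_measures_on K'" "compact K'"
    and d: "0 < d" "d \<le> d'"
  shows "renergy d \<nu> \<nu>' - renergy d' \<nu> \<nu>' = (\<integral>t. frullani_weight d d' t * gauss_energy t \<nu> \<nu>' \<partial>lborel) / 2"
    and "integrable lborel (\<lambda>t. frullani_weight d d' t * gauss_energy t \<nu> \<nu>')"
proof -
  note [measurable_cong] = prob_measures_onD(2)[OF \<nu>(1)] prob_measures_onD(2)[OF \<nu>'(1)]
  interpret N: prob_space \<nu> by (rule prob_measures_onD[OF \<nu>(1)])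
  interpret N': prob_space \<nu>' by (rule prob_measures_onD[OF \<nu>'(1)])
  note P = prob_measures_on_P_log[OF \<nu>]
  \<comment> \<open>cutting the Gaussian off at negative times makes it globally bounded\<close>
  define \<gamma> where "\<gamma> t w z = (if 0 \<le> t then gauss t w z else 0)" for t w z
  have [measurable]: "(\<lambda>x. \<gamma> (t x) (f x) (g x)) \<in> borel_measurable M"
    if [measurable]: "t \<in> borel_measurable M" "f \<in> borel_measurable M" "g \<in> borel_measurable M" for t f g and M :: "'b measure"
    unfolding \<gamma>_def by measurable
  have \<gamma>b: "0 \<le> \<gamma> t w z" "\<gamma> t w z \<le> 1" for t w z using gauss_bounds[of t w z] by (auto simp: \<gamma>_def)
  have fr: "frullani_weight d d' t * (if 0 \<le> t then x else y) = frullani_weight d d' t * x" for t x y by (auto simp: frullani_weight_def)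
  have \<gamma>2: "frullani_weight d d' t * \<gamma> t w z = frullani_weight d d' t * gauss t w z" for t w z unfolding \<gamma>_def by (rule fr)
  note g = integrable_frullani_weight[OF d]
  have 1: "rpot d \<nu> z - rpot d' \<nu> z = (\<integral>t. frullani_weight d d' t * (\<integral>w. \<gamma> t w z \<partial>\<nu>) \<partial>lborel) / 2" for z
  proof -
    have "rpot d \<nu> z - rpot d' \<nu> z = (\<integral>w. lker d w z - lker d' w z \<partial>\<nu>)"
      unfolding rpot_def using integrable_lker[OF P] d by simp
    also have "\<dots> = (\<integral>w. (\<integral>t. frullani_weight d d' t * \<gamma> t w z \<partial>lborel) \<partial>\<nu>) / 2"
      unfolding \<gamma>2 lker_diff[OF d] by simp
    also have "(\<integral>w. (\<integral>t. frullani_weight d d' t * \<gamma> t w z \<partial>lborel) \<partial>\<nu>) = (\<integral>t. frullani_weight d d' t * (\<integral>w. \<gamma> t w z \<partial>\<nu>) \<partial>lborel)"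
      by (rule Fubini_weighted) (use \<gamma>b in \<open>auto intro!: N.prob_space_axioms g prob_measures_onD(2)[OF \<nu>(1)]\<close>)
    finally show ?thesis .
  qed
  have b: "\<bar>\<integral>w. \<gamma> t w z \<partial>\<nu>\<bar> \<le> 1" for t z
  proof -
    have "(\<integral>w. \<gamma> t w z \<partial>\<nu>) \<le> 1" using \<gamma>b by (intro N.integral_le_const N.integrable_const_bound[of _ 1]) auto
    moreover have "0 \<le> (\<integral>w. \<gamma> t w z \<partial>\<nu>)" using \<gamma>b by (intro integral_nonneg_AE) auto
    ultimately show ?thesis by simp
  qed
  have I: "integrable \<nu>' (rpot d \<nu>)" "integrable \<nu>' (rpot d' \<nu>)"
    using integrable_rpot[OF \<nu>' P] d by auto
  have m: "case_prod (\<lambda>z t. \<integral>w. \<gamma> t w z \<partial>\<nu>) \<in> borel_measurable (borel \<Otimes>\<^sub>M borel)"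
    unfolding case_prod_unfold by measurable
  have "renergy d \<nu> \<nu>' - renergy d' \<nu> \<nu>' = (\<integral>z. rpot d \<nu> z - rpot d' \<nu> z \<partial>\<nu>')"
    unfolding renergy_def using I by simp
  also have "\<dots> = (\<integral>z. (\<integral>t. frullani_weight d d' t * (\<integral>w. \<gamma> t w z \<partial>\<nu>) \<partial>lborel) \<partial>\<nu>') / 2"
    unfolding 1 by simp
  also have "(\<integral>z. (\<integral>t. frullani_weight d d' t * (\<integral>w. \<gamma> t w z \<partial>\<nu>) \<partial>lborel) \<partial>\<nu>') = (\<integral>t. frullani_weight d d' t * (\<integral>z. (\<integral>w. \<gamma> t w z \<partial>\<nu>) \<partial>\<nu>') \<partial>lborel)"
    by (rule Fubini_weighted(2)[OF N'.prob_space_axioms prob_measures_onD(2)[OF \<nu>'(1)] g m b])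
  also have *: "(\<lambda>t. frullani_weight d d' t * (\<integral>z. (\<integral>w. \<gamma> t w z \<partial>\<nu>) \<partial>\<nu>')) = (\<lambda>t. frullani_weight d d' t * gauss_energy t \<nu> \<nu>')"
    by (auto simp: gauss_energy_def \<gamma>_def frullani_weight_def indicator_def)
  finally show "renergy d \<nu> \<nu>' - renergy d' \<nu> \<nu>' = (\<integral>t. frullani_weight d d' t * gauss_energy t \<nu> \<nu>' \<partial>lborel) / 2" .
  show "integrable lborel (\<lambda>t. frullani_weight d d' t * gauss_energy t \<nu> \<nu>')"
    using Fubini_weighted(3)[OF N'.prob_space_axioms prob_measures_onD(2)[OF \<nu>'(1)] g m b] * by simp
qed

definition gmoment :: "real \<Rightarrow> complex measure \<Rightarrow> nat \<Rightarrow> nat \<Rightarrow> real" where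
  "gmoment t \<nu> j k = (\<integral>w. exp (- (t * (cmod w)\<^sup>2)) * (Re w ^ j * Im w ^ k) \<partial>\<nu>)"

lemma abs_exp_partial_sum_le: "\<bar>\<Sum>j<N. x ^ j / fact j\<bar> \<le> exp \<bar>x::real\<bar>"
proof -
  have s: "(\<lambda>j. \<bar>x\<bar> ^ j / fact j) sums exp \<bar>x\<bar>"
    using exp_converges[of "\<bar>x\<bar>"] by (simp add: scaleR_conv_of_real field_simps)
  have "\<bar>\<Sum>j<N. x ^ j / fact j\<bar> \<le> (\<Sum>j<N. \<bar>x\<bar> ^ j / fact j)"
    by (rule order_trans[OF sum_abs]) (simp add: power_abs)
  also have "\<dots> \<le> (\<Sum>j. \<bar>x\<bar> ^ j / fact j)"
    using s by (intro sum_le_suminf) (auto simp: sums_iff)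
  finally show ?thesis using s by (simp add: sums_iff)
qed

lemma exp_partial_sum_tendsto: "(\<lambda>N. \<Sum>j<N. x ^ j / fact j) \<longlonglongrightarrow> exp (x::real)"
  using exp_converges[of x] by (simp add: sums_def scaleR_conv_of_real field_simps)

text \<open>\<open>gauss t w z\<close> is \<open>e z * e w\<close> times the exponentials of
  \<open>2 * t * (Re z * Re w)\<close> and \<open>2 * t * (Im z * Im w)\<close>. Expanding these
  separates \<open>z\<close> from \<open>w\<close> in every term with nonnegative coefficients,
  which is the reason why the Gaussian kernel is positive definite.\<close>

lemma gauss_energy_expansion:
  assumes \<nu>: "\<nu> \<in> prob_measures_on K" "compact K" and \<nu>': "\<nu>' \<in> prob_measures_on K'" "compact K'"
    and t: "0 \<le> t"
  shows "(\<lambda>N. \<Sum>j<N. \<Sum>k<N. (2 * t) ^ j / fact j * ((2 * t) ^ k / fact k) * (gmoment t \<nu> j k * gmoment t \<nu>' j k))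
    \<longlonglongrightarrow> gauss_energy t \<nu> \<nu>'"
proof -
  interpret N: prob_space \<nu> by (rule prob_measures_onD[OF \<nu>(1)])
  interpret N': prob_space \<nu>' by (rule prob_measures_onD[OF \<nu>'(1)])
  note [measurable_cong] = prob_measures_onD(2)[OF \<nu>(1)] prob_measures_onD(2)[OF \<nu>'(1)]
  define e where "e w = exp (- (t * (cmod w)\<^sup>2))" for w
  define c where "c j = (2 * t) ^ j / fact j" for j
  define k where "k N z w = e z * e w * ((\<Sum>j<N. (2 * t * (Re z * Re w)) ^ j / fact j) * (\<Sum>j<N. (2 * t * (Im z * Im w)) ^ j / fact j))" for N z w
  have ce: "continuous_on UNIV (\<lambda>w. e w * (Re w ^ j * Im w ^ k))" for j k
    unfolding e_def by (intro continuous_intros)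
  have [measurable]: "e \<in> borel_measurable borel" unfolding e_def by measurable
  have km[measurable]: "(\<lambda>w. k N z w) \<in> borel_measurable borel" for N z unfolding k_def by measurable
  have kexp: "k N z w = (\<Sum>j<N. \<Sum>i<N. (c j * c i * (e z * (Re z ^ j * Im z ^ i))) * (e w * (Re w ^ j * Im w ^ i)))" for N z w
    unfolding k_def sum_product unfolding sum_distrib_left c_def by (intro sum.cong refl) (simp add: power_mult_distrib)
  have lin: "(\<integral>w. (\<Sum>j<N. \<Sum>i<N. A j i * F j i w) \<partial>M) = (\<Sum>j<N. \<Sum>i<N. A j i * (\<integral>w. F j i w \<partial>M))"
    if "\<And>j i. integrable M (F j i)" for A N and F :: "nat \<Rightarrow> nat \<Rightarrow> complex \<Rightarrow> real" and M :: "complex measure"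
    by (simp add: that Bochner_Integration.integral_sum)
  have gm: "(\<integral>w. e w * (Re w ^ j * Im w ^ k) \<partial>\<nu>) = gmoment t \<nu> j k" for j k \<nu> by (simp add: gmoment_def e_def)
  have ik: "(\<integral>w. k N z w \<partial>\<nu>) = (\<Sum>j<N. \<Sum>i<N. (c j * c i * gmoment t \<nu> j i) * (e z * (Re z ^ j * Im z ^ i)))" for N z
    unfolding kexp lin[OF prob_measures_on_integrable[OF \<nu> ce]] gm by (intro sum.cong refl) simp
  have iik: "(\<integral>z. (\<integral>w. k N z w \<partial>\<nu>) \<partial>\<nu>') = (\<Sum>j<N. \<Sum>i<N. c j * c i * (gmoment t \<nu> j i * gmoment t \<nu>' j i))" for N
    unfolding ik lin[OF prob_measures_on_integrable[OF \<nu>' ce]] gm by (intro sum.cong refl) simp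
  \<comment> \<open>Domination uniform in \<open>N\<close>: partial sums are at most the exponential
    of the absolute value, and the factors \<open>e\<close> then complete the squares of
    \<open>\<bar>Re z\<bar> - \<bar>Re w\<bar>\<close> and
    \<open>\<bar>Im z\<bar> - \<bar>Im w\<bar>\<close>.\<close>
  have kb: "\<bar>k N z w\<bar> \<le> 1" for N z w
  proof -
    have "\<bar>k N z w\<bar> \<le> e z * e w * (exp \<bar>2 * t * (Re z * Re w)\<bar> * exp \<bar>2 * t * (Im z * Im w)\<bar>)"
      unfolding k_def abs_mult[of "e z * e w"] abs_mult[of "sum _ _"]
      using mult_mono[OF abs_exp_partial_sum_le[of "2 * t * (Re z * Re w)" N] abs_exp_partial_sum_le[of "2 * t * (Im z * Im w)" N]]
      by (simp add: e_def)
    also have "\<dots> = exp (t * - ((\<bar>Re z\<bar> - \<bar>Re w\<bar>)\<^sup>2 + (\<bar>Im z\<bar> - \<bar>Im w\<bar>)\<^sup>2))"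
      using t by (simp add: e_def exp_add[symmetric] cmod_power2 power2_diff abs_mult algebra_simps)
    also have "\<dots> \<le> 1" using t by (auto simp: mult_nonneg_nonpos)
    finally show ?thesis .
  qed
  have kl: "(\<lambda>N. k N z w) \<longlonglongrightarrow> gauss t w z" for z w
  proof -
    have "(\<lambda>N. k N z w) \<longlonglongrightarrow> e z * e w * (exp (2 * t * (Re z * Re w)) * exp (2 * t * (Im z * Im w)))"
      unfolding k_def by (intro tendsto_intros exp_partial_sum_tendsto)
    also have "e z * e w * (exp (2 * t * (Re z * Re w)) * exp (2 * t * (Im z * Im w))) = gauss t w z"
      by (simp add: e_def gauss_def exp_add[symmetric] cmod_power2 power2_diff algebra_simps)
    finally show ?thesis .
  qed
  have 1: "(\<lambda>N. \<integral>w. k N z w \<partial>\<nu>) \<longlonglongrightarrow> (\<integral>w. gauss t w z \<partial>\<nu>)" for z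
    by (rule integral_dominated_convergence[where w = "\<lambda>_. 1"]) (use kb kl in auto)
  have kib: "\<bar>\<integral>w. k N z w \<partial>\<nu>\<bar> \<le> 1" for N z
  proof -
    have "\<bar>\<integral>w. k N z w \<partial>\<nu>\<bar> \<le> (\<integral>w. \<bar>k N z w\<bar> \<partial>\<nu>)" by (rule integral_abs_bound)
    also have "\<dots> \<le> 1" using kb by (intro N.integral_le_const N.integrable_const_bound[of _ 1]) auto
    finally show ?thesis .
  qed
  have "(\<lambda>N. \<integral>z. (\<integral>w. k N z w \<partial>\<nu>) \<partial>\<nu>') \<longlonglongrightarrow> (\<integral>z. (\<integral>w. gauss t w z \<partial>\<nu>) \<partial>\<nu>')"
  proof (rule integral_dominated_convergence[where w = "\<lambda>_. 1"])
    show "(\<lambda>z. \<integral>w. k N z w \<partial>\<nu>) \<in> borel_measurable \<nu>'" for N unfolding ik by measurable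
  qed (use kib 1 in auto)
  thus ?thesis unfolding iik gauss_energy_def c_def .
qed

text \<open>By the expansion, the Gaussian energy of the difference of the measures is a series of
  squared moment differences with positive coefficients; if it vanishes, so does every term.\<close>

lemma gauss_energy_diff:
  assumes \<nu>: "\<nu>\<^sub>1 \<in> prob_measures_on K" "\<nu>\<^sub>2 \<in> prob_measures_on K" "compact K" and t: "0 < t"
  shows "0 \<le> gauss_energy t \<nu>\<^sub>1 \<nu>\<^sub>1 + gauss_energy t \<nu>\<^sub>2 \<nu>\<^sub>2 - 2 * gauss_energy t \<nu>\<^sub>1 \<nu>\<^sub>2"
    and "gauss_energy t \<nu>\<^sub>1 \<nu>\<^sub>1 + gauss_energy t \<nu>\<^sub>2 \<nu>\<^sub>2 - 2 * gauss_energy t \<nu>\<^sub>1 \<nu>\<^sub>2 \<le> 0 \<Longrightarrow> gmoment t \<nu>\<^sub>1 j k = gmoment t \<nu>\<^sub>2 j k"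
proof -
  let ?D = "gauss_energy t \<nu>\<^sub>1 \<nu>\<^sub>1 + gauss_energy t \<nu>\<^sub>2 \<nu>\<^sub>2 - 2 * gauss_energy t \<nu>\<^sub>1 \<nu>\<^sub>2"
  define m where "m j k = gmoment t \<nu>\<^sub>1 j k - gmoment t \<nu>\<^sub>2 j k" for j k
  define c where "c j k = (2 * t) ^ j / fact j * ((2 * t) ^ k / fact k)" for j k
  define S where "S N = (\<Sum>j<N. \<Sum>k<N. c j k * (m j k)\<^sup>2)" for N
  have cpos: "0 < c j k" for j k using t by (simp add: c_def)
  note exp = gauss_energy_expansion[OF _ \<nu>(3) _ \<nu>(3) less_imp_le[OF t], folded c_def]
  have "S \<longlonglongrightarrow> ?D"
  proof -
    have "S = (\<lambda>N. (\<Sum>j<N. \<Sum>k<N. c j k * (gmoment t \<nu>\<^sub>1 j k * gmoment t \<nu>\<^sub>1 j k))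
      + (\<Sum>j<N. \<Sum>k<N. c j k * (gmoment t \<nu>\<^sub>2 j k * gmoment t \<nu>\<^sub>2 j k))
      - 2 * (\<Sum>j<N. \<Sum>k<N. c j k * (gmoment t \<nu>\<^sub>1 j k * gmoment t \<nu>\<^sub>2 j k)))"
      unfolding S_def m_def sum_distrib_left sum.distrib[symmetric] sum_subtractf[symmetric]
      by (intro ext sum.cong refl) (simp add: power2_eq_square algebra_simps)
    thus ?thesis by (simp only:) (intro tendsto_intros exp \<nu>)
  qed
  moreover have "0 \<le> S N" for N unfolding S_def using cpos by (intro sum_nonneg mult_nonneg_nonneg) (auto intro: less_imp_le)
  ultimately show D: "0 \<le> ?D" by (meson LIMSEQ_le_const)
  have "m j k = 0" if "?D \<le> 0"
  proof -
    have nn: "0 \<le> c j k * (m j k)\<^sup>2" for j k using cpos[of j k] by simp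
    have "c j k * (m j k)\<^sup>2 \<le> S N" if "N \<ge> Suc (max j k)" for N
    proof -
      have "c j k * (m j k)\<^sup>2 \<le> (\<Sum>k<N. c j k * (m j k)\<^sup>2)"
        using that nn by (intro member_le_sum[of k]) auto
      also have "\<dots> \<le> S N" unfolding S_def
        using that nn by (intro member_le_sum[of j _ "\<lambda>j. \<Sum>k<N. c j k * (m j k)\<^sup>2"]) (auto intro!: sum_nonneg)
      finally show ?thesis .
    qed
    hence "c j k * (m j k)\<^sup>2 \<le> ?D"
      using \<open>S \<longlonglongrightarrow> ?D\<close> by (intro LIMSEQ_le_const) blast+
    hence "c j k * (m j k)\<^sup>2 \<le> 0" using that by linarith
    hence "(m j k)\<^sup>2 \<le> 0" using cpos[of j k] by (simp add: mult_le_0_iff not_le)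
    thus ?thesis by simp
  qed
  thus "?D \<le> 0 \<Longrightarrow> gmoment t \<nu>\<^sub>1 j k = gmoment t \<nu>\<^sub>2 j k" by (simp add: m_def)
qed

text \<open>Real polynomials in \<open>Re\<close> and \<open>Im\<close>, generated by monomials and
  sums only: a statement that is linear in the function then needs just the case of a single moment
  and additivity.\<close>

inductive polyfun :: "(complex \<Rightarrow> real) \<Rightarrow> bool" where
  monom: "polyfun (\<lambda>w. c * (Re w ^ j * Im w ^ k))"
| add: "polyfun f \<Longrightarrow> polyfun g \<Longrightarrow> polyfun (\<lambda>w. f w + g w)"

lemma polyfun_mult:
  assumes "polyfun f" "polyfun g"
  shows "polyfun (\<lambda>w. f w * g w)"
  using assms(1)
proof induction
  case (monom c j k)
  show ?case using assms(2)
  proof induction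
    case (monom c' j' k')
    have "(\<lambda>w. c * (Re w ^ j * Im w ^ k) * (c' * (Re w ^ j' * Im w ^ k'))) = (\<lambda>w. (c * c') * (Re w ^ (j + j') * Im w ^ (k + k')))"
      by (auto simp: power_add)
    thus ?case using polyfun.monom[of "c * c'" "j + j'" "k + k'"] by simp
  next
    case (add g h)
    show ?case unfolding distrib_left by (rule polyfun.add[OF add.IH])
  qed
next
  case (add f h)
  show ?case unfolding distrib_right by (rule polyfun.add[OF add.IH])
qed

lemma polyfun_real_polynomial:
  assumes "real_polynomial_function (f :: complex \<Rightarrow> real)"
  shows "polyfun f"
  using assms
proof induction
  case (linear f)
  have "f w = f 1 * (Re w ^ 1 * Im w ^ 0) + f \<i> * (Re w ^ 0 * Im w ^ 1)" for w
  proof -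
    have "f w = f (Re w *\<^sub>R 1 + Im w *\<^sub>R \<i>)" by (rule arg_cong[of _ _ f]) (simp add: complex_eq_iff)
    also have "\<dots> = Re w * f 1 + Im w * f \<i>"
      using linear by (simp only: bounded_linear.linear linear_add linear_cmul real_scaleR_def)
    finally show ?thesis by simp
  qed
  hence *: "f = (\<lambda>w. f 1 * (Re w ^ 1 * Im w ^ 0) + f \<i> * (Re w ^ 0 * Im w ^ 1))" by (rule ext)
  show ?case by (subst *) (intro polyfun.add polyfun.monom)
next
  case (const c)
  show ?case using polyfun.monom[of c 0 0] by simp
qed (assumption | rule polyfun.add polyfun_mult)+

lemma polyfun_dense:
  fixes f :: "complex \<Rightarrow> real"
  assumes "compact S" "continuous_on S f" "0 < e"
  obtains q where "polyfun q" "\<And>w. w \<in> S \<Longrightarrow> \<bar>f w - q w\<bar> < e"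
proof -
  obtain g where "real_polynomial_function g" "\<And>w. w \<in> S \<Longrightarrow> \<bar>f w - g w\<bar> < e"
    using Stone_Weierstrass_real_polynomial_function[OF assms] by auto
  thus ?thesis using that polyfun_real_polynomial by auto
qed

lemma polyfun_continuous: "polyfun q \<Longrightarrow> continuous_on A q"
  by (induction rule: polyfun.induct) (auto intro!: continuous_intros)

text \<open>Closed sets form an intersection-stable generator of the Borel sets, and the indicator
  of a nonempty closed set is the limit of the continuous functions
  \<open>max 0 (1 - n * infdist w C)\<close>.\<close>

lemma prob_measures_on_eqI:
  assumes \<nu>: "\<nu>\<^sub>1 \<in> prob_measures_on K" "\<nu>\<^sub>2 \<in> prob_measures_on K"
    and eq: "\<And>f :: complex \<Rightarrow> real. continuous_on UNIV f \<Longrightarrow> (\<integral>w. f w \<partial>\<nu>\<^sub>1) = (\<integral>w. f w \<partial>\<nu>\<^sub>2)"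
  shows "\<nu>\<^sub>1 = \<nu>\<^sub>2"
proof -
  interpret A: prob_space \<nu>\<^sub>1 by (rule prob_measures_onD[OF \<nu>(1)])
  interpret B: prob_space \<nu>\<^sub>2 by (rule prob_measures_onD[OF \<nu>(2)])
  note s = prob_measures_onD(2)[OF \<nu>(1)] prob_measures_onD(2)[OF \<nu>(2)]
  have closed: "emeasure \<nu>\<^sub>1 C = emeasure \<nu>\<^sub>2 C" if C: "closed C" for C
  proof (cases "C = {}")
    case False
    define f where "f n w = max 0 (1 - real n * infdist w C)" for n w
    have fc: "continuous_on UNIV (f n)" for n unfolding f_def by (intro continuous_intros)
    have lim: "(\<lambda>n. f n w) \<longlonglongrightarrow> indicator C w" for w
    proof (cases "w \<in> C")
      case True thus ?thesis by (simp add: f_def)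
    next
      case nw: False
      hence p: "0 < infdist w C" using C False by (metis in_closed_iff_infdist_zero infdist_nonneg less_le)
      then obtain N where N: "1 < real N * infdist w C" using reals_Archimedean3 by blast
      have "f n w = 0" if "n \<ge> N" for n
      proof -
        have "real N * infdist w C \<le> real n * infdist w C" using that p by (intro mult_right_mono) auto
        thus ?thesis using N by (simp add: f_def)
      qed
      hence "eventually (\<lambda>n. f n w = indicator C w) sequentially"
        using nw by (auto simp: eventually_sequentially)
      thus ?thesis by (rule tendsto_eventually)
    qed
    have *: "(\<lambda>n. \<integral>w. f n w \<partial>\<nu>) \<longlonglongrightarrow> measure \<nu> C" if \<nu>: "\<nu> \<in> prob_measures_on K" for \<nu>
    proof -
      interpret prob_space \<nu> by (rule prob_measures_onD[OF \<nu>])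
      have Cs: "C \<in> sets \<nu>" using C by (simp add: prob_measures_onD(2)[OF \<nu>])
      have "(\<lambda>n. \<integral>w. f n w \<partial>\<nu>) \<longlonglongrightarrow> (\<integral>w. indicator C w \<partial>\<nu>)"
      proof (rule integral_dominated_convergence[where w = "\<lambda>_. 1"])
        show "f n \<in> borel_measurable \<nu>" for n
          by (rule prob_measures_on_measurable[OF \<nu> borel_measurable_continuous_UNIV[OF fc]])
        show "AE x in \<nu>. norm (f n x) \<le> 1" for n
          by (rule AE_I2) (auto simp: f_def infdist_nonneg)
      qed (use Cs lim in auto)
      thus ?thesis using Cs by simp
    qed
    have "measure \<nu>\<^sub>1 C = measure \<nu>\<^sub>2 C"
      using LIMSEQ_unique[OF *[OF \<nu>(1)]] *[OF \<nu>(2)] eq[OF fc] by simp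
    thus ?thesis by (simp add: A.emeasure_eq_measure B.emeasure_eq_measure)
  qed simp
  show ?thesis
  proof (rule measure_eqI_generator_eq[of "{C. closed C}" UNIV _ _ "\<lambda>_. UNIV"])
    show "sets \<nu>\<^sub>1 = sigma_sets UNIV {C. closed C}" "sets \<nu>\<^sub>2 = sigma_sets UNIV {C. closed C}"
      unfolding s borel_eq_closed by simp_all
  qed (use closed in \<open>auto simp: Int_stable_def\<close>)
qed

text \<open>A continuous \<open>f\<close> is \<open>e\<close> times \<open>f / e\<close>, and
  \<open>f / e\<close> is uniformly close on \<open>K\<close> to a polynomial; the integral of
  \<open>e\<close> times a polynomial is a combination of Gaussian moments. One fixed
  \<open>t\<close> thus determines the measure.\<close>

lemma prob_measures_on_eq_if_gmoments_eq:
  assumes \<nu>: "\<nu>\<^sub>1 \<in> prob_measures_on K" "\<nu>\<^sub>2 \<in> prob_measures_on K" "compact K"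
    and eq: "\<And>j k. gmoment t \<nu>\<^sub>1 j k = gmoment t \<nu>\<^sub>2 j k"
  shows "\<nu>\<^sub>1 = \<nu>\<^sub>2"
proof (rule prob_measures_on_eqI[OF \<nu>(1,2)])
  fix f :: "complex \<Rightarrow> real" assume f: "continuous_on UNIV f"
  define e where "e w = exp (- (t * (cmod w)\<^sup>2))" for w
  have e0: "0 < e w" for w by (simp add: e_def)
  have ec: "continuous_on A e" for A unfolding e_def by (intro continuous_intros)
  have poly: "(\<integral>w. e w * q w \<partial>\<nu>\<^sub>1) = (\<integral>w. e w * q w \<partial>\<nu>\<^sub>2)" if "polyfun q" for q
    using that
  proof induction
    case (monom c j k)
    have "(\<integral>w. e w * (c * (Re w ^ j * Im w ^ k)) \<partial>\<nu>) = c * gmoment t \<nu> j k" for \<nu>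
      unfolding gmoment_def e_def[symmetric]
      by (subst integral_mult_right_zero[symmetric]) (simp add: ac_simps)
    thus ?case using eq by simp
  next
    case (add f g)
    have "integrable \<nu> (\<lambda>w. e w * f w)" "integrable \<nu> (\<lambda>w. e w * g w)" if "\<nu> \<in> prob_measures_on K" for \<nu>
      by (intro prob_measures_on_integrable[OF that \<nu>(3)] continuous_intros ec polyfun_continuous add.hyps)+
    thus ?case using add.IH \<nu> by (simp add: distrib_left)
  qed
  have "\<bar>(\<integral>w. f w \<partial>\<nu>\<^sub>1) - (\<integral>w. f w \<partial>\<nu>\<^sub>2)\<bar> \<le> 0 + \<epsilon>" if "0 < \<epsilon>" for \<epsilon>
  proof -
    have "continuous_on UNIV (\<lambda>w. f w / e w)" using e0 by (intro continuous_intros f ec) (auto simp: less_imp_neq[symmetric])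
    hence fe: "continuous_on K (\<lambda>w. f w / e w)" by (rule continuous_on_subset) simp
    have "compact (e ` K)" by (rule compact_continuous_image[OF ec \<nu>(3)])
    then obtain B where "0 < B" "\<forall>y \<in> e ` K. norm y \<le> B"
      using compact_imp_bounded bounded_pos by metis
    hence B: "0 < B" "\<And>w. w \<in> K \<Longrightarrow> e w \<le> B" by force+
    \<comment> \<open>\<open>B\<close> bounds the weight \<open>e\<close> on \<open>K\<close>, so
      each of the two measures contributes at most \<open>\<epsilon> / 2\<close>.\<close>
    obtain q where q: "polyfun q" "\<And>w. w \<in> K \<Longrightarrow> \<bar>f w / e w - q w\<bar> < \<epsilon> / (2 * B)"
    proof (rule polyfun_dense[OF \<nu>(3) fe])
      show "0 < \<epsilon> / (2 * B)" using \<open>0 < \<epsilon>\<close> B(1) by simp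
    qed (rule that)
    have *: "\<bar>(\<integral>w. f w \<partial>\<nu>) - (\<integral>w. e w * q w \<partial>\<nu>)\<bar> \<le> \<epsilon> / 2" if \<nu>': "\<nu> \<in> prob_measures_on K" for \<nu>
    proof -
      note I = prob_measures_on_integrable[OF \<nu>' \<nu>(3)]
      have ce: "continuous_on UNIV (\<lambda>w. e w * q w)" by (intro continuous_intros ec polyfun_continuous q)
      have "\<bar>(\<integral>w. f w \<partial>\<nu>) - (\<integral>w. e w * q w \<partial>\<nu>)\<bar> = \<bar>\<integral>w. f w - e w * q w \<partial>\<nu>\<bar>"
        using I[OF f] I[OF ce] by simp
      also have "\<dots> \<le> (\<integral>w. \<bar>f w - e w * q w\<bar> \<partial>\<nu>)" by (rule integral_abs_bound)
      also have "\<dots> \<le> \<epsilon> / 2"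
      proof (rule prob_measures_on_integral_le[OF \<nu>' compact_imp_closed[OF \<nu>(3)]])
        show "integrable \<nu> (\<lambda>w. \<bar>f w - e w * q w\<bar>)" using I[OF f] I[OF ce] by simp
        fix w assume w: "w \<in> K"
        have "f w - e w * q w = e w * (f w / e w - q w)"
          using e0[of w] by (simp add: right_diff_distrib)
        hence "\<bar>f w - e w * q w\<bar> = e w * \<bar>f w / e w - q w\<bar>"
          using e0[of w] by (simp add: abs_mult)
        also have "\<dots> \<le> B * (\<epsilon> / (2 * B))" using B w q(2)[OF w] e0[of w] by (intro mult_mono) auto
        finally show "\<bar>f w - e w * q w\<bar> \<le> \<epsilon> / 2" using B by simp
      qed
      finally show ?thesis .
    qed
    show ?thesis using *[OF \<nu>(1)] *[OF \<nu>(2)] poly[OF q(1)] by linarith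
  qed
  hence "\<bar>(\<integral>w. f w \<partial>\<nu>\<^sub>1) - (\<integral>w. f w \<partial>\<nu>\<^sub>2)\<bar> \<le> 0" by (rule field_le_epsilon)
  thus "(\<integral>w. f w \<partial>\<nu>\<^sub>1) = (\<integral>w. f w \<partial>\<nu>\<^sub>2)" by simp
qed

text \<open>The regularised energy of the neutral measure
  \<open>\<nu>\<^sub>1 - \<nu>\<^sub>2\<close>; its two mutual terms coincide by symmetry of the
  kernel.\<close>

definition energy_dist :: "real \<Rightarrow> complex measure \<Rightarrow> complex measure \<Rightarrow> real" where
  "energy_dist d \<nu>\<^sub>1 \<nu>\<^sub>2 = renergy d \<nu>\<^sub>1 \<nu>\<^sub>1 + renergy d \<nu>\<^sub>2 \<nu>\<^sub>2 - 2 * renergy d \<nu>\<^sub>1 \<nu>\<^sub>2"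

lemma energy_dist_diff:
  assumes \<nu>: "\<nu>\<^sub>1 \<in> prob_measures_on K" "\<nu>\<^sub>2 \<in> prob_measures_on K" "compact K" and d: "0 < d" "d \<le> d'"
  defines "D \<equiv> \<lambda>t. gauss_energy t \<nu>\<^sub>1 \<nu>\<^sub>1 + gauss_energy t \<nu>\<^sub>2 \<nu>\<^sub>2 - 2 * gauss_energy t \<nu>\<^sub>1 \<nu>\<^sub>2"
  shows "energy_dist d \<nu>\<^sub>1 \<nu>\<^sub>2 - energy_dist d' \<nu>\<^sub>1 \<nu>\<^sub>2 = (\<integral>t. frullani_weight d d' t * D t \<partial>lborel) / 2"
    and "integrable lborel (\<lambda>t. frullani_weight d d' t * D t)"
    and "0 \<le> frullani_weight d d' t * D t"
proof -
  note r = renergy_diff[OF \<nu>(1,3) \<nu>(1,3) d] renergy_diff[OF \<nu>(2,3) \<nu>(2,3) d] renergy_diff[OF \<nu>(1,3) \<nu>(2,3) d]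
  have e: "frullani_weight d d' t * D t = frullani_weight d d' t * gauss_energy t \<nu>\<^sub>1 \<nu>\<^sub>1 + frullani_weight d d' t * gauss_energy t \<nu>\<^sub>2 \<nu>\<^sub>2
    - 2 * (frullani_weight d d' t * gauss_energy t \<nu>\<^sub>1 \<nu>\<^sub>2)" for t by (simp add: D_def algebra_simps)
  show "integrable lborel (\<lambda>t. frullani_weight d d' t * D t)" unfolding e using r by auto
  show "energy_dist d \<nu>\<^sub>1 \<nu>\<^sub>2 - energy_dist d' \<nu>\<^sub>1 \<nu>\<^sub>2 = (\<integral>t. frullani_weight d d' t * D t \<partial>lborel) / 2"
    unfolding e using r by (simp add: energy_dist_def)
  show "0 \<le> frullani_weight d d' t * D t"
  proof (cases "0 < t")
    case True
    have "t * d \<le> t * d'" using True d by simp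
    thus ?thesis using gauss_energy_diff(1)[OF \<nu> True] True unfolding D_def frullani_weight_def by (intro mult_nonneg_nonneg) auto
  qed (simp add: frullani_weight_def)
qed

text \<open>Lowering \<open>d\<close> adds a weighted integral of Gaussian energies of the
  difference, which are nonnegative.\<close>

lemma energy_dist_antimono:
  assumes \<nu>: "\<nu>\<^sub>1 \<in> prob_measures_on K" "\<nu>\<^sub>2 \<in> prob_measures_on K" "compact K" and d: "0 < d" "d \<le> d'"
  shows "energy_dist d' \<nu>\<^sub>1 \<nu>\<^sub>2 \<le> energy_dist d \<nu>\<^sub>1 \<nu>\<^sub>2"
proof -
  note D = energy_dist_diff[OF assms]
  have "0 \<le> 2 * (energy_dist d \<nu>\<^sub>1 \<nu>\<^sub>2 - energy_dist d' \<nu>\<^sub>1 \<nu>\<^sub>2)"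
    unfolding D(1) using D(3) by (simp add: Bochner_Integration.integral_nonneg)
  thus ?thesis by simp
qed

lemma renergy_bounds:
  assumes \<nu>: "\<nu> \<in> prob_measures_on (cball 0 R)" "\<nu>' \<in> prob_measures_on (cball 0 R)" and d: "0 < d"
  shows "- ln ((2 * R)\<^sup>2 + d) / 2 \<le> renergy d \<nu> \<nu>'" "renergy d \<nu> \<nu>' \<le> - ln d / 2"
proof -
  note P = prob_measures_on_P_log[OF \<nu>(1) compact_cball]
  have 1: "- ln ((2 * R)\<^sup>2 + d) / 2 \<le> lker d w z" if "w \<in> cball 0 R" "z \<in> cball 0 R" for w z
    using that norm_triangle_ineq4[of w z] by (intro lker_ge[OF d]) auto
  have "- ln ((2 * R)\<^sup>2 + d) / 2 \<le> rpot d \<nu> z" if "z \<in> cball 0 R" for z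
    unfolding rpot_def by (rule prob_measures_on_integral_ge[OF \<nu>(1) closed_cball integrable_lker[OF P d]]) (rule 1[OF _ that])
  thus "- ln ((2 * R)\<^sup>2 + d) / 2 \<le> renergy d \<nu> \<nu>'" unfolding renergy_def
    by (intro prob_measures_on_integral_ge[OF \<nu>(2) closed_cball] integrable_rpot[OF \<nu>(2) compact_cball P d])
  have "rpot d \<nu> z \<le> - ln d / 2" for z
    unfolding rpot_def by (rule prob_measures_on_integral_le[OF \<nu>(1) closed_cball integrable_lker[OF P d]]) (rule lker_le[OF d])
  thus "renergy d \<nu> \<nu>' \<le> - ln d / 2" unfolding renergy_def
    by (intro prob_measures_on_integral_le[OF \<nu>(2) closed_cball] integrable_rpot[OF \<nu>(2) compact_cball P d])
qed

text \<open>As \<open>d \<rightarrow> \<infinity>\<close> the kernel becomes constant on bounded sets, so that the energy distance tends to \<open>0\<close>;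
  being antimonotone in \<open>d\<close>, it is nonnegative.\<close>

lemma energy_dist_nonneg:
  assumes \<nu>: "\<nu>\<^sub>1 \<in> prob_measures_on (cball 0 R)" "\<nu>\<^sub>2 \<in> prob_measures_on (cball 0 R)" and d: "0 < d"
  shows "0 \<le> energy_dist d \<nu>\<^sub>1 \<nu>\<^sub>2"
proof -
  have *: "- ln ((2 * R)\<^sup>2 / d' + 1) \<le> energy_dist d \<nu>\<^sub>1 \<nu>\<^sub>2" if d': "d' \<ge> d" for d'
  proof -
    have "0 < d'" using d d' by simp
    have "- ln ((2 * R)\<^sup>2 + d') + ln d' \<le> energy_dist d' \<nu>\<^sub>1 \<nu>\<^sub>2"
      using renergy_bounds[OF \<nu>(1,1) \<open>0 < d'\<close>] renergy_bounds[OF \<nu>(2,2) \<open>0 < d'\<close>] renergy_bounds[OF \<nu>(1,2) \<open>0 < d'\<close>]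
      by (simp add: energy_dist_def)
    also have "\<dots> \<le> energy_dist d \<nu>\<^sub>1 \<nu>\<^sub>2" by (rule energy_dist_antimono[OF \<nu> compact_cball d d'])
    also have "- ln ((2 * R)\<^sup>2 + d') + ln d' = - ln (((2 * R)\<^sup>2 + d') / d')"
      using \<open>0 < d'\<close> by (subst ln_div) (auto simp: add_nonneg_eq_0_iff)
    also have "((2 * R)\<^sup>2 + d') / d' = (2 * R)\<^sup>2 / d' + 1" using \<open>0 < d'\<close> by (simp add: add_divide_distrib)
    finally show ?thesis .
  qed
  have "((\<lambda>d'. - ln ((2 * R)\<^sup>2 / d' + 1)) \<longlongrightarrow> - ln (0 + 1)) at_top"
    by (intro tendsto_intros tendsto_divide_0[OF tendsto_const] filterlim_at_top_imp_at_infinity filterlim_ident) auto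
  hence "- ln (0 + 1) \<le> energy_dist d \<nu>\<^sub>1 \<nu>\<^sub>2"
    by (rule tendsto_upperbound) (use * in \<open>auto simp: eventually_at_top_linorder intro!: exI[of _ d]\<close>)
  thus ?thesis by simp
qed

text \<open>Smallness at some \<open>d \<le> 1\<close> passes to \<open>d = 1\<close> by
  antimonotonicity, while the distance at \<open>d = 2\<close> is nonnegative. So the Frullani
  integral between 1 and 2 vanishes, and with it the Gaussian energy of the difference for almost
  every \<open>t > 0\<close>; at one such \<open>t\<close> the Gaussian moments of the two measures
  agree.\<close>

lemma energy_dist_eq_0:
  assumes \<nu>: "\<nu>\<^sub>1 \<in> prob_measures_on (cball 0 R)" "\<nu>\<^sub>2 \<in> prob_measures_on (cball 0 R)"
    and small: "\<And>e. 0 < e \<Longrightarrow> \<exists>d>0. d \<le> 1 \<and> energy_dist d \<nu>\<^sub>1 \<nu>\<^sub>2 < e"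
  shows "\<nu>\<^sub>1 = \<nu>\<^sub>2"
proof -
  note c = compact_cball[of "0::complex" R]
  define D where "D t = gauss_energy t \<nu>\<^sub>1 \<nu>\<^sub>1 + gauss_energy t \<nu>\<^sub>2 \<nu>\<^sub>2 - 2 * gauss_energy t \<nu>\<^sub>1 \<nu>\<^sub>2" for t
  note ed = energy_dist_diff[OF \<nu> c, of 1 2, folded D_def, simplified]
  have "energy_dist 1 \<nu>\<^sub>1 \<nu>\<^sub>2 \<le> 0 + e" if "0 < e" for e
  proof -
    obtain d where "d > 0" "d \<le> 1" "energy_dist d \<nu>\<^sub>1 \<nu>\<^sub>2 < e" using small[OF \<open>0 < e\<close>] by blast
    thus ?thesis using energy_dist_antimono[OF \<nu> c, of d 1] by simp
  qed
  hence "energy_dist 1 \<nu>\<^sub>1 \<nu>\<^sub>2 \<le> 0" by (rule field_le_epsilon)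
  moreover have "0 \<le> energy_dist 2 \<nu>\<^sub>1 \<nu>\<^sub>2" by (rule energy_dist_nonneg[OF \<nu>]) simp
  ultimately have "(\<integral>t. frullani_weight 1 2 t * D t \<partial>lborel) = 0"
    using ed(1) Bochner_Integration.integral_nonneg[of lborel "\<lambda>t. frullani_weight 1 2 t * D t", OF ed(3)] by linarith
  hence "AE t in lborel. frullani_weight 1 2 t * D t = 0"
    using integral_nonneg_eq_0_iff_AE[OF ed(2)] ed(3) by auto
  \<comment> \<open>The weight is positive for \<open>t > 0\<close>; the unit interval merely serves
    as a set of positive measure from which \<open>t\<close> is taken.\<close>
  hence "AE t in lborel. t \<notin> {0<..<1::real} \<or> D t = 0"
  proof (rule eventually_mono)
    fix t assume *: "frullani_weight 1 2 t * D t = 0"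
    have "frullani_weight 1 2 t \<noteq> 0" if "0 < t" using that by (simp add: frullani_weight_def)
    thus "t \<notin> {0<..<1} \<or> D t = 0" using * by auto
  qed
  have "\<exists>t>0. D t = 0"
  proof (rule ccontr)
    assume "\<not> ?thesis"
    hence "AE t in lborel. t \<notin> {0<..<1::real}"
      using \<open>AE t in lborel. t \<notin> {0<..<1::real} \<or> D t = 0\<close> by (auto elim!: eventually_mono)
    hence "emeasure lborel {0<..<1::real} = 0"
      by (subst (asm) AE_iff_measurable[of "{0<..<1::real}"]) auto
    thus False by simp
  qed
  then obtain t where "0 < t" "D t = 0" by auto
  have "gmoment t \<nu>\<^sub>1 j k = gmoment t \<nu>\<^sub>2 j k" for j k
    by (rule gauss_energy_diff(2)[OF \<nu> c \<open>0 < t\<close>]) (use \<open>D t = 0\<close> in \<open>simp add: D_def\<close>)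
  thus ?thesis by (rule prob_measures_on_eq_if_gmoments_eq[OF \<nu> c])
qed

section \<open>Weak compactness\<close>

lemma third_powers_sums: "(\<lambda>k. (1 / 3) ^ k) sums (3 / 2 :: real)"
  using geometric_sums[of "1 / 3 :: real"] by simp

text \<open>Digits 0 and 1 in base 3 allow no carrying: the first digit in which the sequences
  differ, at index \<open>m\<close>, contributes \<open>(1 / 3) ^ m\<close>, and all later ones
  together at most half of that.\<close>

lemma third_powers_digits:
  fixes P Q :: "nat \<Rightarrow> bool"
  defines "s \<equiv> \<lambda>P. \<Sum>n. of_bool (P n) * (1 / 3 :: real) ^ n"
  assumes less: "\<bar>s P - s Q\<bar> < (1 / 2) * (1 / 3) ^ N" and "n \<le> N"
  shows "P n = Q n"
proof (rule ccontr)
  assume ne: "P n \<noteq> Q n"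
  define d :: "nat \<Rightarrow> real" where "d k = of_bool (P k) - of_bool (Q k)" for k
  have summ: "summable (\<lambda>n. of_bool (P n) * (1 / 3 :: real) ^ n)" for P
    by (rule summable_comparison_test'[OF sums_summable[OF third_powers_sums], of 0]) auto
  define m where "m = (LEAST k. P k \<noteq> Q k)"
  have m: "P m \<noteq> Q m" "m \<le> n"
    unfolding m_def using ne by (rule LeastI[of "\<lambda>k. P k \<noteq> Q k"], rule Least_le[of "\<lambda>k. P k \<noteq> Q k"])
  have eq: "P k = Q k" if "k < m" for k using not_less_Least[of k "\<lambda>k. P k \<noteq> Q k"] that by (auto simp: m_def)
  have d1: "\<bar>d k\<bar> \<le> 1" for k by (auto simp: d_def)
  have sd: "(\<lambda>k. d k * (1 / 3) ^ k) sums (s P - s Q)"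
    unfolding d_def left_diff_distrib s_def by (intro sums_diff summable_sums summ)
  have tail: "\<bar>\<Sum>k. d (k + Suc m) * (1 / 3) ^ (k + Suc m)\<bar> \<le> (1 / 3) ^ Suc m * (3 / 2)"
  proof -
    have t: "(\<lambda>k. (1 / 3) ^ (k + Suc m)) sums ((3 / 2) * (1 / 3) ^ Suc m :: real)"
      unfolding power_add by (rule sums_mult2[OF third_powers_sums])
    have le: "norm (d (k + Suc m) * (1 / 3) ^ (k + Suc m)) \<le> (1 / 3) ^ (k + Suc m)" for k
    proof -
      have "norm (d (k + Suc m) * (1 / 3) ^ (k + Suc m)) = \<bar>d (k + Suc m)\<bar> * (1 / 3) ^ (k + Suc m)"
        by (simp only: real_norm_def abs_mult) simp
      also have "\<dots> \<le> 1 * (1 / 3) ^ (k + Suc m)" by (intro mult_right_mono d1) simp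
      finally show ?thesis by simp
    qed
    have "norm (\<Sum>k. d (k + Suc m) * (1 / 3) ^ (k + Suc m)) \<le> (\<Sum>k. (1 / 3) ^ (k + Suc m))"
      by (rule norm_suminf_le[OF le sums_summable[OF t]])
    thus ?thesis unfolding sums_unique[OF t, symmetric] by (simp only: real_norm_def mult.commute)
  qed
  have "d k = 0" if "k < m" for k using eq[OF that] by (simp add: d_def)
  hence "(\<Sum>k<Suc m. d k * (1 / 3) ^ k) = d m * (1 / 3) ^ m" by simp
  hence "s P - s Q = (\<Sum>k. d (k + Suc m) * (1 / 3) ^ (k + Suc m)) + d m * (1 / 3) ^ m"
    unfolding sums_unique[OF sd] by (subst suminf_split_initial_segment[OF sums_summable[OF sd], of "Suc m"]) (simp only:)
  moreover have "\<bar>d m * (1 / 3) ^ m\<bar> = (1 / 3) ^ m" using m by (cases "P m") (auto simp: d_def)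
  ultimately have "(1 / 3) ^ m - (1 / 3) ^ Suc m * (3 / 2) \<le> \<bar>s P - s Q\<bar>" using tail by linarith
  hence "(1 / 2) * (1 / 3) ^ m \<le> \<bar>s P - s Q\<bar>" unfolding power_Suc by linarith
  moreover have "(1 / 3 :: real) ^ N \<le> (1 / 3) ^ m" using m \<open>n \<le> N\<close> by (intro power_decreasing) auto
  ultimately show False using less by linarith
qed

text \<open>Marczewski's function: a point is encoded by the sets of a countable base containing it.\<close>

lemma compact_real_encoding:
  fixes K :: "complex set"
  assumes K: "compact K"
  obtains s :: "complex \<Rightarrow> real" and T :: "real \<Rightarrow> complex" where
    "s \<in> borel_measurable borel" "\<And>w. 0 \<le> s w" "\<And>w. s w \<le> 2"
    "continuous_on UNIV T" "bounded (range T)" "\<And>w. w \<in> K \<Longrightarrow> T (s w) = w"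
proof -
  obtain B :: "complex set set" where B: "countable B" "topological_basis B"
    using ex_countable_basis by blast
  have "B \<noteq> {}" using topological_basisE[OF B(2) open_UNIV UNIV_I] by blast
  define A where "A = from_nat_into B"
  have rangeA: "range A = B" unfolding A_def using B(1) \<open>B \<noteq> {}\<close> by (rule range_from_nat_into[rotated])
  have Ao: "open (A n)" for n using topological_basis_open[OF B(2)] rangeA by blast
  define s where "s w = (\<Sum>n. of_bool (w \<in> A n) * (1 / 3 :: real) ^ n)" for w
  have summ: "summable (\<lambda>n. of_bool (w \<in> A n) * (1 / 3 :: real) ^ n)" for w
    by (rule summable_comparison_test'[OF sums_summable[OF third_powers_sums], of 0]) auto
  have sm: "s \<in> borel_measurable borel"
    unfolding s_def
  proof (rule borel_measurable_suminf)
    fix n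
    have "(\<lambda>w. of_bool (w \<in> A n) * (1 / 3 :: real) ^ n) = (\<lambda>w. indicator (A n) w * (1 / 3) ^ n)"
      by (auto simp: indicator_def)
    moreover have "A n \<in> sets borel" using Ao by auto
    ultimately show "(\<lambda>w. of_bool (w \<in> A n) * (1 / 3 :: real) ^ n) \<in> borel_measurable borel" by simp
  qed
  have s0: "0 \<le> s w" for w unfolding s_def by (intro suminf_nonneg summ) auto
  have s2: "s w \<le> 2" for w
  proof -
    have "s w \<le> (\<Sum>n. (1 / 3) ^ n)" unfolding s_def
      by (intro suminf_le summ sums_summable[OF third_powers_sums]) auto
    thus ?thesis using sums_unique[OF third_powers_sums] by simp
  qed
  \<comment> \<open>The encoding \<open>s\<close> is only known to be measurable, but its inverse on
    \<open>K\<close> is uniformly continuous: finitely many small basis sets cover \<open>K\<close>,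
    and points with close codes agree on membership in all basis sets up to the largest index
    \<open>N\<close> used, so one small set contains both.\<close>
  have close: "\<exists>\<delta>>0. \<forall>p\<in>K. \<forall>q\<in>K. \<bar>s p - s q\<bar> < \<delta> \<longrightarrow> dist p q < e" if "e > 0" for e
  proof -
    define C where "C = {n. \<exists>p. A n \<subseteq> ball p (e / 2)}"
    have "K \<subseteq> (\<Union>n\<in>C. A n)"
    proof
      fix p assume "p \<in> K"
      obtain V where "V \<in> B" "p \<in> V" "V \<subseteq> ball p (e / 2)"
        using topological_basisE[OF B(2), of "ball p (e / 2)" p] \<open>e > 0\<close> by auto
      thus "p \<in> (\<Union>n\<in>C. A n)" using rangeA unfolding C_def by blast
    qed
    then obtain C' where C': "C' \<subseteq> C" "finite C'" "K \<subseteq> (\<Union>n\<in>C'. A n)"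
      using compactE_image[OF K] Ao by metis
    define N where "N = Max (insert 0 C')"
    show ?thesis
    proof (intro exI[of _ "(1 / 2) * (1 / 3) ^ N"] conjI ballI impI)
      fix p q assume pq: "p \<in> K" "q \<in> K" "\<bar>s p - s q\<bar> < (1 / 2) * (1 / 3) ^ N"
      obtain n where n: "n \<in> C'" "p \<in> A n" using C' pq by blast
      hence "n \<le> N" using C'(2) by (auto simp: N_def)
      hence "q \<in> A n" using third_powers_digits[of "\<lambda>n. p \<in> A n" "\<lambda>n. q \<in> A n" N n] pq(3) n(2) by (simp add: s_def)
      moreover obtain x where "A n \<subseteq> ball x (e / 2)" using n C' by (auto simp: C_def)
      ultimately have "dist x p < e / 2" "dist x q < e / 2" using n by (auto simp: subset_iff)
      thus "dist p q < e" using dist_triangle_half_r by blast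
    qed simp
  qed
  have inj: "inj_on s K"
  proof (rule inj_onI, rule ccontr)
    fix p q assume "p \<in> K" "q \<in> K" "s p = s q" "p \<noteq> q"
    moreover from this obtain \<delta> where "\<delta> > 0" "\<forall>x\<in>K. \<forall>y\<in>K. \<bar>s x - s y\<bar> < \<delta> \<longrightarrow> dist x y < dist p q"
      using close[of "dist p q"] by (metis zero_less_dist_iff)
    ultimately have "dist p q < dist p q" by (metis abs_zero diff_self)
    thus False by simp
  qed
  define g where "g = inv_into K s"
  have gs: "g (s w) = w" if "w \<in> K" for w using that inj by (simp add: g_def)
  have "uniformly_continuous_on (s ` K) g"
    unfolding uniformly_continuous_on_def
  proof (intro allI impI)
    fix e :: real assume "0 < e"
    then obtain \<delta> where "\<delta> > 0" "\<forall>p\<in>K. \<forall>q\<in>K. \<bar>s p - s q\<bar> < \<delta> \<longrightarrow> dist p q < e" using close by blast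
    thus "\<exists>d>0. \<forall>x\<in>s ` K. \<forall>x'\<in>s ` K. dist x' x < d \<longrightarrow> dist (g x') (g x) < e"
      by (intro exI[of _ \<delta>]) (auto simp: gs dist_real_def)
  qed
  then obtain g' where g': "uniformly_continuous_on (closure (s ` K)) g'" "\<And>x. x \<in> s ` K \<Longrightarrow> g x = g' x"
    by (rule uniformly_continuous_on_extension_on_closure[of "s ` K" g]) blast
  have "closedin (top_of_set UNIV) (closure (s ` K))" by simp
  then obtain h where h: "continuous_on UNIV h" "\<And>x. x \<in> closure (s ` K) \<Longrightarrow> h x = g' x"
    by (rule Tietze_unbounded[OF uniformly_continuous_imp_continuous[OF g'(1)]]) blast
  \<comment> \<open>Clamping to \<open>{0..2}\<close>, which contains all codes, makes the range
    bounded and leaves the values at codes unchanged.\<close>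
  define T where "T x = h (max 0 (min 2 x))" for x
  have "continuous_on UNIV T" unfolding T_def
    by (rule continuous_on_compose2[OF h(1)]) (auto intro!: continuous_intros)
  moreover have "bounded (range T)"
  proof (rule bounded_subset)
    show "bounded (h ` {0..2})" by (intro compact_imp_bounded compact_continuous_image continuous_on_subset[OF h(1)]) auto
    have "T x \<in> h ` {0..2}" for x unfolding T_def by (rule imageI) auto
    thus "range T \<subseteq> h ` {0..2}" by blast
  qed
  moreover have "T (s w) = w" if "w \<in> K" for w
  proof -
    have "s w \<in> closure (s ` K)" by (rule subsetD[OF closure_subset imageI[OF that]])
    hence "h (s w) = g' (s w)" by (rule h(2))
    also have "\<dots> = w" using g'(2)[of "s w", symmetric] gs[OF that] that by simp
    finally have "h (s w) = w" .
    moreover have "max 0 (min 2 (s w)) = s w" using s0[of w] s2[of w] by simp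
    ultimately show ?thesis unfolding T_def by simp
  qed
  ultimately show ?thesis by (rule that[OF sm s0 s2])
qed

text \<open>All continuous functions are tested, unbounded ones included; for measures carried by
  one compact set this is weak convergence.\<close>

definition wconv :: "(nat \<Rightarrow> complex measure) \<Rightarrow> complex measure \<Rightarrow> bool" where
  "wconv \<nu>s \<nu> \<longleftrightarrow> (\<forall>f :: complex \<Rightarrow> real. continuous_on UNIV f \<longrightarrow> (\<lambda>n. \<integral>w. f w \<partial>\<nu>s n) \<longlonglongrightarrow> (\<integral>w. f w \<partial>\<nu>))"

lemma wconvD: "wconv \<nu>s \<nu> \<Longrightarrow> continuous_on UNIV f \<Longrightarrow> (\<lambda>n. \<integral>w. f w \<partial>\<nu>s n) \<longlonglongrightarrow> (\<integral>w. (f w :: real) \<partial>\<nu>)"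
  by (simp add: wconv_def)

lemma wconv_subseq: "wconv \<nu>s \<nu> \<Longrightarrow> strict_mono r \<Longrightarrow> wconv (\<nu>s \<circ> r) \<nu>"
  unfolding wconv_def using LIMSEQ_subseq_LIMSEQ by (fastforce simp: comp_def)

lemma wconv_rpot: "wconv \<nu>s \<nu> \<Longrightarrow> 0 < d \<Longrightarrow> (\<lambda>n. rpot d (\<nu>s n) z) \<longlonglongrightarrow> rpot d \<nu> z"
  unfolding rpot_def by (rule wconvD) (auto intro!: continuous_intros)

text \<open>Compactness is transported from the line: the push-forwards under the Borel encoding
  \<open>s\<close> live in a bounded interval, hence are tight, and their limit is sent back by the
  continuous map \<open>T\<close>. Since \<open>T (s w) = w\<close> on \<open>K\<close>, integrating
  \<open>f\<close> is integrating the bounded continuous \<open>f \<circ> T\<close> on the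
  line.\<close>

theorem prob_measures_on_wconv_compact:
  assumes K: "compact K" and \<nu>s: "\<And>n. \<nu>s n \<in> prob_measures_on K"
  obtains r \<nu> where "strict_mono (r :: nat \<Rightarrow> nat)" "\<nu> \<in> prob_measures_on K" "wconv (\<nu>s \<circ> r) \<nu>"
proof -
  obtain s :: "complex \<Rightarrow> real" and T :: "real \<Rightarrow> complex" where
    sT: "s \<in> borel_measurable borel" "\<And>w. 0 \<le> s w" "\<And>w. s w \<le> 2"
    "continuous_on UNIV T" "bounded (range T)" "\<And>w. w \<in> K \<Longrightarrow> T (s w) = w"
    by (rule compact_real_encoding[OF K]) (rule that)
  have [measurable]: "T \<in> borel_measurable borel" using sT(4) by (rule borel_measurable_continuous_onI)
  define m where "m n = distr (\<nu>s n) borel s" for n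
  have smeas: "s \<in> borel_measurable (\<nu>s n)" for n by (rule prob_measures_on_measurable[OF \<nu>s sT(1)])
  have md: "real_distribution (m n)" for n
  proof -
    interpret prob_space "\<nu>s n" by (rule prob_measures_onD[OF \<nu>s])
    show ?thesis unfolding m_def by (rule real_distribution_distr[OF smeas])
  qed
  \<comment> \<open>Tightness is stated for intervals open on the left, hence the endpoint -1
    although codes start at 0.\<close>
  have m1: "measure (m n) {-1<..2} = 1" for n
  proof -
    interpret prob_space "\<nu>s n" by (rule prob_measures_onD[OF \<nu>s])
    have "-1 < s w" for w using sT(2)[of w] by linarith
    hence "s -` {- 1<..2} \<inter> space (\<nu>s n) = space (\<nu>s n)" using sT(3) by auto
    thus ?thesis unfolding m_def using smeas by (simp add: measure_distr prob_space)
  qed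
  have "tight m"
    unfolding tight_def by (intro conjI allI impI md, rule exI[of _ "-1"], rule exI[of _ 2]) (simp add: m1)
  then obtain r M where r: "strict_mono r" and M: "real_distribution M" and wc: "weak_conv_m (m \<circ> id \<circ> r) M"
    using tight_imp_convergent_subsubsequence[of m id] by (auto simp: strict_mono_id)
  interpret M: real_distribution M by fact
  define \<nu> where "\<nu> = distr M borel T"
  have TM: "T \<in> borel_measurable M" by simp
  have \<nu>p: "prob_space \<nu>" "sets \<nu> = sets borel" unfolding \<nu>_def by (auto intro: M.prob_space_distr)
  have conv: "(\<lambda>n. \<integral>w. f w \<partial>\<nu>s (r n)) \<longlonglongrightarrow> (\<integral>w. f w \<partial>\<nu>)" if f: "continuous_on UNIV f" for f :: "complex \<Rightarrow> real"
  proof -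
    have [measurable]: "f \<in> borel_measurable borel" using f by (rule borel_measurable_continuous_onI)
    have fT: "continuous_on UNIV (f \<circ> T)"
      using continuous_on_compose[OF sT(4) continuous_on_subset[OF f]] by simp
    have "compact (f ` closure (range T))"
      using sT(5) by (intro compact_continuous_image continuous_on_subset[OF f]) (auto simp: compact_closure)
    then obtain B where B: "\<forall>y \<in> f ` closure (range T). norm y \<le> B" using compact_imp_bounded bounded_iff by metis
    have fB: "norm ((f \<circ> T) x) \<le> B" for x
      using B closure_subset[of "range T"] by auto
    have "(\<lambda>n. integral\<^sup>L ((m \<circ> id \<circ> r) n) (f \<circ> T)) \<longlonglongrightarrow> integral\<^sup>L M (f \<circ> T)"
      using fT by (intro weak_conv_imp_integral_bdd_continuous_conv[OF _ M wc _ fB])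
        (auto simp: md continuous_on_eq_continuous_at)
    moreover have "integral\<^sup>L (m n) (f \<circ> T) = (\<integral>w. f w \<partial>\<nu>s n)" for n
    proof -
      have "integral\<^sup>L (m n) (f \<circ> T) = (\<integral>w. f (T (s w)) \<partial>\<nu>s n)"
        unfolding m_def using smeas by (subst integral_distr) auto
      also have "\<dots> = (\<integral>w. f w \<partial>\<nu>s n)"
        using sT(1,6) by (intro prob_measures_on_integral_cong[OF \<nu>s compact_imp_closed[OF K]]) auto
      finally show ?thesis .
    qed
    moreover have "integral\<^sup>L M (f \<circ> T) = (\<integral>w. f w \<partial>\<nu>)"
      unfolding \<nu>_def by (subst integral_distr) (auto simp: comp_def)
    ultimately show ?thesis by simp
  qed
  have "AE w in \<nu>. w \<in> K"
  proof (cases "K = {}")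
    case True
    have "AE w in \<nu>s 0. w \<in> K" by (rule prob_measures_on_AE[OF \<nu>s compact_imp_closed[OF K]])
    hence False using True prob_space.AE_False[OF prob_measures_onD(1)[OF \<nu>s[of 0]]] by simp
    thus ?thesis ..
  next
    case False
    \<comment> \<open>Bounded, continuous and zero exactly on \<open>K\<close>: its integral is 0
      along the sequence and therefore in the limit.\<close>
    define f where "f w = min 1 (infdist w K)" for w
    have fc: "continuous_on UNIV f" unfolding f_def by (intro continuous_intros)
    interpret N: prob_space \<nu> by (rule \<nu>p)
    have [measurable_cong]: "sets \<nu> = sets borel" by (rule \<nu>p)
    have [measurable]: "f \<in> borel_measurable borel" using fc by (rule borel_measurable_continuous_onI)
    have "(\<integral>w. f w \<partial>\<nu>s n) = (\<integral>w. 0 \<partial>\<nu>s n)" for n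
      by (rule prob_measures_on_integral_cong[OF \<nu>s compact_imp_closed[OF K]]) (measurable, simp add: f_def)
    hence "(\<lambda>n. 0) \<longlonglongrightarrow> (\<integral>w. f w \<partial>\<nu>)" using conv[OF fc] by simp
    hence "(\<integral>w. f w \<partial>\<nu>) = 0" by (simp add: LIMSEQ_const_iff)
    moreover have "integrable \<nu> f" by (rule N.integrable_const_bound[of _ 1]) (auto simp: f_def infdist_nonneg)
    ultimately have "AE w in \<nu>. f w = 0" by (subst (asm) integral_nonneg_eq_0_iff_AE) (auto simp: f_def infdist_nonneg)
    thus ?thesis
    proof eventually_elim
      case (elim w)
      hence "infdist w K = 0" by (auto simp: f_def min_def split: if_splits)
      thus ?case using in_closed_iff_infdist_zero[OF compact_imp_closed[OF K] False] by simp
    qed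
  qed
  hence "\<nu> \<in> prob_measures_on K" by (rule prob_measures_onI[OF \<nu>p compact_imp_closed[OF K]])
  thus ?thesis using that[OF r] conv by (simp add: wconv_def comp_def)
qed

section \<open>Point distributions and polynomials with prescribed roots\<close>

definition uniform_on :: "nat \<Rightarrow> (nat \<Rightarrow> complex) \<Rightarrow> complex measure" where
  "uniform_on n a = distr (measure_pmf (pmf_of_set {..<n})) borel a"

lemma uniform_on_integral:
  fixes f :: "complex \<Rightarrow> real"
  assumes "0 < n" "f \<in> borel_measurable borel"
  shows "(\<integral>w. f w \<partial>uniform_on n a) = (\<Sum>i<n. f (a i)) / n"
proof -
  have "(\<integral>w. f w \<partial>uniform_on n a) = (\<integral>i. f (a i) \<partial>measure_pmf (pmf_of_set {..<n}))"
    unfolding uniform_on_def using assms(2) by (subst integral_distr) auto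
  also have "\<dots> = (\<Sum>i<n. f (a i)) / n" using assms(1) by (subst integral_pmf_of_set) auto
  finally show ?thesis .
qed

lemma uniform_on_prob_measures_on:
  assumes "0 < n" "closed K" "\<And>i. i < n \<Longrightarrow> a i \<in> K"
  shows "uniform_on n a \<in> prob_measures_on K"
proof (rule prob_measures_onI)
  show "prob_space (uniform_on n a)" unfolding uniform_on_def by (intro prob_space.prob_space_distr measure_pmf.prob_space_axioms) simp
  have "AE i in measure_pmf (pmf_of_set {..<n}). a i \<in> K" using assms(1,3) by (simp add: AE_measure_pmf_iff set_pmf_of_set lessThan_empty_iff)
  thus "AE w in uniform_on n a. w \<in> K" unfolding uniform_on_def using assms(2) by (subst AE_distr_iff) auto
qed (use assms in \<open>auto simp: uniform_on_def\<close>)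

lemma uniform_on_rpot: "0 < n \<Longrightarrow> rpot d (uniform_on n a) z = (\<Sum>i<n. lker d (a i) z) / n"
  unfolding rpot_def by (rule uniform_on_integral) measurable

text \<open>The roots are an indexed family, so multiplicities match the weights of
  \<open>uniform_on m a\<close>; off the roots, \<open>- ln (cmod (rootpoly m a z)) / m\<close> is
  the potential of that measure.\<close>

definition rootpoly :: "nat \<Rightarrow> (nat \<Rightarrow> complex) \<Rightarrow> complex \<Rightarrow> complex" where
  "rootpoly m a z = (\<Prod>i<m. z - a i)"

lemma continuous_on_rootpoly [continuous_intros]: "continuous_on A f \<Longrightarrow> continuous_on A (\<lambda>x. rootpoly m a (f x))"
  unfolding rootpoly_def by (intro continuous_intros)

lemma monic_poly_factorization:
  fixes p :: "complex poly"
  assumes "lead_coeff p = 1"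
  obtains w where "\<And>z. poly p z = rootpoly (degree p) w z"
proof -
  have "p \<noteq> 0" using assms by auto
  then obtain A where A: "size A = degree p" "p = smult (lead_coeff p) (\<Prod>x\<in>#A. [:-x, 1:])"
    using alg_closed_imp_factorization[OF \<open>p \<noteq> 0\<close>] by blast
  obtain xs where xs: "mset xs = A" using ex_mset by blast
  have "poly p z = rootpoly (degree p) (\<lambda>i. xs ! i) z" for z
  proof -
    have "p = (\<Prod>x\<in>#A. [:-x, 1:])" using A(2) unfolding assms by (simp only: smult_1_left)
    hence "poly p z = (\<Prod>x\<in>#A. poly [:-x, 1:] z)" by (simp only: poly_prod_mset)
    also have "\<dots> = (\<Prod>x\<in>#A. z - x)" by (intro arg_cong[of _ _ prod_mset] image_mset_cong) simp
    also have "\<dots> = prod_list (map (\<lambda>x. z - x) xs)" unfolding xs[symmetric] by (simp only: mset_map[symmetric] prod_mset_prod_list)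
    also have "\<dots> = (\<Prod>i<length xs. z - xs ! i)" by (simp add: prod.list_conv_set_nth atLeast0LessThan)
    also have "length xs = degree p" using A(1) xs by (metis size_mset)
    finally show ?thesis by (simp add: rootpoly_def)
  qed
  thus ?thesis using that by blast
qed

text \<open>Beyond this radius every factor exceeds \<open>1 + \<rho>\<close>, so the product is at
  least \<open>1 + \<rho>\<close>. The radius is independent of \<open>m\<close>, which confines
  lemniscates of growing degree to one disc.\<close>

lemma lemniscate_bounded:
  assumes m: "0 < m" and A: "\<And>i. i < m \<Longrightarrow> cmod (a i) \<le> A" and le: "cmod (rootpoly m a z) \<le> \<rho>" and \<rho>: "0 \<le> \<rho>"
  shows "cmod z \<le> A + 1 + \<rho>"
proof (rule ccontr)
  assume "\<not> ?thesis"
  hence z: "cmod z > A + 1 + \<rho>" by simp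
  have 1: "1 + \<rho> < cmod (z - a i)" if "i < m" for i
    using norm_triangle_ineq2[of z "a i"] A[OF that] z by linarith
  have "(1 + \<rho>) ^ m = (\<Prod>i<m. 1 + \<rho>)" by simp
  also have "\<dots> \<le> (\<Prod>i<m. cmod (z - a i))" using 1 \<rho> by (intro prod_mono) (auto intro: less_imp_le)
  also have "\<dots> = cmod (rootpoly m a z)" by (simp add: rootpoly_def prod_norm)
  finally have "(1 + \<rho>) ^ m \<le> \<rho>" using le by linarith
  moreover have "(1 + \<rho>) ^ 1 \<le> (1 + \<rho>) ^ m" using m \<rho> by (intro power_increasing) auto
  ultimately show False by simp
qed

lemma compact_lemniscate:
  assumes m: "0 < m" and \<rho>: "0 \<le> \<rho>"
  shows "compact {z. cmod (rootpoly m a z) \<le> \<rho>}" "compact {z. cmod (rootpoly m a z) = \<rho>}"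
proof -
  define A where "A = (\<Sum>i<m. cmod (a i))"
  have "cmod (a i) \<le> A" if "i < m" for i unfolding A_def using that by (intro member_le_sum) auto
  hence b: "bounded {z. cmod (rootpoly m a z) \<le> \<rho>}"
    unfolding bounded_iff using lemniscate_bounded[OF m _ _ \<rho>, of a A] by blast
  show "compact {z. cmod (rootpoly m a z) \<le> \<rho>}"
    unfolding compact_eq_bounded_closed by (intro conjI b closed_Collect_le continuous_intros)
  have "bounded {z. cmod (rootpoly m a z) = \<rho>}" by (rule bounded_subset[OF b]) auto
  thus "compact {z. cmod (rootpoly m a z) = \<rho>}"
    unfolding compact_eq_bounded_closed by (intro conjI closed_Collect_eq continuous_intros)
qed

text \<open>The squared modulus along the line is a real polynomial in \<open>x\<close> of positive
  degree \<open>2 * m\<close>.\<close>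

lemma finite_level_on_horizontal_line:
  assumes m: "0 < m"
  shows "finite {x::real. cmod (rootpoly m a (z + of_real x)) = \<rho>}"
proof -
  define P where "P = (\<Prod>i<m. [:(cmod (z - a i))\<^sup>2, 2 * Re (z - a i), 1:])"
  have "degree P = (\<Sum>i<m. degree [:(cmod (z - a i))\<^sup>2, 2 * Re (z - a i), 1:])"
    unfolding P_def by (rule degree_prod_eq_sum_degree) auto
  hence deg: "degree P = 2 * m" by simp
  have P: "(cmod (rootpoly m a (z + of_real x)))\<^sup>2 = poly P x" for x
  proof -
    have "(cmod (rootpoly m a (z + of_real x)))\<^sup>2 = (\<Prod>i<m. (cmod (z + of_real x - a i))\<^sup>2)"
      unfolding rootpoly_def prod_norm[symmetric] prod_power_distrib ..
    also have "\<dots> = poly P x" unfolding P_def poly_prod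
    proof (intro prod.cong refl)
      fix i
      have "(cmod (u + of_real x))\<^sup>2 = (cmod u)\<^sup>2 + x * (2 * Re u + x * 1)" for u
        unfolding cmod_power2 by (simp add: power2_eq_square algebra_simps)
      from this[of "z - a i"] show "(cmod (z + of_real x - a i))\<^sup>2 = poly [:(cmod (z - a i))\<^sup>2, 2 * Re (z - a i), 1:] x"
        by (simp add: algebra_simps)
    qed
    finally show ?thesis .
  qed
  have "P - [:\<rho>\<^sup>2:] \<noteq> 0"
  proof
    assume "P - [:\<rho>\<^sup>2:] = 0"
    hence "degree P = degree [:\<rho>\<^sup>2:]" by simp
    thus False using deg m by simp
  qed
  hence "finite {x. poly (P - [:\<rho>\<^sup>2:]) x = 0}" by (rule poly_roots_finite)
  thus ?thesis by (rule finite_subset[rotated]) (auto simp: P[symmetric])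
qed

section \<open>Lemniscates\<close>

text \<open>After division by \<open>M ^ Suc n\<close>, where \<open>M\<close> is the larger of
  \<open>cmod q\<close> and \<rho>, the modulus tends to 1; its logarithm disappears when divided by
  \<open>Suc n\<close>.\<close>

lemma ln_abs_diff_power_tendsto:
  fixes q :: complex and \<rho> :: real
  assumes \<rho>: "0 < \<rho>" and ne: "cmod q \<noteq> \<rho>"
  shows "(\<lambda>n. ln (cmod (q ^ Suc n - of_real \<rho> ^ Suc n)) / Suc n) \<longlonglongrightarrow> ln (max (cmod q) \<rho>)"
proof -
  define M where "M = max (cmod q) \<rho>"
  have M: "0 < M" using \<rho> by (simp add: M_def)
  define x where "x n = cmod (q ^ Suc n - of_real \<rho> ^ Suc n) / M ^ Suc n" for n
  have x1: "x \<longlonglongrightarrow> 1"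
  proof (cases "cmod q < \<rho>")
    case True
    have "(\<lambda>n. cmod ((q / of_real \<rho>) ^ Suc n - 1)) \<longlonglongrightarrow> cmod (0 - 1)"
      by (intro tendsto_intros LIMSEQ_Suc[OF LIMSEQ_power_zero]) (use True \<rho> in \<open>simp add: norm_divide\<close>)
    moreover have "cmod ((q / of_real \<rho>) ^ Suc n - 1) = x n" for n
    proof -
      have "(q / of_real \<rho>) ^ Suc n - 1 = (q ^ Suc n - of_real \<rho> ^ Suc n) / of_real \<rho> ^ Suc n"
        using \<rho> by (simp add: power_divide diff_divide_distrib)
      thus ?thesis unfolding x_def M_def using True \<rho> by (simp add: norm_divide norm_power norm_mult)
    qed
    ultimately show ?thesis by simp
  next
    case False
    hence q: "\<rho> < cmod q" "q \<noteq> 0" using ne \<rho> by auto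
    have "(\<lambda>n. cmod (1 - (of_real \<rho> / q) ^ Suc n)) \<longlonglongrightarrow> cmod (1 - 0)"
      by (intro tendsto_intros LIMSEQ_Suc[OF LIMSEQ_power_zero]) (use q \<rho> in \<open>simp add: norm_divide\<close>)
    moreover have "cmod (1 - (of_real \<rho> / q) ^ Suc n) = x n" for n
    proof -
      have "1 - (of_real \<rho> / q) ^ Suc n = (q ^ Suc n - of_real \<rho> ^ Suc n) / q ^ Suc n"
        using q by (simp add: power_divide diff_divide_distrib)
      thus ?thesis unfolding x_def M_def using q by (simp add: norm_divide norm_power norm_mult)
    qed
    ultimately show ?thesis by simp
  qed
  have "(\<lambda>n. ln (x n)) \<longlonglongrightarrow> ln 1" using x1 by (rule tendsto_ln) simp
  hence "(\<lambda>n. ln M + ln (x n) * inverse (real (Suc n))) \<longlonglongrightarrow> ln M + ln 1 * 0"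
    by (rule tendsto_add[OF tendsto_const tendsto_mult[OF _ LIMSEQ_inverse_real_of_nat]])
  moreover have "eventually (\<lambda>n. ln M + ln (x n) * inverse (real (Suc n)) = ln (cmod (q ^ Suc n - of_real \<rho> ^ Suc n)) / Suc n) sequentially"
    using order_tendstoD(1)[OF x1, of 0]
  proof (rule eventually_mono)
    fix n assume "0 < x n"
    moreover have "cmod (q ^ Suc n - of_real \<rho> ^ Suc n) = M ^ Suc n * x n" using M by (simp add: x_def)
    ultimately have "ln (cmod (q ^ Suc n - of_real \<rho> ^ Suc n)) = real (Suc n) * ln M + ln (x n)"
      using M by (simp only: ln_mult_pos zero_less_power ln_realpow)
    thus "ln M + ln (x n) * inverse (real (Suc n)) = ln (cmod (q ^ Suc n - of_real \<rho> ^ Suc n)) / Suc n"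
      by (simp add: field_simps del: of_nat_Suc)
  qed simp
  ultimately show ?thesis by (simp add: M_def tendsto_cong)
qed

lemma rootpoly_power_diff_factorization:
  assumes m: "0 < m" and N: "0 < N"
  obtains w where "\<And>z. rootpoly m a z ^ N - c = rootpoly (m * N) w z"
proof -
  define Q where "Q = (\<Prod>i<m. [:- a i, 1:])"
  have Q: "poly Q z = rootpoly m a z" for z by (simp add: Q_def rootpoly_def poly_prod)
  have "degree Q = (\<Sum>i<m. degree [:- a i, 1:])" unfolding Q_def by (rule degree_prod_eq_sum_degree) auto
  hence dQ: "degree Q = m" by simp
  have lQ: "lead_coeff Q = 1" unfolding Q_def lead_coeff_prod by simp
  have d1: "degree (Q ^ N) = m * N" using lQ dQ by (subst degree_power_eq) (auto simp: mult.commute)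
  define p where "p = Q ^ N + [:- c:]"
  have dp: "degree p = m * N" unfolding p_def using d1 m N by (subst degree_add_eq_left) auto
  have lp: "lead_coeff p = 1"
  proof -
    have "lead_coeff p = lead_coeff (Q ^ N)"
      using lead_coeff_add_le[of "[:- c:]" "Q ^ N"] d1 m N by (simp add: p_def add.commute)
    thus ?thesis using lQ by (simp add: lead_coeff_power)
  qed
  obtain w where "\<And>z. poly p z = rootpoly (degree p) w z" using monic_poly_factorization[OF lp] by blast
  hence "rootpoly m a z ^ N - c = rootpoly (m * N) w z" for z
    unfolding dp by (simp add: p_def Q poly_power)
  thus ?thesis by (rule that)
qed

lemma continuous_on_neg_ln_max:
  "0 < \<eta> \<Longrightarrow> continuous_on UNIV (\<lambda>w. - ln (max (cmod (w - z)) \<eta>))"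
  by (intro continuous_intros) auto

text \<open>Let \<open>q = rootpoly m a\<close>. The zeros of \<open>q ^ N - \<rho> ^ N\<close> lie
  on the level curve, and their potential at \<open>z\<close> off the curve is
  \<open>- ln (cmod (q z ^ N - \<rho> ^ N)) / (m * N)\<close>, which converges to the stated value.
  A weak limit of these root distributions thus has an explicit potential. Exactness is claimed off
  the curve only; on the curve an upper bound is kept.\<close>

theorem lemniscate_measure:
  assumes m: "0 < m" and \<rho>: "0 < \<rho>"
  obtains \<tau> where "\<tau> \<in> prob_measures_on {z. cmod (rootpoly m a z) = \<rho>}"
    "\<And>z d. 0 < d \<Longrightarrow> rpot d \<tau> z \<le> - ln (max (cmod (rootpoly m a z)) \<rho>) / m"
    "\<And>z. cmod (rootpoly m a z) \<noteq> \<rho> \<Longrightarrow>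
      (\<lambda>n. rpot (inverse (real (Suc n))) \<tau> z) \<longlonglongrightarrow> - ln (max (cmod (rootpoly m a z)) \<rho>) / m"
proof -
  let ?q = "rootpoly m a"
  define L where "L = {z. cmod (?q z) = \<rho>}"
  have L: "compact L" unfolding L_def using compact_lemniscate(2)[OF m] \<rho> by simp
  have "\<exists>w. \<forall>z. ?q z ^ Suc n - of_real \<rho> ^ Suc n = rootpoly (m * Suc n) w z" for n
    by (rule rootpoly_power_diff_factorization[OF m zero_less_Suc, of a n "of_real \<rho> ^ Suc n"]) blast
  then obtain w where w: "?q z ^ Suc n - of_real \<rho> ^ Suc n = rootpoly (m * Suc n) (w n) z" for n z
    by metis
  have wL: "w n i \<in> L" if "i < m * Suc n" for n i
  proof -
    have "rootpoly (m * Suc n) (w n) (w n i) = 0"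
      unfolding rootpoly_def using that by (intro prod_zero) auto
    hence "?q (w n i) ^ Suc n = of_real \<rho> ^ Suc n" using w[of "w n i" n] by simp
    hence "cmod (?q (w n i)) ^ Suc n = \<rho> ^ Suc n" using \<rho> by (metis norm_power norm_of_real abs_of_pos)
    hence "cmod (?q (w n i)) = \<rho>" by (rule power_eq_imp_eq_base) (use \<rho> in auto)
    thus ?thesis by (simp add: L_def)
  qed
  define \<sigma> where "\<sigma> n = uniform_on (m * Suc n) (w n)" for n
  have \<sigma>: "\<sigma> n \<in> prob_measures_on L" for n
    unfolding \<sigma>_def using m wL by (intro uniform_on_prob_measures_on compact_imp_closed[OF L]) auto
  obtain r \<tau> where r: "strict_mono (r :: nat \<Rightarrow> nat)" and \<tau>: "\<tau> \<in> prob_measures_on L" and wc: "wconv (\<sigma> \<circ> r) \<tau>"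
    using prob_measures_on_wconv_compact[OF L \<sigma>] .
  note P = prob_measures_on_P_log[OF \<tau> L]
  \<comment> \<open>Truncating at a lower bound \<eta> for the distance from \<open>z\<close> to the
    curve gives a continuous test function that agrees with the logarithmic kernel on the curve,
    which carries all measures involved.\<close>
  have off: "\<exists>\<eta>>0. (\<forall>u\<in>L. \<eta> \<le> cmod (u - z)) \<and> (\<integral>u. - ln (max (cmod (u - z)) \<eta>) \<partial>\<tau>) = - ln (max (cmod (?q z)) \<rho>) / m"
    if z: "cmod (?q z) \<noteq> \<rho>" for z
  proof -
    have "z \<notin> L" using z by (simp add: L_def)
    then obtain \<eta> where \<eta>: "0 < \<eta>" "\<And>u. u \<in> L \<Longrightarrow> \<eta> \<le> cmod (u - z)"
      using separate_point_closed[OF compact_imp_closed[OF L]] by (metis dist_commute dist_norm)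
    have cg: "continuous_on UNIV (\<lambda>u. - ln (max (cmod (u - z)) \<eta>))" by (rule continuous_on_neg_ln_max[OF \<eta>(1)])
    have I: "(\<integral>u. - ln (max (cmod (u - z)) \<eta>) \<partial>\<sigma> n) = - (ln (cmod (?q z ^ Suc n - of_real \<rho> ^ Suc n)) / Suc n) / m" for n
    proof -
      have "(\<integral>u. - ln (max (cmod (u - z)) \<eta>) \<partial>\<sigma> n) = (\<Sum>i<m * Suc n. - ln (max (cmod (w n i - z)) \<eta>)) / (m * Suc n)"
        unfolding \<sigma>_def using m by (subst uniform_on_integral) (auto intro!: borel_measurable_continuous_UNIV[OF cg])
      also have "(\<Sum>i<m * Suc n. - ln (max (cmod (w n i - z)) \<eta>)) = (\<Sum>i<m * Suc n. - ln (cmod (z - w n i)))"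
        using \<eta>(2)[OF wL] by (intro sum.cong refl) (simp add: norm_minus_commute max_absorb1 del: mult_Suc_right)
      also have "\<dots> = - ln (\<Prod>i<m * Suc n. cmod (z - w n i))"
      proof (subst ln_prod)
        fix i assume "i \<in> {..<m * Suc n}"
        hence "i < m * Suc n" by simp
        hence "\<eta> \<le> cmod (w n i - z)" by (intro \<eta>(2) wL)
        thus "cmod (z - w n i) \<noteq> 0" using \<eta>(1) by (simp only: norm_minus_commute)
      qed (simp_all add: sum_negf)
      also have "(\<Prod>i<m * Suc n. cmod (z - w n i)) = cmod (?q z ^ Suc n - of_real \<rho> ^ Suc n)"
        unfolding w by (simp add: rootpoly_def prod_norm)
      finally show ?thesis by (simp add: field_simps)
    qed
    have "(\<lambda>n. \<integral>u. - ln (max (cmod (u - z)) \<eta>) \<partial>\<sigma> n) \<longlonglongrightarrow> - ln (max (cmod (?q z)) \<rho>) / m"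
      unfolding I using m by (intro tendsto_intros ln_abs_diff_power_tendsto \<rho> z) auto
    from LIMSEQ_subseq_LIMSEQ[OF this r]
    have "(\<lambda>n. \<integral>u. - ln (max (cmod (u - z)) \<eta>) \<partial>\<sigma> (r n)) \<longlonglongrightarrow> - ln (max (cmod (?q z)) \<rho>) / m" by (simp add: comp_def)
    moreover have "(\<lambda>n. \<integral>u. - ln (max (cmod (u - z)) \<eta>) \<partial>\<sigma> (r n)) \<longlonglongrightarrow> (\<integral>u. - ln (max (cmod (u - z)) \<eta>) \<partial>\<tau>)"
      using wconvD[OF wc cg] by simp
    ultimately show ?thesis using \<eta> LIMSEQ_unique by blast
  qed
  have T2': "rpot d \<tau> z \<le> - ln (max (cmod (?q z)) \<rho>) / m" if d: "0 < d" and z: "cmod (?q z) \<noteq> \<rho>" for d z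
  proof -
    obtain \<eta> where \<eta>: "0 < \<eta>" "\<forall>u\<in>L. \<eta> \<le> cmod (u - z)" and I: "(\<integral>u. - ln (max (cmod (u - z)) \<eta>) \<partial>\<tau>) = - ln (max (cmod (?q z)) \<rho>) / m"
      using off[OF z] by blast
    have "rpot d \<tau> z \<le> (\<integral>u. - ln (max (cmod (u - z)) \<eta>) \<partial>\<tau>)"
      unfolding rpot_def
    proof (rule integral_mono_AE)
      show "AE u in \<tau>. lker d u z \<le> - ln (max (cmod (u - z)) \<eta>)"
        using prob_measures_on_AE[OF \<tau> compact_imp_closed[OF L]]
      proof eventually_elim
        case (elim u)
        hence "\<eta> \<le> cmod (u - z)" using \<eta> by blast
        moreover from this \<eta>(1) have "0 < cmod (u - z)" by linarith
        ultimately show ?case using lker_le_neg_ln[OF d _ order_refl, of u z] by (simp only: max_absorb1)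
      qed
    qed (rule integrable_lker[OF P d], rule prob_measures_on_integrable[OF \<tau> L continuous_on_neg_ln_max[OF \<eta>(1)]])
    thus ?thesis unfolding I .
  qed
  have T2: "rpot d \<tau> z \<le> - ln (max (cmod (?q z)) \<rho>) / m" if d: "0 < d" for d z
  proof (cases "cmod (?q z) = \<rho>")
    case True
    have "rpot d \<tau> z \<le> - ln \<rho> / m + e" if e: "0 < e" for e
    proof -
      \<comment> \<open>For a point on the curve the bound comes from a horizontal neighbour off the
        curve; a shift below \<open>e * sqrt d\<close> costs at most \<open>e\<close> by the
        Lipschitz bound.\<close>
      have "infinite {0<..<e * sqrt d}" using e d by (intro infinite_Ioo) auto
      then obtain x where x: "x \<in> {0<..<e * sqrt d}" "x \<notin> {x. cmod (?q (z + of_real x)) = \<rho>}"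
        using finite_level_on_horizontal_line[OF m, of a z \<rho>] by (meson finite_subset subsetI)
      have "rpot d \<tau> z \<le> rpot d \<tau> (z + of_real x) + cmod (z - (z + of_real x)) / sqrt d"
        using rpot_lipschitz[OF P d, of z "z + of_real x"] by linarith
      moreover have "cmod (z - (z + of_real x)) / sqrt d \<le> e" using x d by (simp add: field_simps)
      moreover have "rpot d \<tau> (z + of_real x) \<le> - ln (max (cmod (?q (z + of_real x))) \<rho>) / m"
        using x by (intro T2' d) auto
      moreover have "- ln (max (cmod (?q (z + of_real x))) \<rho>) / m \<le> - ln \<rho> / m"
        using \<rho> by (intro divide_right_mono) auto
      ultimately show ?thesis by linarith
    qed
    thus ?thesis unfolding True by (simp add: field_le_epsilon)
  qed (rule T2'[OF d])
  have T3: "(\<lambda>n. rpot (inverse (real (Suc n))) \<tau> z) \<longlonglongrightarrow> - ln (max (cmod (?q z)) \<rho>) / m" if z: "cmod (?q z) \<noteq> \<rho>" for z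
  proof -
    obtain \<eta> where \<eta>: "0 < \<eta>" "\<forall>u\<in>L. \<eta> \<le> cmod (u - z)" and I: "(\<integral>u. - ln (max (cmod (u - z)) \<eta>) \<partial>\<tau>) = - ln (max (cmod (?q z)) \<rho>) / m"
      using off[OF z] by blast
    note AEL = prob_measures_on_AE[OF \<tau> compact_imp_closed[OF L]]
    note cg = continuous_on_neg_ln_max[OF \<eta>(1), of z]
    have "(\<lambda>n. rpot (inverse (real (Suc n))) \<tau> z) \<longlonglongrightarrow> (\<integral>u. - ln (max (cmod (u - z)) \<eta>) \<partial>\<tau>)"
      unfolding rpot_def
    proof (rule integral_dominated_convergence[where w = "\<lambda>u. \<bar>- ln (max (cmod (u - z)) \<eta>)\<bar> + \<bar>lker 1 u z\<bar>"])
      show "(\<lambda>u. - ln (max (cmod (u - z)) \<eta>)) \<in> borel_measurable \<tau>"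
        by (rule prob_measures_on_measurable[OF \<tau> borel_measurable_continuous_UNIV[OF cg]])
      show "(\<lambda>u. lker (inverse (real (Suc n))) u z) \<in> borel_measurable \<tau>" for n
        by (rule prob_measures_on_measurable[OF \<tau>]) measurable
      show "integrable \<tau> (\<lambda>u. \<bar>- ln (max (cmod (u - z)) \<eta>)\<bar> + \<bar>lker 1 u z\<bar>)"
        by (intro Bochner_Integration.integrable_add integrable_abs prob_measures_on_integrable[OF \<tau> L cg] integrable_lker[OF P]) simp
      show "AE u in \<tau>. (\<lambda>n. lker (inverse (real (Suc n))) u z) \<longlonglongrightarrow> - ln (max (cmod (u - z)) \<eta>)"
        using AEL
      proof eventually_elim
        case (elim u)
        hence u: "\<eta> \<le> cmod (u - z)" using \<eta> by blast
        hence p: "0 < cmod (u - z)" using \<eta>(1) by linarith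
        have "(\<lambda>n. - ln ((cmod (u - z))\<^sup>2 + inverse (real (Suc n))) / 2) \<longlonglongrightarrow> - ln ((cmod (u - z))\<^sup>2 + 0) / 2"
          using p by (intro tendsto_intros LIMSEQ_inverse_real_of_nat) auto
        thus ?case using p u by (simp add: lker_def ln_realpow max_absorb1)
      qed
      show "AE u in \<tau>. norm (lker (inverse (real (Suc n))) u z) \<le> \<bar>- ln (max (cmod (u - z)) \<eta>)\<bar> + \<bar>lker 1 u z\<bar>" for n
        using AEL
      proof eventually_elim
        case (elim u)
        hence u: "\<eta> \<le> cmod (u - z)" using \<eta> by blast
        have "lker 1 u z \<le> lker (inverse (real (Suc n))) u z" by (rule lker_antimono) (auto simp: field_simps)
        moreover have "lker (inverse (real (Suc n))) u z \<le> - ln (max (cmod (u - z)) \<eta>)"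
        proof -
          have "0 < cmod (u - z)" using u \<eta>(1) by linarith
          thus ?thesis using lker_le_neg_ln[of "inverse (real (Suc n))" "cmod (u - z)" u z] u by (simp add: max_absorb1)
        qed
        ultimately show ?case unfolding real_norm_def by linarith
      qed
    qed
    thus ?thesis unfolding I .
  qed
  show ?thesis by (rule that[OF \<tau>[unfolded L_def] T2 T3])
qed

text \<open>If \<open>q\<close> is monic of degree \<open>m\<close> and \<open>\<bar>q\<bar> < \<rho>\<close> on \<open>K\<close>, then the lemniscate measure has the constant potential
  \<open>- ln \<rho> / m\<close> on \<open>K\<close>; nonnegativity of the energy distance to it bounds every energy on \<open>K\<close> from below.\<close>

lemma energy_ge_lemniscate:
  assumes m: "0 < m" and \<rho>: "0 < \<rho>" and K: "compact K" and lt: "\<And>z. z \<in> K \<Longrightarrow> cmod (rootpoly m a z) < \<rho>"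
    and \<nu>: "\<nu> \<in> prob_measures_on K" and le: "log_energy \<nu> \<le> ereal c"
  shows "- ln \<rho> / m \<le> c"
proof -
  define v where "v = - ln \<rho> / m"
  let ?L = "{z. cmod (rootpoly m a z) = \<rho>}"
  obtain \<tau> where \<tau>: "\<tau> \<in> prob_measures_on ?L"
    and T2: "\<And>z d. 0 < d \<Longrightarrow> rpot d \<tau> z \<le> - ln (max (cmod (rootpoly m a z)) \<rho>) / m"
    and T3: "\<And>z. cmod (rootpoly m a z) \<noteq> \<rho> \<Longrightarrow>
      (\<lambda>n. rpot (inverse (real (Suc n))) \<tau> z) \<longlonglongrightarrow> - ln (max (cmod (rootpoly m a z)) \<rho>) / m"
    using lemniscate_measure[OF m \<rho>] by metis
  have L: "compact ?L" using compact_lemniscate(2)[OF m] \<rho> by simp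
  note P = prob_measures_on_P_log[OF \<tau> L]
  have "bounded (K \<union> ?L)" using K L compact_imp_bounded by auto
  then obtain R where "\<forall>x\<in>K \<union> ?L. norm x \<le> R" unfolding bounded_iff ..
  hence R: "K \<union> ?L \<subseteq> cball 0 R" by (simp add: subset_iff)
  have \<nu>R: "\<nu> \<in> prob_measures_on (cball 0 R)" and \<tau>R: "\<tau> \<in> prob_measures_on (cball 0 R)"
    using prob_measures_on_mono[OF \<nu> compact_imp_closed[OF K] closed_cball] prob_measures_on_mono[OF \<tau> compact_imp_closed[OF L] closed_cball] R by auto
  have 1: "rpot d \<tau> z \<le> v" if "0 < d" for d z
    using T2[OF that, of z] \<rho> by (intro order_trans[OF T2[OF that]]) (auto simp: v_def intro!: divide_right_mono)
  have 2: "(\<lambda>n. rpot (inverse (real (Suc n))) \<tau> z) \<longlonglongrightarrow> v" if "z \<in> K" for z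
    using T3[of z] lt[OF that] by (simp add: v_def max_absorb2)
  interpret N: prob_space \<nu> by (rule prob_measures_onD[OF \<nu>])
  have rm: "rpot (inverse (real (Suc n))) \<tau> \<in> borel_measurable \<nu>" for n
    by (rule prob_measures_on_measurable[OF \<nu> borel_measurable_continuous_UNIV[OF continuous_on_rpot[OF P]]]) simp
  have "(\<lambda>n. renergy (inverse (real (Suc n))) \<tau> \<nu>) \<longlonglongrightarrow> (\<integral>z. v \<partial>\<nu>)"
    unfolding renergy_def
  proof (rule integral_dominated_convergence[where w = "\<lambda>z. \<bar>v\<bar> + \<bar>rpot 1 \<tau> z\<bar>"])
    show "integrable \<nu> (\<lambda>z. \<bar>v\<bar> + \<bar>rpot 1 \<tau> z\<bar>)"
      using integrable_rpot[OF \<nu> K P] by auto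
    show "AE z in \<nu>. (\<lambda>n. rpot (inverse (real (Suc n))) \<tau> z) \<longlonglongrightarrow> v"
      using prob_measures_on_AE[OF \<nu> compact_imp_closed[OF K]] 2 by (rule eventually_mono)
    show "AE z in \<nu>. norm (rpot (inverse (real (Suc n))) \<tau> z) \<le> \<bar>v\<bar> + \<bar>rpot 1 \<tau> z\<bar>" for n
    proof (rule AE_I2)
      fix z
      have "rpot 1 \<tau> z \<le> rpot (inverse (real (Suc n))) \<tau> z" by (rule rpot_antimono[OF P]) (auto simp: field_simps)
      moreover have "rpot (inverse (real (Suc n))) \<tau> z \<le> v" by (rule 1) simp
      ultimately show "norm (rpot (inverse (real (Suc n))) \<tau> z) \<le> \<bar>v\<bar> + \<bar>rpot 1 \<tau> z\<bar>" unfolding real_norm_def by linarith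
    qed
  qed (use rm in auto)
  hence lim: "(\<lambda>n. renergy (inverse (real (Suc n))) \<tau> \<nu>) \<longlonglongrightarrow> v" by (simp add: N.prob_space)
  have "2 * renergy (inverse (real (Suc n))) \<tau> \<nu> - v \<le> c" for n
  proof -
    let ?d = "inverse (real (Suc n))"
    have d: "0 < ?d" by simp
    have "0 \<le> energy_dist ?d \<tau> \<nu>" by (rule energy_dist_nonneg[OF \<tau>R \<nu>R d])
    moreover have "renergy ?d \<tau> \<tau> \<le> v" unfolding renergy_def
      by (rule prob_measures_on_integral_le[OF \<tau> compact_imp_closed[OF L] integrable_rpot[OF \<tau> L P d] 1[OF d]])
    moreover have "renergy ?d \<nu> \<nu> \<le> c" using le d unfolding log_energy_le_iff[OF \<nu> K] by blast
    ultimately show ?thesis unfolding energy_dist_def by linarith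
  qed
  moreover have "(\<lambda>n. 2 * renergy (inverse (real (Suc n))) \<tau> \<nu> - v) \<longlonglongrightarrow> 2 * v - v" by (intro tendsto_intros lim)
  ultimately have "2 * v - v \<le> c" by (intro LIMSEQ_le_const2) auto
  thus ?thesis by (simp add: v_def)
qed

section \<open>Fekete points\<close>

text \<open>The left side is a polynomial in \<open>x\<close> of degree below \<open>n\<close> that
  takes the value 1 at the \<open>n\<close> nodes.\<close>

lemma Lagrange_sum_eq_1:
  fixes z :: "nat \<Rightarrow> complex"
  assumes n: "0 < n" and inj: "inj_on z {..<n}"
  shows "(\<Sum>i<n. \<Prod>j\<in>{..<n} - {i}. (x - z j) / (z i - z j)) = 1"
proof -
  define p where "p = (\<Sum>i<n. smult (\<Prod>j\<in>{..<n} - {i}. inverse (z i - z j)) (\<Prod>j\<in>{..<n} - {i}. [:- z j, 1:]))"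
  have px: "poly p x = (\<Sum>i<n. \<Prod>j\<in>{..<n} - {i}. (x - z j) / (z i - z j))" for x
    by (simp add: p_def poly_sum poly_prod prod.distrib[symmetric] divide_inverse mult.commute)
  have "degree p \<le> n - 1"
    unfolding p_def
  proof (rule degree_sum_le)
    fix i assume i: "i \<in> {..<n}"
    have "degree (smult (\<Prod>j\<in>{..<n} - {i}. inverse (z i - z j)) (\<Prod>j\<in>{..<n} - {i}. [:- z j, 1:])) \<le> degree (\<Prod>j\<in>{..<n} - {i}. [:- z j, 1:])"
      by (rule degree_smult_le)
    also have "\<dots> = (\<Sum>j\<in>{..<n} - {i}. degree [:- z j, 1:])" by (rule degree_prod_eq_sum_degree) auto
    also have "\<dots> = n - 1" using i by simp
    finally show "degree (smult (\<Prod>j\<in>{..<n} - {i}. inverse (z i - z j)) (\<Prod>j\<in>{..<n} - {i}. [:- z j, 1:])) \<le> n - 1" .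
  qed simp
  moreover have "card (z ` {..<n}) = n" using inj by (simp add: card_image)
  ultimately have "p = 1"
  proof (intro poly_eqI_degree[of "z ` {..<n}"])
    fix y assume "y \<in> z ` {..<n}"
    then obtain k where k: "k < n" "y = z k" by auto
    have "poly p y = (\<Prod>j\<in>{..<n} - {k}. (z k - z j) / (z k - z j))"
    proof -
      have "(\<Prod>j\<in>{..<n} - {i}. (z k - z j) / (z i - z j)) = 0" if "i \<in> {..<n} - {k}" for i
        using that k by (intro prod_zero) (auto intro!: bexI[of _ k])
      hence "(\<Sum>i\<in>{..<n} - {k}. \<Prod>j\<in>{..<n} - {i}. (z k - z j) / (z i - z j)) = 0" by (intro sum.neutral ballI)
      moreover have "poly p y = (\<Prod>j\<in>{..<n} - {k}. (z k - z j) / (z k - z j)) +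
          (\<Sum>i\<in>{..<n} - {k}. \<Prod>j\<in>{..<n} - {i}. (z k - z j) / (z i - z j))"
        unfolding px k(2) using k(1) by (intro sum.remove) auto
      ultimately show ?thesis by (simp only: add_0_right)
    qed
    also have "\<dots> = 1"
    proof (rule prod.neutral, rule ballI)
      fix j assume "j \<in> {..<n} - {k}"
      hence "z k \<noteq> z j" using inj k(1) by (auto simp: inj_on_def)
      thus "(z k - z j) / (z k - z j) = 1" by simp
    qed
    finally show "poly p y = poly 1 y" by simp
  qed (use n in auto)
  thus ?thesis using px[of x] by simp
qed

text \<open>\<open>H\<close> says that every monic polynomial of degree \<open>k\<close> has sup
  norm at least \<open>c ^ k\<close> on \<open>K\<close>. In a configuration maximising the product
  of mutual distances, moving the \<open>i\<close>-th point within \<open>K\<close> cannot increase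
  its product of distances to the others, so that product is at least the one at the point supplied
  by \<open>H\<close>.\<close>

lemma Fekete_points:
  fixes K :: "complex set"
  assumes K: "compact K" and c: "0 < c"
    and H: "\<And>J a. finite J \<Longrightarrow> \<exists>x\<in>K. c ^ card J \<le> (\<Prod>j\<in>J. cmod (x - a (j::nat)))"
  obtains z :: "nat \<Rightarrow> complex" where "\<And>i. z i \<in> K" "inj_on z {..<n}"
    "\<And>i. i < n \<Longrightarrow> c ^ (n - 1) \<le> (\<Prod>j\<in>{..<n} - {i}. cmod (z i - z j))"
proof -
  \<comment> \<open>Ordered pairs: every distance occurs twice, whence the square in
    \<open>split\<close>.\<close>
  define P where "P = {(i, j). i < n \<and> j < n \<and> i \<noteq> (j::nat)}"
  have fP: "finite P" by (rule finite_subset[of _ "{..<n} \<times> {..<n}"]) (auto simp: P_def)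
  define F where "F z = (\<Prod>p\<in>P. cmod (z (fst p) - z (snd p)))" for z :: "nat \<Rightarrow> complex"
  define S where "S = (PiE UNIV (\<lambda>_::nat. K))"
  \<comment> \<open>A polynomial whose roots are all points of a finite \<open>K\<close> would
    vanish on \<open>K\<close>, against \<open>H\<close>. Infinitely many points then supply a
    configuration with positive product.\<close>
  have "infinite K"
  proof
    assume fin: "finite K"
    then obtain a :: "nat \<Rightarrow> complex" where a: "K = a ` {..<card K}"
      by (metis finite_imp_nat_seg_image_inj_on card_image lessThan_def card_lessThan)
    obtain x where x: "x \<in> K" "c ^ card {..<card K} \<le> (\<Prod>j<card K. cmod (x - a j))" using H[of "{..<card K}" a] by auto
    then obtain i where "i < card K" "x = a i" using a by auto
    hence "(\<Prod>j<card K. cmod (x - a j)) = 0" by (intro prod_zero) auto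
    hence "c ^ card {..<card K} \<le> 0" using x(2) by (simp only:)
    moreover have "0 < c ^ card {..<card K}" using c by (rule zero_less_power)
    ultimately show False by linarith
  qed
  then obtain f :: "nat \<Rightarrow> complex" where f: "inj f" "range f \<subseteq> K" using infinite_countable_subset by blast
  have "compactin (product_topology (\<lambda>_. euclidean) UNIV) S"
    unfolding S_def compactin_PiE using K by simp
  hence "compact S" unfolding euclidean_product_topology by simp
  moreover have "S \<noteq> {}" using f by (auto simp: S_def PiE_UNIV_domain)
  moreover have "continuous_on S F" unfolding F_def
    by (intro continuous_intros continuous_on_subset[OF continuous_on_product_coordinates]) auto
  ultimately obtain z where z: "z \<in> S" "\<And>y. y \<in> S \<Longrightarrow> F y \<le> F z"
    using continuous_attains_sup by metis
  have zK: "z i \<in> K" for i using z(1) by (auto simp: S_def PiE_UNIV_domain)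
  have "f \<in> S" using f by (auto simp: S_def PiE_UNIV_domain)
  moreover have "0 < F f" unfolding F_def using f(1) by (intro prod_pos) (auto simp: P_def inj_eq)
  ultimately have Fz: "0 < F z" using z(2) by (metis less_le_trans)
  have ne: "z i \<noteq> z j" if "i < n" "j < n" "i \<noteq> j" for i j
  proof
    assume "z i = z j"
    hence "F z = 0" unfolding F_def using that by (intro prod_zero fP bexI[of _ "(i, j)"]) (auto simp: P_def)
    thus False using Fz by simp
  qed
  have "c ^ (n - 1) \<le> (\<Prod>j\<in>{..<n} - {i}. cmod (z i - z j))" if i: "i < n" for i
  proof -
    define J where "J = {..<n} - {i}"
    define O' where "O' = {(a, b) \<in> P. a \<noteq> i \<and> b \<noteq> i}"
    have finO: "finite O'" by (rule finite_subset[OF _ fP]) (auto simp: O'_def)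
    have split: "F y = (\<Prod>p\<in>O'. cmod (y (fst p) - y (snd p))) * (\<Prod>j\<in>J. cmod (y i - y j))\<^sup>2" for y
    proof -
      have "P = O' \<union> ((\<lambda>j. (i, j)) ` J \<union> (\<lambda>j. (j, i)) ` J)" using i by (auto simp: P_def O'_def J_def)
      hence "F y = (\<Prod>p\<in>O' \<union> ((\<lambda>j. (i, j)) ` J \<union> (\<lambda>j. (j, i)) ` J). cmod (y (fst p) - y (snd p)))" by (simp only: F_def)
      also have "\<dots> = (\<Prod>p\<in>O'. cmod (y (fst p) - y (snd p))) * ((\<Prod>p\<in>(\<lambda>j. (i, j)) ` J. cmod (y (fst p) - y (snd p))) * (\<Prod>p\<in>(\<lambda>j. (j, i)) ` J. cmod (y (fst p) - y (snd p))))"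
      proof -
        have fJ: "finite J" by (simp add: J_def)
        have 1: "O' \<inter> ((\<lambda>j. (i, j)) ` J \<union> (\<lambda>j. (j, i)) ` J) = {}" by (auto simp: O'_def)
        have 2: "(\<lambda>j. (i, j)) ` J \<inter> (\<lambda>j. (j, i)) ` J = {}" by (auto simp: J_def)
        show ?thesis
          unfolding prod.union_disjoint[OF finO finite_UnI[OF finite_imageI[OF fJ] finite_imageI[OF fJ]] 1]
            prod.union_disjoint[OF finite_imageI[OF fJ] finite_imageI[OF fJ] 2] ..
      qed
      also have "(\<Prod>p\<in>(\<lambda>j. (i, j)) ` J. cmod (y (fst p) - y (snd p))) = (\<Prod>j\<in>J. cmod (y i - y j))"
        by (subst prod.reindex) (auto simp: inj_on_def)
      also have "(\<Prod>p\<in>(\<lambda>j. (j, i)) ` J. cmod (y (fst p) - y (snd p))) = (\<Prod>j\<in>J. cmod (y i - y j))"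
        by (subst prod.reindex) (auto simp: inj_on_def norm_minus_commute)
      finally show ?thesis by (simp add: power2_eq_square)
    qed
    obtain x where x: "x \<in> K" "c ^ card J \<le> (\<Prod>j\<in>J. cmod (x - z j))" using H[of J z] by (auto simp: J_def)
    define y where "y = z(i := x)"
    have "y \<in> S" using x(1) zK by (simp add: S_def PiE_UNIV_domain y_def)
    hence "F y \<le> F z" by (rule z(2))
    moreover have "(\<Prod>p\<in>O'. cmod (y (fst p) - y (snd p))) = (\<Prod>p\<in>O'. cmod (z (fst p) - z (snd p)))"
      by (intro prod.cong refl) (auto simp: O'_def y_def)
    moreover have "(\<Prod>j\<in>J. cmod (y i - y j)) = (\<Prod>j\<in>J. cmod (x - z j))"
      by (intro prod.cong refl) (auto simp: J_def y_def)
    moreover have "0 < (\<Prod>p\<in>O'. cmod (z (fst p) - z (snd p)))"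
      using ne by (intro prod_pos) (auto simp: O'_def P_def)
    ultimately have "(\<Prod>j\<in>J. cmod (x - z j))\<^sup>2 \<le> (\<Prod>j\<in>J. cmod (z i - z j))\<^sup>2"
      unfolding split by simp
    hence "(\<Prod>j\<in>J. cmod (x - z j)) \<le> (\<Prod>j\<in>J. cmod (z i - z j))"
      by (rule power2_le_imp_le) (auto intro: prod_nonneg)
    moreover have "card J = n - 1" using i by (simp add: J_def)
    ultimately show ?thesis using x(2) by (simp add: J_def)
  qed
  moreover have "inj_on z {..<n}"
  proof (rule inj_onI, rule ccontr)
    fix i j assume "i \<in> {..<n}" "j \<in> {..<n}" "z i = z j" "i \<noteq> j"
    thus False using ne[of i j] by simp
  qed
  ultimately show ?thesis by (intro that[OF zK])
qed

text \<open>Pigeonhole: of the \<open>n + 1\<close> candidates to the right of \<open>y\<close> at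
  spacing \<open>1 / n\<^sup>2\<close>, two would otherwise lie within half a spacing of the same
  \<open>z j\<close>.\<close>

lemma point_off_finite_set:
  fixes z :: "nat \<Rightarrow> complex"
  assumes n: "0 < n"
  obtains x where "cmod (x - y) \<le> 1 / n" "\<And>j. j < n \<Longrightarrow> 1 / (2 * real n ^ 2) \<le> cmod (x - z j)"
proof -
  define x where "x k = y + of_real (real k / real n ^ 2)" for k :: nat
  have "\<exists>k\<le>n. \<forall>j<n. 1 / (2 * real n ^ 2) \<le> cmod (x k - z j)"
  proof (rule ccontr)
    assume neg: "\<not> ?thesis"
    have "\<forall>k\<in>{..n}. \<exists>j\<in>{..<n}. cmod (x k - z j) < 1 / (2 * real n ^ 2)"
    proof
      fix k assume "k \<in> {..n}"
      hence "\<not> (\<forall>j<n. 1 / (2 * real n ^ 2) \<le> cmod (x k - z j))" using neg by auto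
      thus "\<exists>j\<in>{..<n}. cmod (x k - z j) < 1 / (2 * real n ^ 2)" by (auto simp: not_le)
    qed
    then obtain g where g: "\<And>k. k \<in> {..n} \<Longrightarrow> g k \<in> {..<n}" "\<And>k. k \<in> {..n} \<Longrightarrow> cmod (x k - z (g k)) < 1 / (2 * real n ^ 2)"
      by metis
    have "\<not> inj_on g {..n}"
    proof
      assume "inj_on g {..n}"
      hence "card {..n} \<le> card {..<n}" using g(1) by (intro card_inj_on_le[of g]) auto
      thus False by simp
    qed
    then obtain k l where kl: "k \<in> {..n}" "l \<in> {..n}" "k \<noteq> l" "g k = g l" by (auto simp: inj_on_def)
    have "cmod (x k - x l) \<le> cmod (x k - z (g k)) + cmod (x l - z (g k))"
      using norm_triangle_ineq4[of "x k - z (g k)" "x l - z (g k)"] by simp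
    also have "\<dots> < 1 / real n ^ 2" using g(2)[OF kl(1)] g(2)[OF kl(2)] kl(4) by simp
    finally have "cmod (x k - x l) < 1 / real n ^ 2" .
    moreover have "cmod (x k - x l) = \<bar>real k - real l\<bar> / real n ^ 2"
    proof -
      have "x k - x l = of_real ((real k - real l) / real n ^ 2)" by (simp add: x_def diff_divide_distrib)
      thus ?thesis by (simp only: norm_of_real) (simp add: abs_divide)
    qed
    moreover have "1 \<le> \<bar>real k - real l\<bar>" using kl(3) by linarith
    ultimately show False using n by (simp add: divide_less_cancel)
  qed
  then obtain k where k: "k \<le> n" "\<And>j. j < n \<Longrightarrow> 1 / (2 * real n ^ 2) \<le> cmod (x k - z j)" by auto
  have "cmod (x k - y) = real k / real n ^ 2" by (simp add: x_def norm_divide norm_power)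
  also have "\<dots> \<le> real n / real n ^ 2" using k(1) by (intro divide_right_mono) auto
  also have "\<dots> = 1 / n" using n by (simp add: power2_eq_square)
  finally show ?thesis using that k(2) by blast
qed

text \<open>By Lagrange interpolation \<open>1 = \<Sum>i. F x / ((x - z i) * F' (z i))\<close> with \<open>F x = (\<Prod>j. x - z j)\<close>, and \<open>\<bar>F' (z i)\<bar>\<close> is bounded
  below at Fekete points; so \<open>\<bar>F x\<bar>\<close> is bounded below away from the nodes.\<close>

lemma Fekete_rpot_le:
  fixes z :: "nat \<Rightarrow> complex"
  assumes n: "0 < n" and inj: "inj_on z {..<n}" and d: "0 < d"
    and ge: "\<And>i. i < n \<Longrightarrow> exp (- V) ^ (n - 1) \<le> (\<Prod>j\<in>{..<n} - {i}. cmod (z i - z j))"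
  shows "rpot d (uniform_on n z) y \<le> (V * (real n - 1) + ln 2 + 3 * ln n) / n + (1 / n) / sqrt d"
proof -
  obtain x where x: "cmod (x - y) \<le> 1 / n" "\<And>j. j < n \<Longrightarrow> 1 / (2 * real n ^ 2) \<le> cmod (x - z j)"
    using point_off_finite_set[OF n] by blast
  define \<eta> where "\<eta> = 1 / (2 * real n ^ 2)"
  have \<eta>: "0 < \<eta>" using n by (simp add: \<eta>_def)
  have xp: "0 < cmod (x - z j)" if "j < n" for j using x(2)[OF that] \<eta> unfolding \<eta>_def by linarith
  define F where "F = (\<Prod>j<n. cmod (x - z j))"
  have F: "0 < F" unfolding F_def using xp by (intro prod_pos) auto
  define E where "E = exp (- V) ^ (n - 1)"
  have E: "0 < E" by (simp add: E_def)
  have trm: "cmod (\<Prod>j\<in>{..<n} - {i}. (x - z j) / (z i - z j)) \<le> F / \<eta> / E" if i: "i < n" for i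
  proof -
    have "F = cmod (x - z i) * (\<Prod>j\<in>{..<n} - {i}. cmod (x - z j))"
      unfolding F_def using i by (simp add: prod.remove)
    moreover have "\<eta> \<le> cmod (x - z i)" using x(2)[OF i] by (simp add: \<eta>_def)
    ultimately have "\<eta> * (\<Prod>j\<in>{..<n} - {i}. cmod (x - z j)) \<le> F"
      by (simp add: mult_right_mono prod_nonneg)
    hence 1: "(\<Prod>j\<in>{..<n} - {i}. cmod (x - z j)) \<le> F / \<eta>" using \<eta> by (simp add: field_simps)
    have "cmod (\<Prod>j\<in>{..<n} - {i}. (x - z j) / (z i - z j)) = (\<Prod>j\<in>{..<n} - {i}. cmod (x - z j)) / (\<Prod>j\<in>{..<n} - {i}. cmod (z i - z j))"
      by (simp add: prod_norm[symmetric] norm_divide prod_dividef)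
    also have "\<dots> \<le> F / \<eta> / E"
      using 1 ge[OF i] E F \<eta> unfolding E_def by (intro frac_le) auto
    finally show ?thesis .
  qed
  have "1 = cmod (\<Sum>i<n. \<Prod>j\<in>{..<n} - {i}. (x - z j) / (z i - z j))"
    using Lagrange_sum_eq_1[OF n inj] by simp
  also have "\<dots> \<le> (\<Sum>i<n. F / \<eta> / E)" by (rule sum_norm_le) (use trm in auto)
  also have "\<dots> = n * (F / \<eta> / E)" by simp
  finally have "\<eta> * E \<le> n * F" using \<eta> E by (simp add: field_simps)
  hence "ln (\<eta> * E) \<le> ln (n * F)" using \<eta> E by (intro ln_mono) auto
  hence "ln \<eta> + ln E \<le> ln n + ln F" using \<eta> E F n by (simp add: ln_mult_pos)
  \<comment> \<open>Origin of the error terms: the \<open>n\<close> Lagrange summands give one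
    \<open>ln n\<close>, the distance \<eta> from the nodes gives \<open>ln 2\<close> and two
    more.\<close>
  moreover have "ln \<eta> = - ln 2 - 2 * ln n" using n by (simp add: \<eta>_def ln_div ln_mult_pos ln_realpow)
  moreover have "ln E = - (V * (real n - 1))" using n by (simp add: E_def ln_realpow of_nat_diff)
  ultimately have lnF: "- ln F \<le> V * (real n - 1) + ln 2 + 3 * ln n" by linarith
  have "rpot d (uniform_on n z) x = (\<Sum>i<n. lker d (z i) x) / n" by (rule uniform_on_rpot[OF n])
  also have "(\<Sum>i<n. lker d (z i) x) \<le> (\<Sum>i<n. - ln (cmod (x - z i)))"
  proof (rule sum_mono)
    fix i assume "i \<in> {..<n}"
    thus "lker d (z i) x \<le> - ln (cmod (x - z i))"
      using lker_le_neg_ln[OF d, of "cmod (x - z i)" "z i" x] xp[of i] by (simp add: norm_minus_commute)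
  qed
  also have "\<dots> = - ln F" unfolding F_def using xp by (subst ln_prod) (auto simp: sum_negf)
  also note lnF
  finally have "rpot d (uniform_on n z) x \<le> (V * (real n - 1) + ln 2 + 3 * ln n) / n"
    using n by (simp add: divide_right_mono)
  moreover have "uniform_on n z \<in> prob_measures_on (z ` {..<n})"
    using n by (intro uniform_on_prob_measures_on) (auto intro: finite_imp_closed)
  hence "uniform_on n z \<in> P_log" by (rule prob_measures_on_P_log) (auto intro: finite_imp_compact)
  hence "rpot d (uniform_on n z) y \<le> rpot d (uniform_on n z) x + cmod (y - x) / sqrt d"
    using rpot_lipschitz[of "uniform_on n z" d y x] d by linarith
  moreover have "cmod (y - x) / sqrt d \<le> (1 / n) / sqrt d"
    using x(1) d by (intro divide_right_mono) (auto simp: norm_minus_commute)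
  ultimately show ?thesis by linarith
qed

text \<open>At fixed \<open>d\<close> the error terms of \<open>Fekete_rpot_le\<close> vanish as the
  number of Fekete points grows, so a weak limit of the Fekete measures has potential at most
  \<open>V\<close> on the whole plane, not just on \<open>K\<close>.\<close>

theorem exists_measure_potential_le:
  assumes K: "compact K"
    and H: "\<And>J a. finite J \<Longrightarrow> \<exists>x\<in>K. exp (- V) ^ card J \<le> (\<Prod>j\<in>J. cmod (x - a (j::nat)))"
  obtains \<sigma> where "\<sigma> \<in> prob_measures_on K" "\<And>z d. 0 < d \<Longrightarrow> rpot d \<sigma> z \<le> V"
proof -
  have "\<exists>z. (\<forall>i. z i \<in> K) \<and> inj_on z {..<Suc n} \<and> (\<forall>i<Suc n. exp (- V) ^ (Suc n - 1) \<le> (\<Prod>j\<in>{..<Suc n} - {i}. cmod (z i - z j)))" for n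
    using Fekete_points[OF K _ H, of "Suc n"] by (metis exp_gt_zero)
  then obtain z where z: "\<And>n i. z n i \<in> K" "\<And>n. inj_on (z n) {..<Suc n}"
    "\<And>n i. i < Suc n \<Longrightarrow> exp (- V) ^ (Suc n - 1) \<le> (\<Prod>j\<in>{..<Suc n} - {i}. cmod (z n i - z n j))"
    by metis
  define \<sigma> where "\<sigma> n = uniform_on (Suc n) (z n)" for n
  have "\<sigma> n \<in> prob_measures_on K" for n
    unfolding \<sigma>_def by (intro uniform_on_prob_measures_on z compact_imp_closed[OF K]) auto
  from prob_measures_on_wconv_compact[OF K this]
  obtain r \<tau> where r: "strict_mono (r :: nat \<Rightarrow> nat)" and \<tau>: "\<tau> \<in> prob_measures_on K" and wc: "wconv (\<sigma> \<circ> r) \<tau>" .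
  have "rpot d \<tau> y \<le> V" if d: "0 < d" for d y
  proof -
    define b where "b n = (V * (real n - 1) + ln 2 + 3 * ln n) / n + (1 / n) / sqrt d" for n :: nat
    have "(\<lambda>n. V - V * (1 / real n) + ln 2 * (1 / real n) + 3 * (ln (real n) / real n) + 1 / real n * (1 / sqrt d)) \<longlonglongrightarrow>
        V - V * 0 + ln 2 * 0 + 3 * 0 + 0 * (1 / sqrt d)"
      by (intro tendsto_intros lim_1_over_n lim_ln_over_n)
    moreover have "eventually (\<lambda>n. V - V * (1 / real n) + ln 2 * (1 / real n) + 3 * (ln (real n) / real n) + 1 / real n * (1 / sqrt d) = b n) sequentially"
      using eventually_gt_at_top[of 0]
    proof (rule eventually_mono)
      fix n :: nat assume "0 < n"
      thus "V - V * (1 / real n) + ln 2 * (1 / real n) + 3 * (ln (real n) / real n) + 1 / real n * (1 / sqrt d) = b n"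
        unfolding b_def by (simp add: add_divide_distrib diff_divide_distrib right_diff_distrib)
    qed
    ultimately have "b \<longlonglongrightarrow> V - V * 0 + ln 2 * 0 + 3 * 0 + 0 * (1 / sqrt d)" by (rule Lim_transform_eventually)
    hence "b \<longlonglongrightarrow> V" by simp
    hence "(\<lambda>n. b (Suc (r n))) \<longlonglongrightarrow> V"
      using LIMSEQ_subseq_LIMSEQ[OF LIMSEQ_Suc r] by (simp add: comp_def)
    moreover have "(\<lambda>n. rpot d (\<sigma> (r n)) y) \<longlonglongrightarrow> rpot d \<tau> y" using wconv_rpot[OF wc d] by simp
    moreover have "rpot d (\<sigma> n) y \<le> b (Suc n)" for n
      unfolding \<sigma>_def b_def by (rule Fekete_rpot_le[OF zero_less_Suc z(2) d z(3)])
    ultimately show ?thesis by (intro LIMSEQ_le) auto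
  qed
  thus ?thesis by (rule that[OF \<tau>])
qed

section \<open>Equilibrium measures\<close>

lemma measure_average:
  assumes \<nu>: "\<nu> \<in> prob_measures_on K" "\<tau> \<in> prob_measures_on K" and K: "closed K"
  obtains \<alpha> where "\<alpha> \<in> prob_measures_on K"
    "\<And>f :: complex \<Rightarrow> real. integrable \<nu> f \<Longrightarrow> integrable \<tau> f \<Longrightarrow> f \<in> borel_measurable borel \<Longrightarrow>
       integrable \<alpha> f \<and> (\<integral>w. f w \<partial>\<alpha>) = ((\<integral>w. f w \<partial>\<nu>) + (\<integral>w. f w \<partial>\<tau>)) / 2"
proof -
  interpret A: prob_space \<nu> by (rule prob_measures_onD[OF \<nu>(1)])
  interpret B: prob_space \<tau> by (rule prob_measures_onD[OF \<nu>(2)])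
  define \<alpha> where "\<alpha> = measure_of UNIV (sets borel) (\<lambda>A. (emeasure \<nu> A + emeasure \<tau> A) / 2)"
  have s: "sets \<nu> = sets borel" "sets \<tau> = sets borel" by (rule prob_measures_onD[OF \<nu>(1)] prob_measures_onD[OF \<nu>(2)])+
  have s\<alpha>: "sets \<alpha> = sets borel" "space \<alpha> = UNIV"
    using sets.sigma_sets_eq[of "borel :: complex measure"] by (simp_all add: \<alpha>_def sets_measure_of_conv space_measure_of_conv)
  have em: "emeasure \<alpha> A = (emeasure \<nu> A + emeasure \<tau> A) / 2" if "A \<in> sets borel" for A
    unfolding \<alpha>_def
  proof (rule emeasure_measure_of_sigma)
    show "sigma_algebra UNIV (sets (borel :: complex measure))" using sets.sigma_algebra_axioms[of "borel :: complex measure"] by simp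
    show "positive (sets borel) (\<lambda>A. (emeasure \<nu> A + emeasure \<tau> A) / 2)" by (simp add: positive_def)
    show "countably_additive (sets borel) (\<lambda>A. (emeasure \<nu> A + emeasure \<tau> A) / 2)"
    proof (rule countably_additiveI)
      fix F :: "nat \<Rightarrow> complex set" assume F: "range F \<subseteq> sets borel" "disjoint_family F"
      have "(\<Sum>i. (emeasure \<nu> (F i) + emeasure \<tau> (F i)) / 2) = (\<Sum>i. emeasure \<nu> (F i) + emeasure \<tau> (F i)) / 2"
        by (simp add: divide_ennreal_def)
      also have "(\<Sum>i. emeasure \<nu> (F i) + emeasure \<tau> (F i)) = (\<Sum>i. emeasure \<nu> (F i)) + (\<Sum>i. emeasure \<tau> (F i))"
        by (rule suminf_add[symmetric]) auto
      also have "\<dots> = emeasure \<nu> (\<Union>i. F i) + emeasure \<tau> (\<Union>i. F i)"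
        using F by (simp add: suminf_emeasure s)
      finally show "(\<Sum>i. (emeasure \<nu> (F i) + emeasure \<tau> (F i)) / 2) = (emeasure \<nu> (\<Union>i. F i) + emeasure \<tau> (\<Union>i. F i)) / 2" .
    qed
  qed (use that in simp)
  have nn: "(\<integral>\<^sup>+w. f w \<partial>\<alpha>) = ((\<integral>\<^sup>+w. f w \<partial>\<nu>) + (\<integral>\<^sup>+w. f w \<partial>\<tau>)) / 2" if "f \<in> borel_measurable borel" for f
    using that
  proof (induction rule: borel_measurable_induct)
    case (cong f g) thus ?case by (metis (no_types, lifting) nn_integral_cong UNIV_I space_borel)
  next
    case (set A)
    thus ?case using em[of A] by (simp add: s s\<alpha>)
  next
    case (mult u c)
    have m: "u \<in> borel_measurable \<nu>" "u \<in> borel_measurable \<tau>" "u \<in> borel_measurable \<alpha>"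
      using mult(2) by (simp_all cong: measurable_cong_sets add: s s\<alpha>)
    show ?case using mult(4) by (simp add: nn_integral_cmult m distrib_left distrib_right divide_ennreal_def mult.assoc)
  next
    case (add u v)
    have m: "u \<in> borel_measurable \<nu>" "u \<in> borel_measurable \<tau>" "u \<in> borel_measurable \<alpha>"
      "v \<in> borel_measurable \<nu>" "v \<in> borel_measurable \<tau>" "v \<in> borel_measurable \<alpha>"
      using add(1,3) by (simp_all cong: measurable_cong_sets add: s s\<alpha>)
    show ?case using add by (simp add: nn_integral_add m add_divide_distrib_ennreal ac_simps)
  next
    case (seq U)
    have m: "U i \<in> borel_measurable \<nu>" "U i \<in> borel_measurable \<tau>" "U i \<in> borel_measurable \<alpha>" for i
      using seq(1) by (simp_all cong: measurable_cong_sets add: s s\<alpha>)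
    have inc: "incseq (\<lambda>i. \<integral>\<^sup>+w. U i w \<partial>M)" for M :: "complex measure"
      using seq(3) by (auto simp: incseq_def le_fun_def intro!: nn_integral_mono)
    have S: "(\<integral>\<^sup>+w. (SUP i. U i) w \<partial>M) = (SUP i. \<integral>\<^sup>+w. U i w \<partial>M)" if "\<And>i. U i \<in> borel_measurable M" for M :: "complex measure"
      using nn_integral_monotone_convergence_SUP[OF seq(3) that] by (simp add: image_comp)
    show ?case
      unfolding S[OF m(1)] S[OF m(2)] S[OF m(3)] seq
      unfolding ennreal_SUP_add[OF inc inc, symmetric] divide_ennreal_def by (rule SUP_mult_right_ennreal[symmetric])
  qed
  have half: "(1 + 1) / 2 = (1 :: ennreal)" unfolding one_add_one by (rule ennreal_divide_self) auto
  have "emeasure \<alpha> UNIV = (emeasure \<nu> UNIV + emeasure \<tau> UNIV) / 2" by (rule em) simp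
  moreover have "emeasure \<nu> UNIV = 1" using A.emeasure_space_1 unfolding prob_measures_onD(3)[OF \<nu>(1)] .
  moreover have "emeasure \<tau> UNIV = 1" using B.emeasure_space_1 unfolding prob_measures_onD(3)[OF \<nu>(2)] .
  ultimately have "emeasure \<alpha> UNIV = 1" using half by (simp only:)
  hence p\<alpha>: "prob_space \<alpha>" by (intro prob_spaceI) (simp add: s\<alpha>)
  have "emeasure \<alpha> K = (emeasure \<nu> K + emeasure \<tau> K) / 2" by (rule em) (use K in simp)
  hence "emeasure \<alpha> K = 1"
    unfolding prob_measures_onD(4)[OF \<nu>(1)] prob_measures_onD(4)[OF \<nu>(2)] half .
  hence \<alpha>: "\<alpha> \<in> prob_measures_on K" using p\<alpha> s\<alpha> by (simp add: prob_measures_on_def)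
  have "integrable \<alpha> f \<and> (\<integral>w. f w \<partial>\<alpha>) = ((\<integral>w. f w \<partial>\<nu>) + (\<integral>w. f w \<partial>\<tau>)) / 2"
    if f: "integrable \<nu> f" "integrable \<tau> f" and [measurable]: "f \<in> borel_measurable borel" for f :: "complex \<Rightarrow> real"
  proof -
    have fin: "(\<integral>\<^sup>+w. ennreal (f w) \<partial>\<nu>) < \<infinity>" "(\<integral>\<^sup>+w. ennreal (f w) \<partial>\<tau>) < \<infinity>" "(\<integral>\<^sup>+w. ennreal (- f w) \<partial>\<nu>) < \<infinity>" "(\<integral>\<^sup>+w. ennreal (- f w) \<partial>\<tau>) < \<infinity>"
      using f by (auto simp: real_integrable_def less_top)
    have n1: "(\<integral>\<^sup>+w. ennreal (f w) \<partial>\<alpha>) = ((\<integral>\<^sup>+w. ennreal (f w) \<partial>\<nu>) + (\<integral>\<^sup>+w. ennreal (f w) \<partial>\<tau>)) / 2" by (rule nn) measurable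
    have n2: "(\<integral>\<^sup>+w. ennreal (- f w) \<partial>\<alpha>) = ((\<integral>\<^sup>+w. ennreal (- f w) \<partial>\<nu>) + (\<integral>\<^sup>+w. ennreal (- f w) \<partial>\<tau>)) / 2" by (rule nn) measurable
    have I: "integrable \<alpha> f"
      unfolding real_integrable_def n1 n2 using fin prob_measures_on_measurable[OF \<alpha>, of f]
      by (auto simp: ennreal_divide_eq_top_iff)
    have e: "enn2real ((x + y) / 2) = (enn2real x + enn2real y) / 2" if xy: "x < \<infinity>" "y < \<infinity>" for x y :: ennreal
    proof -
      obtain a where a: "x = ennreal a" "0 \<le> a" using xy(1) by (cases x) auto
      obtain b where b: "y = ennreal b" "0 \<le> b" using xy(2) by (cases y) auto
      note ab = a(1) b(1) a(2) b(2)
      have "ennreal ((a + b) / 2) = ennreal (a + b) / ennreal 2" by (subst divide_ennreal) (use ab in auto)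
      also have "\<dots> = (x + y) / 2" unfolding ab using ab(3,4) by simp
      finally have "(x + y) / 2 = ennreal ((a + b) / 2)" ..
      thus ?thesis using ab by (simp add: enn2real_ennreal)
    qed
    show ?thesis
      unfolding real_lebesgue_integral_def[OF I] real_lebesgue_integral_def[OF f(1)] real_lebesgue_integral_def[OF f(2)] n1 n2
        e[OF fin(1,2)] e[OF fin(3,4)] using I by (simp add: field_simps)
  qed
  thus ?thesis using that[OF \<alpha>] by blast
qed

text \<open>Bilinearity and symmetry of the mutual energy. If both self-energies are minimal and
  that of \<alpha> is no smaller, the mutual energy is forced up to the minimum, which makes the
  energy distance vanish.\<close>

lemma renergy_average_bound:
  assumes \<nu>: "\<nu> \<in> prob_measures_on K" "\<tau> \<in> prob_measures_on K" and K: "compact K"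
  obtains \<alpha> where "\<alpha> \<in> prob_measures_on K"
    "\<And>d. 0 < d \<Longrightarrow> renergy d \<alpha> \<alpha> = (renergy d \<nu> \<nu> + renergy d \<tau> \<tau> + 2 * renergy d \<nu> \<tau>) / 4"
proof -
  obtain \<alpha> where \<alpha>: "\<alpha> \<in> prob_measures_on K"
    and avg: "\<And>f :: complex \<Rightarrow> real. integrable \<nu> f \<Longrightarrow> integrable \<tau> f \<Longrightarrow> f \<in> borel_measurable borel \<Longrightarrow>
       integrable \<alpha> f \<and> (\<integral>w. f w \<partial>\<alpha>) = ((\<integral>w. f w \<partial>\<nu>) + (\<integral>w. f w \<partial>\<tau>)) / 2"
    using measure_average[OF \<nu> compact_imp_closed[OF K]] by blast
  have avg': "(\<integral>w. f w \<partial>\<alpha>) = ((\<integral>w. f w \<partial>\<nu>) + (\<integral>w. f w \<partial>\<tau>)) / 2" if "continuous_on UNIV f" for f :: "complex \<Rightarrow> real"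
    using avg prob_measures_on_integrable[OF \<nu>(1) K that] prob_measures_on_integrable[OF \<nu>(2) K that] borel_measurable_continuous_UNIV[OF that] by blast
  note P = prob_measures_on_P_log[OF \<nu>(1) K] prob_measures_on_P_log[OF \<nu>(2) K] prob_measures_on_P_log[OF \<alpha> K]
  have "renergy d \<alpha> \<alpha> = (renergy d \<nu> \<nu> + renergy d \<tau> \<tau> + 2 * renergy d \<nu> \<tau>) / 4" if d: "0 < d" for d
  proof -
    have "continuous_on UNIV (\<lambda>w. lker d w z)" for z by (intro continuous_intros d)
    hence r: "rpot d \<alpha> z = (rpot d \<nu> z + rpot d \<tau> z) / 2" for z unfolding rpot_def by (rule avg')
    have "renergy d \<alpha> \<alpha> = ((\<integral>z. rpot d \<alpha> z \<partial>\<nu>) + (\<integral>z. rpot d \<alpha> z \<partial>\<tau>)) / 2"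
      unfolding renergy_def by (rule avg'[OF continuous_on_rpot[OF P(3) d]])
    also have "(\<integral>z. rpot d \<alpha> z \<partial>\<nu>) = (renergy d \<nu> \<nu> + renergy d \<tau> \<nu>) / 2"
      unfolding r renergy_def using integrable_rpot[OF \<nu>(1) K P(1) d] integrable_rpot[OF \<nu>(1) K P(2) d] by simp
    also have "(\<integral>z. rpot d \<alpha> z \<partial>\<tau>) = (renergy d \<nu> \<tau> + renergy d \<tau> \<tau>) / 2"
      unfolding r renergy_def using integrable_rpot[OF \<nu>(2) K P(1) d] integrable_rpot[OF \<nu>(2) K P(2) d] by simp
    also have "renergy d \<tau> \<nu> = renergy d \<nu> \<tau>" by (rule renergy_commute[OF \<nu>(2) K \<nu>(1) K d])
    finally show ?thesis by (simp add: field_simps)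
  qed
  thus ?thesis by (rule that[OF \<alpha>])
qed

lemma renergy_antimono:
  assumes "\<nu> \<in> prob_measures_on K" "compact K" "0 < d" "d \<le> d'"
  shows "renergy d' \<nu> \<nu> \<le> renergy d \<nu> \<nu>"
proof -
  note P = prob_measures_on_P_log[OF assms(1,2)]
  show ?thesis unfolding renergy_def
    by (intro integral_mono integrable_rpot[OF assms(1,2) P] rpot_antimono[OF P]) (use assms in auto)
qed

text \<open>The average of two minimisers is again a minimiser, so their energy distance vanishes.\<close>

lemma energy_minimizer_unique:
  assumes K: "compact K" and \<nu>: "\<nu> \<in> prob_measures_on K" "\<tau> \<in> prob_measures_on K"
    and le: "log_energy \<nu> \<le> ereal V" "log_energy \<tau> \<le> ereal V"
    and min: "\<And>\<alpha> c. \<alpha> \<in> prob_measures_on K \<Longrightarrow> log_energy \<alpha> \<le> ereal c \<Longrightarrow> V \<le> c"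
  shows "\<nu> = \<tau>"
proof -
  obtain \<alpha> where \<alpha>: "\<alpha> \<in> prob_measures_on K"
    and avg: "\<And>d. 0 < d \<Longrightarrow> renergy d \<alpha> \<alpha> = (renergy d \<nu> \<nu> + renergy d \<tau> \<tau> + 2 * renergy d \<nu> \<tau>) / 4"
    using renergy_average_bound[OF \<nu> K] by metis
  obtain R where "\<forall>x\<in>K. norm x \<le> R" using compact_imp_bounded[OF K] unfolding bounded_iff ..
  hence R: "K \<subseteq> cball 0 R" by (simp add: subset_iff)
  note mono = prob_measures_on_mono[OF _ compact_imp_closed[OF K] closed_cball R]
  have le': "renergy d \<nu> \<nu> \<le> V" "renergy d \<tau> \<tau> \<le> V" if "0 < d" for d
    using le that unfolding log_energy_le_iff[OF \<nu>(1) K] log_energy_le_iff[OF \<nu>(2) K] by auto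
  show ?thesis
  proof (rule energy_dist_eq_0[OF mono[OF \<nu>(1)] mono[OF \<nu>(2)]])
    fix e :: real assume e: "0 < e"
    \<comment> \<open>The energy distance is twice the sum of the energies of \<nu> and \<tau> minus
      four times that of \<alpha>; the factor 4 turns the deficit \<open>e / 8\<close> into
      \<open>e / 2\<close>, below \<open>e\<close>.\<close>
    have "\<not> log_energy \<alpha> \<le> ereal (V - e / 8)" using min[OF \<alpha>, of "V - e / 8"] e by auto
    then obtain d0 where d0: "0 < d0" "V - e / 8 < renergy d0 \<alpha> \<alpha>" unfolding log_energy_le_iff[OF \<alpha> K] by (auto simp: not_le)
    define d where "d = min d0 1"
    have d: "0 < d" "d \<le> 1" "d \<le> d0" using d0 by (auto simp: d_def)
    have "V - e / 8 < renergy d \<alpha> \<alpha>" using renergy_antimono[OF \<alpha> K d(1,3)] d0 by linarith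
    hence "4 * V - e / 2 < renergy d \<nu> \<nu> + renergy d \<tau> \<tau> + 2 * renergy d \<nu> \<tau>" unfolding avg[OF d(1)] by simp
    hence "energy_dist d \<nu> \<tau> < e" unfolding energy_dist_def using le'[OF d(1)] e by linarith
    thus "\<exists>d>0. d \<le> 1 \<and> energy_dist d \<nu> \<tau> < e" using d by blast
  qed
qed

text \<open>\<open>V\<close> bounds the real upper bounds of energies from below, the form in which
  it arises as an infimum. Uniqueness of the minimiser is what the definite description in
  \<open>equilibrium_measure\<close> asks for.\<close>

lemma equilibrium_measure_eqI:
  assumes K: "compact K" and \<tau>: "\<tau> \<in> prob_measures_on K" and le: "log_energy \<tau> \<le> ereal V"
    and min: "\<And>\<alpha> c. \<alpha> \<in> prob_measures_on K \<Longrightarrow> log_energy \<alpha> \<le> ereal c \<Longrightarrow> V \<le> c"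
  shows "equilibrium_measure K = \<tau>" "log_capacity K = exp (- V)"
proof -
  have ge: "ereal V \<le> log_energy \<alpha>" if \<alpha>: "\<alpha> \<in> prob_measures_on K" for \<alpha>
  proof (cases "log_energy \<alpha>")
    case (real r) thus ?thesis using min[OF \<alpha>, of r] by simp
  next
    case MInf thus ?thesis using min[OF \<alpha>, of "V - 1"] by simp
  qed simp
  have eq: "log_energy \<tau> = ereal V" using le ge[OF \<tau>] by simp
  show "equilibrium_measure K = \<tau>"
    unfolding equilibrium_measure_def
  proof (rule the_equality)
    show "\<tau> \<in> prob_measures_on K \<and> (\<forall>\<nu>'\<in>prob_measures_on K. log_energy \<tau> \<le> log_energy \<nu>')"
      using \<tau> ge eq by simp
    fix \<nu> assume *: "\<nu> \<in> prob_measures_on K \<and> (\<forall>\<nu>'\<in>prob_measures_on K. log_energy \<nu> \<le> log_energy \<nu>')"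
    hence "log_energy \<nu> \<le> ereal V" using \<tau> eq by metis
    with * show "\<nu> = \<tau>" by (intro energy_minimizer_unique[OF K _ \<tau> _ le min]) auto
  qed
  moreover have "non_polar K" unfolding non_polar_def using \<tau> eq by (intro bexI[of _ \<tau>]) auto
  ultimately show "log_capacity K = exp (- V)" by (simp add: log_capacity_def eq)
qed

lemma log_energy_le_if_rpot_le:
  assumes "\<nu> \<in> prob_measures_on K" "compact K" and le: "\<And>z d. 0 < d \<Longrightarrow> rpot d \<nu> z \<le> V"
  shows "log_energy \<nu> \<le> ereal V"
  unfolding log_energy_le_iff[OF assms(1,2)] renergy_def
  by (intro allI impI prob_measures_on_integral_le[OF assms(1) compact_imp_closed[OF assms(2)]]
      integrable_rpot[OF assms(1,2) prob_measures_on_P_log[OF assms(1,2)]] le)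

text \<open>\<open>V\<close> is the infimum of the energies. A monic polynomial of degree
  \<open>m\<close> with sup norm below \<open>exp (- V) ^ m\<close> on \<open>K\<close> would put
  \<open>K\<close> inside a lemniscate whose energy bound exceeds \<open>V\<close>. Hence the
  sup-norm bound holds, Fekete points give a measure with potential at most \<open>V\<close>
  everywhere, and its energy is then at most \<open>V\<close>.\<close>

theorem equilibrium_measure_potential_le:
  assumes K: "compact K" and np: "non_polar K"
  obtains V where "equilibrium_measure K \<in> prob_measures_on K" "log_capacity K = exp (- V)"
    "\<And>z d. 0 < d \<Longrightarrow> rpot d (equilibrium_measure K) z \<le> V"
proof -
  \<comment> \<open>Real upper bounds of energies instead of the energies themselves, so that the
    infimum is taken in the reals.\<close>
  define E where "E = {c. \<exists>\<nu>\<in>prob_measures_on K. log_energy \<nu> \<le> ereal c}"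
  obtain \<nu>0 where \<nu>0: "\<nu>0 \<in> prob_measures_on K" "log_energy \<nu>0 < \<infinity>" using np unfolding non_polar_def by blast
  have "E \<noteq> {}"
  proof (cases "log_energy \<nu>0")
    case (real r) hence "r \<in> E" unfolding E_def using \<nu>0(1) by (intro CollectI bexI[of _ \<nu>0]) auto
    thus ?thesis by blast
  next
    case MInf hence "0 \<in> E" unfolding E_def using \<nu>0(1) by (intro CollectI bexI[of _ \<nu>0]) auto
    thus ?thesis by blast
  qed (use \<nu>0 in simp)
  obtain R where "\<forall>x\<in>K. norm x \<le> R" using compact_imp_bounded[OF K] unfolding bounded_iff ..
  hence R: "K \<subseteq> cball 0 R" by (simp add: subset_iff)
  note mono = prob_measures_on_mono[OF _ compact_imp_closed[OF K] closed_cball R]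
  have "- ln ((2 * R)\<^sup>2 + 1) / 2 \<le> c" if cE: "c \<in> E" for c
  proof -
    obtain \<nu> where \<nu>: "\<nu> \<in> prob_measures_on K" "log_energy \<nu> \<le> ereal c" using cE by (auto simp: E_def)
    hence "renergy 1 \<nu> \<nu> \<le> c" unfolding log_energy_le_iff[OF \<nu>(1) K] by simp
    thus ?thesis using renergy_bounds(1)[OF mono[OF \<nu>(1)] mono[OF \<nu>(1)], of 1] by simp
  qed
  hence bdd: "bdd_below E" by (rule bdd_belowI)
  define V where "V = Inf E"
  have Vle: "V \<le> c" if "\<nu> \<in> prob_measures_on K" "log_energy \<nu> \<le> ereal c" for \<nu> c
    unfolding V_def by (rule cInf_lower[OF _ bdd]) (use that in \<open>auto simp: E_def\<close>)
  have "K \<noteq> {}" using prob_measures_onD(4)[OF \<nu>0(1)] by auto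
  have H: "\<exists>x\<in>K. exp (- V) ^ card J \<le> (\<Prod>j\<in>J. cmod (x - a j))" if J: "finite J" for J and a :: "nat \<Rightarrow> complex"
  proof (cases "J = {}")
    case True thus ?thesis using \<open>K \<noteq> {}\<close> by auto
  next
    case False
    define m where "m = card J"
    have m: "0 < m" using False J by (simp add: m_def card_gt_0_iff)
    obtain b where b: "bij_betw b {..<m} J" using ex_bij_betw_nat_finite[OF J] by (auto simp: m_def atLeast0LessThan)
    have q: "cmod (rootpoly m (a \<circ> b) x) = (\<Prod>j\<in>J. cmod (x - a j))" for x
      unfolding rootpoly_def prod_norm[symmetric] using prod.reindex_bij_betw[OF b, of "\<lambda>j. cmod (x - a j)"] by simp
    have "continuous_on K (\<lambda>x. cmod (rootpoly m (a \<circ> b) x))" by (intro continuous_intros)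
    then obtain x where x: "x \<in> K" "\<And>y. y \<in> K \<Longrightarrow> cmod (rootpoly m (a \<circ> b) y) \<le> cmod (rootpoly m (a \<circ> b) x)"
      using continuous_attains_sup[OF K \<open>K \<noteq> {}\<close>] by metis
    have "exp (- V) ^ m \<le> cmod (rootpoly m (a \<circ> b) x)"
    proof (rule ccontr)
      assume "\<not> ?thesis"
      \<comment> \<open>A level strictly between: above the sup norm for the lemniscate bound, below
        \<open>exp (- V) ^ m\<close> for the contradiction.\<close>
      then obtain \<rho> where \<rho>: "cmod (rootpoly m (a \<circ> b) x) < \<rho>" "\<rho> < exp (- V) ^ m" using dense not_le by metis
      have \<rho>0: "0 < \<rho>" using \<rho>(1) norm_ge_zero by (rule le_less_trans[rotated])
      have "- ln \<rho> / m \<le> c" if cE: "c \<in> E" for c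
      proof -
        obtain \<nu> where \<nu>: "\<nu> \<in> prob_measures_on K" "log_energy \<nu> \<le> ereal c" using cE by (auto simp: E_def)
        show ?thesis
          by (rule energy_ge_lemniscate[OF m \<rho>0 K le_less_trans[OF x(2) \<rho>(1)] \<nu>])
      qed
      hence "- ln \<rho> / m \<le> V" unfolding V_def by (rule cInf_greatest[OF \<open>E \<noteq> {}\<close>])
      hence "m * (- V) \<le> ln \<rho>" using m by (simp add: field_simps)
      hence "exp (m * (- V)) \<le> \<rho>" using \<rho>0 by (simp add: ln_ge_iff)
      thus False using \<rho>(2) by (simp only: exp_of_nat_mult)
    qed
    thus ?thesis using x(1) q by (auto simp: m_def)
  qed
  obtain \<sigma> where \<sigma>: "\<sigma> \<in> prob_measures_on K" "\<And>z d. 0 < d \<Longrightarrow> rpot d \<sigma> z \<le> V"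
    using exists_measure_potential_le[OF K H] by metis
  have le: "log_energy \<sigma> \<le> ereal V" by (rule log_energy_le_if_rpot_le[OF \<sigma>(1) K \<sigma>(2)])
  have "equilibrium_measure K = \<sigma>" by (rule equilibrium_measure_eqI(1)[OF K \<sigma>(1) le Vle])
  moreover have "log_capacity K = exp (- V)" by (rule equilibrium_measure_eqI(2)[OF K \<sigma>(1) le Vle])
  ultimately show ?thesis using that[of V] \<sigma> by simp
qed

theorem potential_le_0_if_equilibrium_limit:
  assumes K: "\<And>n. compact (K n)" "\<And>n. log_capacity (K n) = 1"
    and lim: "log_weakly_converges (\<lambda>n. equilibrium_measure (K n)) \<mu>"
  shows "potential \<mu> z \<le> 0"
proof -
  have \<mu>: "\<mu> \<in> P_log" using lim by (simp add: log_weakly_converges_def)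
  have le: "rpot d (equilibrium_measure (K n)) z \<le> 0" if "0 < d" for d n
  proof -
    \<comment> \<open>Polar sets have capacity 0 by convention, so capacity one excludes
      them.\<close>
    have np: "non_polar (K n)" using K(2)[of n] by (auto simp: log_capacity_def split: if_splits)
    obtain V where V: "log_capacity (K n) = exp (- V)" "\<And>z d. 0 < d \<Longrightarrow> rpot d (equilibrium_measure (K n)) z \<le> V"
      using equilibrium_measure_potential_le[OF K(1) np] by metis
    have "V = 0" using V(1) K(2)[of n] by simp
    thus ?thesis using V(2)[OF that] by simp
  qed
  have "rpot d \<mu> z \<le> 0" if d: "0 < d" for d
  proof -
    have "continuous_on UNIV (\<lambda>w. lker d w z)" by (intro continuous_intros d)
    moreover have "\<exists>A B. \<forall>w. \<bar>lker d w z\<bar> \<le> A + B * log_plus (cmod w)" using abs_lker_le[OF d] by blast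
    ultimately have "(\<lambda>n. rpot d (equilibrium_measure (K n)) z) \<longlonglongrightarrow> rpot d \<mu> z"
      unfolding rpot_def using lim by (simp add: log_weakly_converges_def)
    thus ?thesis by (rule LIMSEQ_le_const2) (use le[OF d] in auto)
  qed
  thus ?thesis using potential_le_iff[OF \<mu>, of z 0] by (simp add: zero_ereal_def)
qed

section \<open>Quantisation\<close>

lemma wconv_if_moments:
  assumes K: "compact K" and \<nu>s: "\<And>n. \<nu>s n \<in> prob_measures_on K" and \<nu>: "\<nu> \<in> prob_measures_on K"
    and mom: "\<And>j k. (\<lambda>n. \<integral>w. Re w ^ j * Im w ^ k \<partial>\<nu>s n) \<longlonglongrightarrow> (\<integral>w. Re w ^ j * Im w ^ k \<partial>\<nu>)"
  shows "wconv \<nu>s \<nu>"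
  unfolding wconv_def
proof (intro allI impI)
  fix f :: "complex \<Rightarrow> real" assume f: "continuous_on UNIV f"
  note I = prob_measures_on_integrable[OF _ K]
  have poly: "(\<lambda>n. \<integral>w. q w \<partial>\<nu>s n) \<longlonglongrightarrow> (\<integral>w. q w \<partial>\<nu>)" if "polyfun q" for q
    using that
  proof induction
    case (monom c j k)
    show ?case unfolding integral_mult_right_zero by (intro tendsto_intros mom)
  next
    case (add f g)
    have "integrable M f" "integrable M g" if "M \<in> prob_measures_on K" for M
      by (intro I[OF that] polyfun_continuous add.hyps)+
    thus ?case using tendsto_add[OF add.IH] \<nu>s \<nu> by simp
  qed
  show "(\<lambda>n. \<integral>w. f w \<partial>\<nu>s n) \<longlonglongrightarrow> (\<integral>w. f w \<partial>\<nu>)"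
  proof (rule LIMSEQ_I)
    fix e :: real assume e: "0 < e"
    obtain q where q: "polyfun q" "\<And>w. w \<in> K \<Longrightarrow> \<bar>f w - q w\<bar> < e / 4"
      using polyfun_dense[OF K continuous_on_subset[OF f], of "e / 4"] e by auto
    have *: "\<bar>(\<integral>w. f w \<partial>M) - (\<integral>w. q w \<partial>M)\<bar> \<le> e / 4" if M: "M \<in> prob_measures_on K" for M
    proof -
      have i: "integrable M f" "integrable M q" using I[OF M] f polyfun_continuous[OF q(1)] by auto
      have "\<bar>(\<integral>w. f w \<partial>M) - (\<integral>w. q w \<partial>M)\<bar> = \<bar>\<integral>w. f w - q w \<partial>M\<bar>" using i by simp
      also have "\<dots> \<le> (\<integral>w. \<bar>f w - q w\<bar> \<partial>M)" by (rule integral_abs_bound)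
      also have "\<dots> \<le> e / 4"
        using i q(2) by (intro prob_measures_on_integral_le[OF M compact_imp_closed[OF K]]) (auto intro: less_imp_le)
      finally show ?thesis .
    qed
    obtain N where N: "\<And>n. n \<ge> N \<Longrightarrow> \<bar>(\<integral>w. q w \<partial>\<nu>s n) - (\<integral>w. q w \<partial>\<nu>)\<bar> < e / 4"
      using LIMSEQ_D[OF poly[OF q(1)], of "e / 4"] e by auto
    have "\<bar>(\<integral>w. f w \<partial>\<nu>s n) - (\<integral>w. f w \<partial>\<nu>)\<bar> < e" if "n \<ge> N" for n
      using *[OF \<nu>s[of n]] *[OF \<nu>] N[OF that] e by linarith
    thus "\<exists>no. \<forall>n\<ge>no. norm ((\<integral>w. f w \<partial>\<nu>s n) - (\<integral>w. f w \<partial>\<nu>)) < e" by auto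
  qed
qed

text \<open>The points are chosen one by one so that the inner product of the accumulated error with the next
  increment is nonpositive; hence the squared error grows only linearly.\<close>

lemma greedy_quantization:
  fixes f :: "'i \<Rightarrow> complex \<Rightarrow> real"
  assumes K: "compact K" and \<mu>: "\<mu> \<in> prob_measures_on K" and I: "finite I"
    and f: "\<And>i. i \<in> I \<Longrightarrow> continuous_on UNIV (f i)"
  obtains z :: "nat \<Rightarrow> complex" and B :: real where "\<And>n. z n \<in> K"
    "\<And>n. (\<Sum>i\<in>I. ((\<Sum>k<n. f i (z k)) - n * (\<integral>w. f i w \<partial>\<mu>))\<^sup>2) \<le> n * B"
proof -
  interpret prob_space \<mu> by (rule prob_measures_onD[OF \<mu>])
  define g where "g i w = f i w - (\<integral>w. f i w \<partial>\<mu>)" for i w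
  have gc: "continuous_on UNIV (g i)" if "i \<in> I" for i unfolding g_def by (intro continuous_intros f that)
  have gI: "integrable \<mu> (g i)" if "i \<in> I" for i by (rule prob_measures_on_integrable[OF \<mu> K gc[OF that]])
  have g0: "(\<integral>w. g i w \<partial>\<mu>) = 0" if "i \<in> I" for i
    unfolding g_def using prob_measures_on_integrable[OF \<mu> K f[OF that]] by (simp add: prob_space)
  have Kne: "K \<noteq> {}" using prob_measures_onD(4)[OF \<mu>] by auto
  \<comment> \<open>The combination has mean 0 under \<mu> because each \<open>g i\<close> is
    centred, so its minimum over \<open>K\<close> is nonpositive.\<close>
  have ex: "\<exists>w\<in>K. (\<Sum>i\<in>I. S i * g i w) \<le> 0" for S
  proof -
    have c: "continuous_on UNIV (\<lambda>w. \<Sum>i\<in>I. S i * g i w)" by (intro continuous_intros gc)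
    obtain w where w: "w \<in> K" "\<And>y. y \<in> K \<Longrightarrow> (\<Sum>i\<in>I. S i * g i w) \<le> (\<Sum>i\<in>I. S i * g i y)"
      using continuous_attains_inf[OF K Kne continuous_on_subset[OF c]] by auto
    have "(\<Sum>i\<in>I. S i * g i w) \<le> (\<integral>y. (\<Sum>i\<in>I. S i * g i y) \<partial>\<mu>)"
      by (rule prob_measures_on_integral_ge[OF \<mu> compact_imp_closed[OF K] prob_measures_on_integrable[OF \<mu> K c]]) (rule w)
    also have "\<dots> = (\<Sum>i\<in>I. S i * (\<integral>y. g i y \<partial>\<mu>))" using gI by simp
    also have "\<dots> = 0" using g0 by simp
    finally show ?thesis using w(1) by blast
  qed
  define step where "step S = (SOME w. w \<in> K \<and> (\<Sum>i\<in>I. S i * g i w) \<le> 0)" for S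
  have step: "step S \<in> K" "(\<Sum>i\<in>I. S i * g i (step S)) \<le> 0" for S
  proof -
    have "step S \<in> K \<and> (\<Sum>i\<in>I. S i * g i (step S)) \<le> 0"
      unfolding step_def by (rule someI_ex) (use ex[of S] in blast)
    thus "step S \<in> K" "(\<Sum>i\<in>I. S i * g i (step S)) \<le> 0" by auto
  qed
  define S :: "nat \<Rightarrow> 'i \<Rightarrow> real" where "S = rec_nat (\<lambda>i. 0) (\<lambda>n T i. T i + g i (step T))"
  have S0: "S 0 = (\<lambda>i. 0)" and SS: "S (Suc n) = (\<lambda>i. S n i + g i (step (S n)))" for n by (simp_all add: S_def)
  define z where "z n = step (S n)" for n
  have zS: "S n i = (\<Sum>k<n. g i (z k))" for n i by (induction n) (simp_all add: S0 SS z_def)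
  have "continuous_on UNIV (\<lambda>w. \<Sum>i\<in>I. (g i w)\<^sup>2)" by (intro continuous_intros gc)
  hence "continuous_on K (\<lambda>w. \<Sum>i\<in>I. (g i w)\<^sup>2)" by (rule continuous_on_subset) simp
  then obtain y where y: "\<And>w. w \<in> K \<Longrightarrow> (\<Sum>i\<in>I. (g i w)\<^sup>2) \<le> (\<Sum>i\<in>I. (g i y)\<^sup>2)"
    using continuous_attains_sup[OF K Kne] by metis
  define B where "B = (\<Sum>i\<in>I. (g i y)\<^sup>2)"
  have "(\<Sum>i\<in>I. (S n i)\<^sup>2) \<le> n * B" for n
  proof (induction n)
    case (Suc n)
    have "(\<Sum>i\<in>I. (S (Suc n) i)\<^sup>2) = (\<Sum>i\<in>I. (S n i)\<^sup>2 + (g i (z n))\<^sup>2 + 2 * (S n i * g i (z n)))"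
      unfolding SS z_def by (intro sum.cong refl) (simp add: power2_sum)
    also have "\<dots> = (\<Sum>i\<in>I. (S n i)\<^sup>2) + (\<Sum>i\<in>I. (g i (z n))\<^sup>2) + 2 * (\<Sum>i\<in>I. S n i * g i (z n))"
      by (simp add: sum.distrib sum_distrib_left)
    also have "\<dots> \<le> n * B + B + 2 * 0"
    proof -
      have "z n \<in> K" unfolding z_def by (rule step)
      hence "(\<Sum>i\<in>I. (g i (z n))\<^sup>2) \<le> B" unfolding B_def by (rule y)
      moreover have "(\<Sum>i\<in>I. S n i * g i (z n)) \<le> 0" unfolding z_def by (rule step)
      ultimately show ?thesis using Suc.IH by linarith
    qed
    finally show ?case by (simp add: algebra_simps)
  qed (simp add: S0)
  moreover have "S n i = (\<Sum>k<n. f i (z k)) - n * (\<integral>w. f i w \<partial>\<mu>)" for n i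
    unfolding zS g_def by (simp add: sum_subtractf)
  ultimately show ?thesis using that[of z B] step(1) by (simp add: z_def)
qed

text \<open>A diagonal choice: the \<open>N\<close>-th point distribution reproduces the moments of
  \<mu> with both exponents up to \<open>N\<close> within \<open>1 / (N + 1)\<close>, and
  convergence of moments implies weak convergence on a compact set.\<close>

theorem uniform_on_wconv:
  assumes K: "compact K" and \<mu>: "\<mu> \<in> prob_measures_on K"
  obtains m a where "\<And>n. 0 < m n" "\<And>n i. a n i \<in> K" "wconv (\<lambda>n. uniform_on (m n) (a n)) \<mu>"
proof -
  define f :: "nat \<times> nat \<Rightarrow> complex \<Rightarrow> real" where "f = (\<lambda>(j, k) w. Re w ^ j * Im w ^ k)"
  have fc: "continuous_on UNIV (f i)" for i unfolding f_def by (cases i) (auto intro!: continuous_intros)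
  have "\<exists>m z. 0 < m \<and> (\<forall>i. z i \<in> K) \<and> (\<forall>i\<in>{..N} \<times> {..N}. \<bar>(\<integral>w. f i w \<partial>uniform_on m z) - (\<integral>w. f i w \<partial>\<mu>)\<bar> \<le> 1 / Suc N)" for N
  proof -
    let ?I = "{..N} \<times> {..N}"
    obtain z :: "nat \<Rightarrow> complex" and B :: real where z: "\<And>n. z n \<in> K"
      and B: "\<And>n. (\<Sum>i\<in>?I. ((\<Sum>k<n. f i (z k)) - real n * (\<integral>w. f i w \<partial>\<mu>))\<^sup>2) \<le> real n * B"
    proof (rule greedy_quantization[OF K \<mu>, of ?I f])
      show "finite ?I" by simp
      show "continuous_on UNIV (f i)" for i by (rule fc)
    qed (rule that)
    \<comment> \<open>The squared error of the sums is at most \<open>m * B\<close>, so that of the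
      means is at most \<open>B / m\<close>; this choice puts it below the square of
      \<open>1 / (N + 1)\<close>.\<close>
    obtain m :: nat where m: "B * (real (Suc N))\<^sup>2 < m" "0 < m"
      using reals_Archimedean2[of "max 1 (B * (real (Suc N))\<^sup>2)"] by (auto simp del: of_nat_Suc)
    have "\<bar>(\<integral>w. f i w \<partial>uniform_on m z) - (\<integral>w. f i w \<partial>\<mu>)\<bar> \<le> 1 / Suc N" if i: "i \<in> ?I" for i
    proof -
      define D where "D = (\<Sum>k<m. f i (z k)) - m * (\<integral>w. f i w \<partial>\<mu>)"
      have "D\<^sup>2 \<le> m * B" unfolding D_def
        using member_le_sum[OF i, of "\<lambda>i. ((\<Sum>k<m. f i (z k)) - m * (\<integral>w. f i w \<partial>\<mu>))\<^sup>2"] B[of m] by simp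
      hence "D\<^sup>2 * (real (Suc N))\<^sup>2 \<le> m * B * (real (Suc N))\<^sup>2" by (rule mult_right_mono) simp
      also have "\<dots> = m * (B * (real (Suc N))\<^sup>2)" by (rule mult.assoc)
      also have "\<dots> \<le> real m * real m" using m by (intro mult_left_mono) auto
      finally have "(\<bar>D\<bar> * real (Suc N))\<^sup>2 \<le> (real m)\<^sup>2" by (simp only: power_mult_distrib power2_abs power2_eq_square[of "real m"])
      hence "\<bar>D\<bar> * real (Suc N) \<le> m" by (rule power2_le_imp_le) simp
      hence "\<bar>D\<bar> / m \<le> 1 / Suc N" using m(2) by (simp add: field_simps del: of_nat_Suc)
      moreover have "(\<integral>w. f i w \<partial>uniform_on m z) - (\<integral>w. f i w \<partial>\<mu>) = D / m"
        using m(2) by (simp add: uniform_on_integral borel_measurable_continuous_UNIV[OF fc] D_def field_simps)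
      ultimately show ?thesis by (simp only: abs_divide abs_of_nat)
    qed
    thus ?thesis using m(2) z by (intro exI[of _ m] exI[of _ z] conjI allI ballI)
  qed
  then obtain m a where m: "\<And>N. 0 < m N" and a: "\<And>N i. a N i \<in> K"
    and le: "\<And>N i. i \<in> {..N} \<times> {..N} \<Longrightarrow> \<bar>(\<integral>w. f i w \<partial>uniform_on (m N) (a N)) - (\<integral>w. f i w \<partial>\<mu>)\<bar> \<le> 1 / Suc N"
    by metis
  have "(\<lambda>N. \<integral>w. f (j, k) w \<partial>uniform_on (m N) (a N)) \<longlonglongrightarrow> (\<integral>w. f (j, k) w \<partial>\<mu>)" for j k
  proof (rule LIM_zero_cancel, rule Lim_null_comparison)
    show "(\<lambda>N. 1 / real (Suc N)) \<longlonglongrightarrow> 0" using LIMSEQ_inverse_real_of_nat by (simp only: inverse_eq_divide)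
    show "\<forall>\<^sub>F N in sequentially. norm ((\<integral>w. f (j, k) w \<partial>uniform_on (m N) (a N)) - (\<integral>w. f (j, k) w \<partial>\<mu>)) \<le> 1 / real (Suc N)"
      using eventually_ge_at_top[of "max j k"] by eventually_elim (use le[of "(j, k)"] in simp)
  qed
  hence "wconv (\<lambda>N. uniform_on (m N) (a N)) \<mu>"
    by (intro wconv_if_moments[OF K _ \<mu>] uniform_on_prob_measures_on m compact_imp_closed[OF K] a) (simp add: f_def)
  thus ?thesis by (rule that[OF m a])
qed

section \<open>Uniform measures on horizontal segments\<close>

definition segment_measure :: "complex \<Rightarrow> real \<Rightarrow> complex measure" where
  "segment_measure z h = distr (density lborel (\<lambda>s. ennreal (indicator {0..1} s))) borel (\<lambda>s::real. z + of_real (h * (2 * s - 1)))"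

lemma prob_space_unit_density: "prob_space (density lborel (\<lambda>s::real. ennreal (indicator {0..1} s)))"
  by (rule prob_spaceI) (simp add: emeasure_density ennreal_indicator)

lemma AE_segment_measureI:
  assumes [measurable]: "{y. P y} \<in> sets borel"
    and "\<And>s. s \<in> {0..1} \<Longrightarrow> s \<notin> N \<Longrightarrow> P (z + of_real (h * (2 * s - 1)))" "finite N"
  shows "AE y in segment_measure z h. P y"
proof -
  have "AE s in lborel. s \<notin> N"
    by (rule AE_not_in) (use assms(3) in \<open>auto simp: null_sets_def emeasure_lborel_countable countable_finite finite_imp_closed\<close>)
  hence "AE s in lborel. 0 < ennreal (indicator {0..1} s) \<longrightarrow> P (z + of_real (h * (2 * s - 1)))"
    by eventually_elim (use assms(2) in \<open>auto simp: indicator_def split: if_splits\<close>)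
  thus ?thesis unfolding segment_measure_def
    by (subst AE_distr_iff) (auto simp: AE_density)
qed

lemma segment_measure_prob_measures_on:
  assumes "0 \<le> h"
  shows "segment_measure z h \<in> prob_measures_on (cball z h)"
proof (rule prob_measures_onI)
  show "prob_space (segment_measure z h)" unfolding segment_measure_def
    by (rule prob_space.prob_space_distr[OF prob_space_unit_density]) simp
  show "AE y in segment_measure z h. y \<in> cball z h"
  proof (rule AE_segment_measureI[where N = "{}"])
    fix s :: real assume "s \<in> {0..1}"
    hence "\<bar>2 * s - 1\<bar> \<le> 1" by auto
    hence "\<bar>h * (2 * s - 1)\<bar> \<le> h" using assms by (simp add: abs_mult mult_left_le)
    moreover have "dist z (z + of_real t) = \<bar>t\<bar>" for t by (simp add: dist_norm)
    ultimately show "z + of_real (h * (2 * s - 1)) \<in> cball z h" by (simp only: mem_cball)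
  qed auto
qed (auto simp: segment_measure_def)

lemma segment_measure_integral:
  fixes f :: "complex \<Rightarrow> real"
  assumes [measurable]: "f \<in> borel_measurable borel"
  shows "(\<integral>y. f y \<partial>segment_measure z h) = (\<integral>s. indicator {0..1} s *\<^sub>R f (z + of_real (h * (2 * s - 1))) \<partial>lborel)"
  unfolding segment_measure_def by (subst integral_distr) (auto simp: integral_density)

section \<open>Averaging potentials over segments\<close>

text \<open>\<open>y / (y\<^sup>2 + \<delta>) powr (1 / 4)\<close> is bounded by \<open>\<surd>\<bar>y\<bar>\<close>, and four times its derivative dominates the kernel.\<close>

lemma neg_ln_primitive:
  fixes \<delta> :: real
  assumes \<delta>: "0 < \<delta>"
    and P_def: "P = (\<lambda>y. y * (y\<^sup>2 + \<delta>) powr (- 1 / 4))"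
    and P'_def: "P' = (\<lambda>y. (y\<^sup>2 + \<delta>) powr (- 1 / 4) - y\<^sup>2 / 2 * (y\<^sup>2 + \<delta>) powr (- 5 / 4))"
  shows "(P has_real_derivative P' y) (at y)" "continuous_on UNIV P'"
    "- ln (y\<^sup>2 + \<delta>) / 2 \<le> 4 * P' y" "\<bar>y\<bar> \<le> 4 \<Longrightarrow> \<bar>P y\<bar> \<le> 2"
proof -
  have p: "0 < y\<^sup>2 + \<delta>" for y using \<delta> by (simp add: add_nonneg_pos)
  have p0: "y\<^sup>2 + \<delta> \<noteq> 0" for y using p[of y] by simp
  show "(P has_real_derivative P' y) (at y)"
    unfolding P_def P'_def using p[of y]
    by (auto intro!: derivative_eq_intros simp: power2_eq_square)
  show "continuous_on UNIV P'" unfolding P'_def by (intro continuous_intros) (auto simp: p0)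
  define s where "s = (y\<^sup>2 + \<delta>) powr (- 1 / 4)"
  have s: "0 < s" unfolding s_def using p[of y] by simp
  have "(y\<^sup>2 + \<delta>) * (y\<^sup>2 + \<delta>) powr (- 5 / 4) = s"
  proof -
    have "(y\<^sup>2 + \<delta>) * (y\<^sup>2 + \<delta>) powr (- 5 / 4) = (y\<^sup>2 + \<delta>) powr 1 * (y\<^sup>2 + \<delta>) powr (- 5 / 4)" using p[of y] by simp
    also have "\<dots> = (y\<^sup>2 + \<delta>) powr (1 + - 5 / 4)" by (rule powr_add[symmetric])
    finally show ?thesis by (simp add: s_def)
  qed
  moreover have "y\<^sup>2 * (y\<^sup>2 + \<delta>) powr (- 5 / 4) \<le> (y\<^sup>2 + \<delta>) * (y\<^sup>2 + \<delta>) powr (- 5 / 4)" using \<delta> by (intro mult_right_mono) auto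
  ultimately have 1: "s / 2 \<le> P' y" unfolding P'_def s_def[symmetric] by simp
  \<comment> \<open>The kernel \<open>- ln (y\<^sup>2 + \<delta>) / 2\<close> is
    \<open>2 * ln s\<close>, and \<open>2 * ln s \<le> 2 * s \<le> 4 * P' y\<close>.\<close>
  have "ln s \<le> s - 1" using s by (rule ln_le_minus_one)
  moreover have "ln s = - 1 / 4 * ln (y\<^sup>2 + \<delta>)" unfolding s_def using p[of y] by (simp add: ln_powr)
  ultimately show "- ln (y\<^sup>2 + \<delta>) / 2 \<le> 4 * P' y" using 1 by simp
  assume y: "\<bar>y\<bar> \<le> 4"
  have "s ^ 4 = (y\<^sup>2 + \<delta>) powr (- 1)"
    unfolding s_def using p[of y] by (subst powr_power) auto
  also have "\<dots> = 1 / (y\<^sup>2 + \<delta>)" using p[of y] by (simp add: powr_minus_divide)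
  finally have "(P y) ^ 4 = y ^ 4 / (y\<^sup>2 + \<delta>)" unfolding P_def s_def[symmetric] by (simp add: power_mult_distrib)
  also have "\<dots> \<le> y\<^sup>2"
  proof -
    have "y ^ 4 = y\<^sup>2 * y\<^sup>2" by (simp add: power2_eq_square power4_eq_xxxx)
    also have "\<dots> \<le> y\<^sup>2 * (y\<^sup>2 + \<delta>)" using \<delta> by (intro mult_left_mono) auto
    finally show ?thesis using p[of y] by (simp add: divide_le_eq)
  qed
  also have "\<dots> \<le> 4\<^sup>2" using y by (metis abs_le_square_iff abs_numeral)
  finally have "\<bar>P y\<bar> ^ 4 \<le> 2 ^ 4" by (simp add: power_abs)
  thus "\<bar>P y\<bar> \<le> 2" by (rule power_le_imp_le_base[of _ 3, simplified numeral_eq_Suc, simplified]) simp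
qed

text \<open>The bound is free of \<open>d\<close> and continuous in \<open>w\<close>, which makes it
  a test function. Far from the segment the kernel varies along it by a multiple of
  \<open>h / r\<close> only; near the segment the distance is replaced by its horizontal part, and
  the primitive above bounds the average by \<open>- ln h + 8\<close>.\<close>

lemma segment_measure_integral_lker_le:
  assumes h: "0 < h" and d: "0 < d"
  shows "(\<integral>y. lker d w y \<partial>segment_measure z h) \<le> lker (h\<^sup>2) w z + 30 * (h / (h + cmod (w - z)))"
proof -
  define r where "r = cmod (w - z)"
  have r0: "0 \<le> r" by (simp add: r_def)
  note \<lambda> = segment_measure_prob_measures_on[OF less_imp_le[OF h], of z]
  have lc: "continuous_on A (lker d w)" for A by (intro continuous_intros d)
  have I: "integrable (segment_measure z h) (lker d w)"
    by (rule prob_measures_on_integrable[OF \<lambda> compact_cball lc])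
  show ?thesis
  proof (cases "2 * h \<le> r")
    case True
    have "(\<integral>y. lker d w y \<partial>segment_measure z h) \<le> - ln (r - h)"
    proof (rule prob_measures_on_integral_le[OF \<lambda> closed_cball I])
      fix y assume "y \<in> cball z h"
      hence "cmod (y - z) \<le> h" by (simp add: dist_norm norm_minus_commute)
      hence "r - h \<le> cmod (w - y)" using norm_triangle_ineq2[of "w - z" "y - z"] by (simp add: r_def)
      thus "lker d w y \<le> - ln (r - h)" using True h by (intro lker_le_neg_ln[OF d]) auto
    qed
    also have "\<dots> \<le> lker (h\<^sup>2) w z + 30 * (h / (h + r))"
    proof -
      have rh: "0 < r - h" "0 < r + h" using True h by auto
      have "r\<^sup>2 + h\<^sup>2 \<le> (r + h)\<^sup>2" using r0 h by (simp add: power2_sum)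
      hence "ln (r\<^sup>2 + h\<^sup>2) \<le> ln ((r + h)\<^sup>2)" using h by (intro ln_mono) (auto intro!: add_nonneg_pos)
      also have "\<dots> = 2 * ln (r + h)" using rh by (simp add: ln_realpow)
      finally have 1: "- ln (r + h) \<le> lker (h\<^sup>2) w z" by (simp add: lker_def r_def)
      have "ln (r + h) - ln (r - h) = ln ((r + h) / (r - h))" using rh by (simp add: ln_div)
      also have "\<dots> \<le> (r + h) / (r - h) - 1" using rh by (intro ln_le_minus_one) simp
      also have "\<dots> = 2 * h / (r - h)" using rh by (simp add: field_simps)
      \<comment> \<open>\<open>2 * h \<le> r\<close> gives
        \<open>(h + r) / 3 \<le> r - h\<close>.\<close>
      also have "\<dots> \<le> 2 * h / ((h + r) / 3)" using True h rh by (intro divide_left_mono mult_pos_pos) auto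
      also have "\<dots> \<le> 30 * (h / (h + r))" using h r0 by (simp add: field_simps)
      finally show ?thesis using 1 by linarith
    qed
    finally show ?thesis by (simp add: r_def)
  next
    case False
    define \<delta> where "\<delta> = d / h\<^sup>2"
    have \<delta>: "0 < \<delta>" using d h by (simp add: \<delta>_def)
    define P where "P = (\<lambda>y. y * (y\<^sup>2 + \<delta>) powr (- 1 / 4))"
    define P' where "P' = (\<lambda>y. (y\<^sup>2 + \<delta>) powr (- 1 / 4) - y\<^sup>2 / 2 * (y\<^sup>2 + \<delta>) powr (- 5 / 4))"
    note prim = neg_ln_primitive[OF \<delta> P_def P'_def]
    define a where "a = Re (w - z)"
    define b where "b = 1 + a / h"
    have "\<bar>a\<bar> \<le> r" unfolding a_def r_def by (rule abs_Re_le_cmod)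
    hence "\<bar>a / h\<bar> \<le> 2" using False h by (simp add: abs_divide field_simps)
    hence b: "\<bar>- b\<bar> \<le> 4" "\<bar>2 - b\<bar> \<le> 4" unfolding b_def by linarith+
    have pt: "lker d w (z + of_real (h * (2 * s - 1))) \<le> - ln h + 4 * P' (2 * s - b)" for s
    proof -
      define u where "u = 2 * s - b"
      \<comment> \<open>Dropping the vertical part of the distance only raises the kernel;
        \<open>u\<close> is the horizontal offset in units of \<open>h\<close>, up to sign.\<close>
      have "Re (w - (z + of_real (h * (2 * s - 1)))) = - (h * u)" using h by (simp add: a_def u_def b_def field_simps)
      hence "(h * u)\<^sup>2 \<le> (cmod (w - (z + of_real (h * (2 * s - 1)))))\<^sup>2"
        by (metis abs_Re_le_cmod abs_minus_cancel power2_abs power_mono abs_ge_zero)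
      hence "h\<^sup>2 * (u\<^sup>2 + \<delta>) \<le> (cmod (w - (z + of_real (h * (2 * s - 1)))))\<^sup>2 + d"
        using h by (simp add: \<delta>_def power_mult_distrib distrib_left)
      moreover have up: "0 < u\<^sup>2 + \<delta>" using \<delta> by (simp add: add_nonneg_pos)
      ultimately have "ln (h\<^sup>2 * (u\<^sup>2 + \<delta>)) \<le> ln ((cmod (w - (z + of_real (h * (2 * s - 1)))))\<^sup>2 + d)"
        using h by (intro ln_mono) auto
      moreover have "ln (h\<^sup>2 * (u\<^sup>2 + \<delta>)) = 2 * ln h + ln (u\<^sup>2 + \<delta>)" using h up by (simp add: ln_mult_pos ln_realpow)
      ultimately have "lker d w (z + of_real (h * (2 * s - 1))) \<le> - ln h + - ln (u\<^sup>2 + \<delta>) / 2" unfolding lker_def by simp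
      also have "\<dots> \<le> - ln h + 4 * P' u" using prim(3)[of u] by simp
      finally show ?thesis by (simp add: u_def)
    qed
    define F where "F s = - ln h * s + 2 * P (2 * s - b)" for s
    have FTC: "has_bochner_integral lborel (\<lambda>s. indicator {0..1} s *\<^sub>R (- ln h + 4 * P' (2 * s - b))) (F 1 - F 0)"
    proof (rule has_bochner_integral_FTC_Icc)
      fix s :: real
      have "((\<lambda>s. 2 * s - b) has_real_derivative 2) (at s)" by (auto intro!: derivative_eq_intros)
      from DERIV_chain2[OF prim(1)[of "2 * s - b"] this]
      have "((\<lambda>s. P (2 * s - b)) has_real_derivative P' (2 * s - b) * 2) (at s)" .
      hence "(F has_real_derivative - ln h + 4 * P' (2 * s - b)) (at s)" unfolding F_def
        by (auto intro!: derivative_eq_intros)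
      thus "(F has_vector_derivative - ln h + 4 * P' (2 * s - b)) (at s within {0..1})"
        unfolding has_real_derivative_iff_has_vector_derivative[symmetric] by (rule DERIV_subset) simp
    next
      show "continuous_on {0..1} (\<lambda>s. - ln h + 4 * P' (2 * s - b))"
        by (intro continuous_intros continuous_on_compose2[OF prim(2)]) auto
    qed simp
    have "continuous_on {0..1} (\<lambda>s. lker d w (z + of_real (h * (2 * s - 1))))"
      by (intro continuous_intros d)
    hence I2: "integrable lborel (\<lambda>s. indicator {0..1} s *\<^sub>R lker d w (z + of_real (h * (2 * s - 1))))"
      by (rule borel_integrable_compact[OF compact_Icc])
    have "(\<integral>y. lker d w y \<partial>segment_measure z h) = (\<integral>s. indicator {0..1} s *\<^sub>R lker d w (z + of_real (h * (2 * s - 1))) \<partial>lborel)"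
      by (rule segment_measure_integral) measurable
    also have "\<dots> \<le> (\<integral>s. indicator {0..1} s *\<^sub>R (- ln h + 4 * P' (2 * s - b)) \<partial>lborel)"
    proof (rule integral_mono[OF I2])
      show "integrable lborel (\<lambda>s. indicator {0..1} s *\<^sub>R (- ln h + 4 * P' (2 * s - b)))" using FTC by (rule integrable.intros)
      show "indicator {0..1} s *\<^sub>R lker d w (z + of_real (h * (2 * s - 1))) \<le> indicator {0..1} s *\<^sub>R (- ln h + 4 * P' (2 * s - b))" for s
        using pt by (intro scaleR_left_mono) auto
    qed
    also have "\<dots> = F 1 - F 0" by (rule has_bochner_integral_integral_eq[OF FTC])
    also have "\<dots> = - ln h + 2 * (P (2 - b) - P (- b))" by (simp add: F_def)
    also have "\<dots> \<le> - ln h + 8"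
    proof -
      have "P (2 - b) \<le> 2" by (rule abs_le_D1[OF prim(4)[OF b(2)]])
      moreover have "- P (- b) \<le> 2" by (rule abs_le_D2[OF prim(4)[OF b(1)]])
      ultimately have "P (2 - b) - P (- b) \<le> 4" by simp
      thus ?thesis by simp
    qed
    \<comment> \<open>Here \<open>r < 2 * h\<close>, so
      \<open>lker (h\<^sup>2) w z \<ge> - ln h - 1\<close> and
      \<open>h / (h + r) \<ge> 1 / 3\<close>; the term with 30 contributes at least 10, and 9 has to
      be covered.\<close>
    also have "\<dots> \<le> lker (h\<^sup>2) w z + 30 * (h / (h + r))"
    proof -
      have "r\<^sup>2 \<le> (2 * h)\<^sup>2" using False r0 by (intro power_mono) auto
      hence "r\<^sup>2 + h\<^sup>2 \<le> h\<^sup>2 * 5" by (simp add: power_mult_distrib)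
      also have "\<dots> \<le> h\<^sup>2 * exp 2" using exp_lower_Taylor_quadratic[of 2] by (intro mult_left_mono) auto
      finally have "ln (r\<^sup>2 + h\<^sup>2) \<le> ln (h\<^sup>2 * exp 2)" using h by (intro ln_mono) (auto intro!: add_nonneg_pos)
      also have "\<dots> = 2 * ln h + 2" using h by (simp add: ln_mult_pos ln_realpow)
      finally have 1: "- ln h - 1 \<le> lker (h\<^sup>2) w z" by (simp add: lker_def r_def)
      have "1 / 3 \<le> h / (h + r)" using False h r0 by (simp add: field_simps)
      thus ?thesis using 1 by linarith
    qed
    finally show ?thesis by (simp add: r_def)
  qed
qed

text \<open>Otherwise the regularised potentials exceed \<open>B\<close> eventually, at all but
  finitely many points of the segment. Cut off at \<open>B\<close> they then tend to
  \<open>B\<close>, so \<open>B\<close> is at most a limit of their averages; by Fubini these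
  averages are at most the integral of the majorant, which is below \<open>B\<close>. The point
  found serves all \<open>d\<close> at once.\<close>

lemma exists_point_rpot_le:
  assumes \<nu>: "\<nu> \<in> prob_measures_on K" and K: "compact K" and h: "0 < h" and N: "finite N"
    and B: "(\<integral>w. lker (h\<^sup>2) w z + 30 * (h / (h + cmod (w - z))) \<partial>\<nu>) < B"
  obtains x where "\<bar>x\<bar> \<le> h" "x \<notin> N" "\<And>d. 0 < d \<Longrightarrow> rpot d \<nu> (z + of_real x) \<le> B"
proof -
  have "\<exists>x. \<bar>x\<bar> \<le> h \<and> x \<notin> N \<and> (\<forall>d>0. rpot d \<nu> (z + of_real x) \<le> B)"
  proof (rule ccontr)
    assume neg: "\<not> ?thesis"
    let ?S = "segment_measure z h"
    note \<lambda> = segment_measure_prob_measures_on[OF less_imp_le[OF h], of z]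
    interpret L: prob_space ?S by (rule prob_measures_onD[OF \<lambda>])
    note P = prob_measures_on_P_log[OF \<nu> K]
    define dn where "dn n = inverse (real (Suc n))" for n
    have dn: "0 < dn n" "dn n \<le> 1" for n by (simp_all add: dn_def field_simps)
    define u where "u n y = rpot (dn n) \<nu> y" for n y
    have um[measurable]: "u n \<in> borel_measurable borel" for n
      unfolding u_def[abs_def] by (rule borel_measurable_continuous_UNIV[OF continuous_on_rpot[OF P dn(1)]])
    have um': "u n \<in> borel_measurable ?S" for n by (rule prob_measures_on_measurable[OF \<lambda> um])
    have ui: "integrable ?S (u n)" for n
      unfolding u_def[abs_def] by (rule integrable_rpot[OF \<lambda> compact_cball P dn(1)])
    have umono: "u m y \<le> u n y" if "m \<le> n" for m n y
      unfolding u_def dn_def using that by (intro rpot_antimono[OF P] inverse_Suc_decr) auto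
    define G where "G = (\<integral>w. lker (h\<^sup>2) w z + 30 * (h / (h + cmod (w - z))) \<partial>\<nu>)"
    have gc: "continuous_on UNIV (\<lambda>w. lker (h\<^sup>2) w z + 30 * (h / (h + cmod (w - z))))"
      using h by (intro continuous_intros) (auto simp: add_nonneg_eq_0_iff less_imp_neq[symmetric] add_pos_nonneg)
    have uG: "(\<integral>y. u n y \<partial>?S) \<le> G" for n
    proof -
      have sw: "rpot (dn n) ?S w = (\<integral>y. lker (dn n) w y \<partial>?S)" for w
        unfolding rpot_def by (intro Bochner_Integration.integral_cong refl lker_commute)
      have "continuous_on UNIV (\<lambda>(y, w). lker (dn n) w y)" unfolding case_prod_unfold by (intro continuous_intros dn)
      from Fubini_prob_measures_on[OF \<nu> K \<lambda> compact_cball this]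
      have "(\<integral>y. u n y \<partial>?S) = (\<integral>w. (\<integral>y. lker (dn n) w y \<partial>?S) \<partial>\<nu>)" unfolding u_def rpot_def .
      also have "\<dots> = (\<integral>w. rpot (dn n) ?S w \<partial>\<nu>)" unfolding sw ..
      also have "\<dots> \<le> G" unfolding G_def
      proof (rule integral_mono)
        show "integrable \<nu> (rpot (dn n) ?S)" by (rule integrable_rpot[OF \<nu> K prob_measures_on_P_log[OF \<lambda> compact_cball] dn(1)])
        show "integrable \<nu> (\<lambda>w. lker (h\<^sup>2) w z + 30 * (h / (h + cmod (w - z))))" by (rule prob_measures_on_integrable[OF \<nu> K gc])
        show "rpot (dn n) ?S w \<le> lker (h\<^sup>2) w z + 30 * (h / (h + cmod (w - z)))" for w
          using segment_measure_integral_lker_le[OF h dn(1)[of n], of z w] unfolding sw .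
      qed
      finally show ?thesis .
    qed
    have lim: "(\<lambda>n. min (u n (z + of_real x)) B) \<longlonglongrightarrow> B" if x: "\<bar>x\<bar> \<le> h" "x \<notin> N" for x
    proof -
      have "\<not> (\<forall>d>0. rpot d \<nu> (z + of_real x) \<le> B)" using neg x by blast
      then obtain d where d: "0 < d" "B < rpot d \<nu> (z + of_real x)" by (auto simp: not_le)
      obtain m where m: "dn m < d" unfolding dn_def using reals_Archimedean[OF d(1)] by blast
      have "B < u m (z + of_real x)" unfolding u_def using rpot_antimono[OF P dn(1) less_imp_le[OF m], of "z + of_real x"] d(2) by linarith
      hence "min (u n (z + of_real x)) B = B" if "n \<ge> m" for n using umono[OF that, of "z + of_real x"] by simp
      thus ?thesis by (intro tendsto_eventually eventually_sequentiallyI[of m])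
    qed
    have "(\<lambda>n. \<integral>y. min (u n y) B \<partial>?S) \<longlonglongrightarrow> (\<integral>y. B \<partial>?S)"
    proof (rule integral_dominated_convergence[where w = "\<lambda>y. \<bar>u 0 y\<bar> + \<bar>B\<bar>"])
      show "integrable ?S (\<lambda>y. \<bar>u 0 y\<bar> + \<bar>B\<bar>)" using ui[of 0] by simp
      show "AE y in ?S. norm (min (u n y) B) \<le> \<bar>u 0 y\<bar> + \<bar>B\<bar>" for n
      proof (rule AE_I2)
        fix y
        have "u 0 y \<le> u n y" by (rule umono) simp
        moreover have "min (u n y) B = u n y \<and> u n y \<le> B \<or> min (u n y) B = B" by (simp add: min_def)
        ultimately show "norm (min (u n y) B) \<le> \<bar>u 0 y\<bar> + \<bar>B\<bar>" unfolding real_norm_def by linarith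
      qed
      show "AE y in ?S. (\<lambda>n. min (u n y) B) \<longlonglongrightarrow> B"
      proof (rule AE_segment_measureI[where N = "(\<lambda>x. (x / h + 1) / 2) ` N"])
        show "{y. (\<lambda>n. min (u n y) B) \<longlonglongrightarrow> B} \<in> sets borel" by measurable
        fix s :: real assume s: "s \<in> {0..1}" "s \<notin> (\<lambda>x. (x / h + 1) / 2) ` N"
        have "\<bar>2 * s - 1\<bar> \<le> 1" using s by auto
        hence 1: "\<bar>h * (2 * s - 1)\<bar> \<le> h" using h by (simp add: abs_mult mult_left_le)
        have 2: "h * (2 * s - 1) \<notin> N"
        proof
          assume "h * (2 * s - 1) \<in> N"
          hence "(h * (2 * s - 1) / h + 1) / 2 \<in> (\<lambda>x. (x / h + 1) / 2) ` N" by (rule imageI)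
          thus False using s(2) h by simp
        qed
        show "(\<lambda>n. min (u n (z + of_real (h * (2 * s - 1)))) B) \<longlonglongrightarrow> B" by (rule lim[OF 1 2])
      qed (use N in simp)
    qed (use um' in measurable)
    moreover have "(\<integral>y. min (u n y) B \<partial>?S) \<le> G" for n
    proof -
      have "(\<integral>y. min (u n y) B \<partial>?S) \<le> (\<integral>y. u n y \<partial>?S)" using ui by (intro integral_mono) auto
      thus ?thesis using uG[of n] by linarith
    qed
    ultimately have "(\<integral>y. B \<partial>?S) \<le> G" by (intro LIMSEQ_le_const2) auto
    thus False using B by (simp add: G_def L.prob_space)
  qed
  thus ?thesis using that by blast
qed

text \<open>An atom of mass \<open>m\<close> at \<open>z\<close> contributes
  \<open>m * (- ln d / 2)\<close> to \<open>rpot d\<close>, which is unbounded as \<open>d\<close>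
  tends to 0.\<close>

lemma AE_neq_if_rpot_bounded:
  assumes \<nu>: "\<nu> \<in> P_log" and c: "\<And>d. 0 < d \<Longrightarrow> rpot d \<nu> z \<le> c"
  shows "AE w in \<nu>. w \<noteq> z"
proof -
  interpret prob_space \<nu> by (rule P_logD[OF \<nu>])
  have zs: "{z} \<in> sets \<nu>" using P_logD(2)[OF \<nu>] by simp
  define m where "m = measure \<nu> {z}"
  define C where "C = (\<integral>w. min 0 (lker 1 w z) \<partial>\<nu>)"
  have i1: "integrable \<nu> (\<lambda>w. min 0 (lker 1 w z))" using integrable_lker[OF \<nu>, of 1 z] by auto
  have *: "m * (- ln d / 2) + C \<le> c" if d: "0 < d" "d \<le> 1" for d
  proof -
    have i2: "integrable \<nu> (\<lambda>w. indicator {z} w * (- ln d / 2))"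
      using zs by (intro Bochner_Integration.integrable_mult_left integrable_real_indicator) (auto simp: emeasure_eq_measure)
    have "m * (- ln d / 2) + C = (\<integral>w. indicator {z} w * (- ln d / 2) + min 0 (lker 1 w z) \<partial>\<nu>)"
      using i1 i2 zs by (simp add: m_def C_def)
    also have "\<dots> \<le> rpot d \<nu> z" unfolding rpot_def
    proof (rule integral_mono)
      fix w
      have "lker 1 w z \<le> lker d w z" by (rule lker_antimono) (use d in auto)
      moreover have "lker d z z = - ln d / 2" by (simp add: lker_def)
      ultimately show "indicator {z} w * (- ln d / 2) + min 0 (lker 1 w z) \<le> lker d w z"
        by (auto simp: indicator_def min_def)
    qed (use i1 i2 integrable_lker[OF \<nu> d(1)] in auto)
    also have "\<dots> \<le> c" by (rule c[OF d(1)])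
    finally show ?thesis .
  qed
  have "m = 0"
  proof (rule ccontr)
    assume "m \<noteq> 0"
    hence m: "0 < m" by (simp add: m_def zero_less_measure_iff measure_nonneg order.not_eq_order_implies_strict)
    define t where "t = max 0 (2 * (c - C + 1) / m)"
    have "m * (- ln (exp (- t)) / 2) + C \<le> c" by (rule *) (auto simp: t_def)
    hence "m * t / 2 + C \<le> c" by simp
    moreover have "c - C + 1 \<le> m * t / 2"
    proof -
      have "2 * (c - C + 1) / m \<le> t" by (simp add: t_def)
      hence "2 * (c - C + 1) \<le> t * m" using m by (simp add: divide_le_eq)
      thus ?thesis by (simp add: mult.commute)
    qed
    ultimately show False by linarith
  qed
  hence "emeasure \<nu> {z} = 0" by (simp add: m_def emeasure_eq_measure)
  thus ?thesis using zs by (intro AE_I[of _ _ "{z}"]) auto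
qed

text \<open>At \<open>z\<close> itself weak convergence gives no upper bound on the potentials of
  \<open>\<nu>s n\<close>. For small \<open>h\<close>, however, the segment majorant has
  \<nu>-integral below \<open>c + e\<close>: its kernel part is at most \<open>c\<close>, and the
  rest vanishes with \<open>h\<close> because \<nu> has no atom at \<open>z\<close>. The majorant is
  continuous, so the same holds for \<open>\<nu>s n\<close> eventually, and some point of the
  segment is as required.\<close>

lemma wconv_eventually_point:
  assumes K: "compact K" and \<nu>s: "\<And>n. \<nu>s n \<in> prob_measures_on K" and \<nu>: "\<nu> \<in> prob_measures_on K"
    and wc: "wconv \<nu>s \<nu>" and c: "\<And>d. 0 < d \<Longrightarrow> rpot d \<nu> z \<le> c" and e: "0 < e" and \<eta>: "0 < \<eta>"
    and N: "\<And>n. finite (N n)"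
  shows "eventually (\<lambda>n. \<exists>x. \<bar>x\<bar> \<le> \<eta> \<and> x \<notin> N n \<and> (\<forall>d>0. rpot d (\<nu>s n) (z + of_real x) \<le> c + e)) sequentially"
proof -
  interpret prob_space \<nu> by (rule prob_measures_onD[OF \<nu>])
  note P = prob_measures_on_P_log[OF \<nu> K]
  have ae: "AE w in \<nu>. w \<noteq> z" by (rule AE_neq_if_rpot_bounded[OF P]) (rule c)
  define h where "h k = \<eta> * inverse (real (Suc k))" for k
  have h: "0 < h k" "h k \<le> \<eta>" for k using \<eta> by (simp_all add: h_def field_simps)
  have h0: "h \<longlonglongrightarrow> 0" unfolding h_def using tendsto_mult[OF tendsto_const LIMSEQ_inverse_real_of_nat, of \<eta>] by simp
  define q where "q k w = h k / (h k + cmod (w - z))" for k w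
  have den: "0 < h k + cmod (w - z)" for k w using h(1)[of k] by (simp add: add_pos_nonneg)
  have qc: "continuous_on UNIV (q k)" for k
    unfolding q_def using den by (intro continuous_intros) (simp add: less_imp_neq[symmetric])
  have q01: "0 \<le> q k w" "q k w \<le> 1" for k w unfolding q_def using h(1)[of k] den[of k w] by (auto simp: less_imp_le)
  have "(\<lambda>k. \<integral>w. q k w \<partial>\<nu>) \<longlonglongrightarrow> (\<integral>w. 0 \<partial>\<nu>)"
  proof (rule integral_dominated_convergence[where w = "\<lambda>_. 1"])
    show "q k \<in> borel_measurable \<nu>" for k by (rule prob_measures_on_measurable[OF \<nu> borel_measurable_continuous_UNIV[OF qc]])
    show "AE w in \<nu>. (\<lambda>k. q k w) \<longlonglongrightarrow> 0"
      using ae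
    proof eventually_elim
      case (elim w)
      have "(\<lambda>k. q k w) \<longlonglongrightarrow> 0 / (0 + cmod (w - z))" unfolding q_def using elim by (intro tendsto_intros h0) auto
      thus ?case by simp
    qed
    show "AE w in \<nu>. norm (q k w) \<le> 1" for k using q01 by (intro AE_I2) auto
  qed auto
  hence "(\<lambda>k. \<integral>w. q k w \<partial>\<nu>) \<longlonglongrightarrow> 0" by simp
  from order_tendstoD(2)[OF this, of "e / 30"] e
  obtain k where k: "(\<integral>w. q k w \<partial>\<nu>) < e / 30" by (auto simp: eventually_sequentially)
  define g where "g w = lker ((h k)\<^sup>2) w z + 30 * (h k / (h k + cmod (w - z)))" for w
  have h2: "0 < (h k)\<^sup>2" using h(1)[of k] by simp
  have gc: "continuous_on UNIV g"
    unfolding g_def using den h2 by (intro continuous_intros) (simp_all add: less_imp_neq[symmetric])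
  have "(\<integral>w. g w \<partial>\<nu>) = rpot ((h k)\<^sup>2) \<nu> z + 30 * (\<integral>w. q k w \<partial>\<nu>)"
    unfolding g_def rpot_def q_def[symmetric]
    using integrable_lker[OF P h2] prob_measures_on_integrable[OF \<nu> K qc, of k] by simp
  also have "\<dots> < c + e" using c[OF h2] k by simp
  finally have "eventually (\<lambda>n. (\<integral>w. g w \<partial>\<nu>s n) < c + e) sequentially"
    using order_tendstoD(2)[OF wconvD[OF wc gc]] by blast
  thus ?thesis
  proof eventually_elim
    case (elim n)
    obtain x where "\<bar>x\<bar> \<le> h k" "x \<notin> N n" "\<And>d. 0 < d \<Longrightarrow> rpot d (\<nu>s n) (z + of_real x) \<le> c + e"
      using exists_point_rpot_le[OF \<nu>s K h(1) N elim[unfolded g_def]] by blast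
    thus ?case using h(2)[of k] by (intro exI[of _ x]) auto
  qed
qed

section \<open>Measures of compact support\<close>

text \<open>The exponential form includes that \<open>y\<close> is not a root; letting
  \<open>d\<close> tend to 0 in the product instead of the sum avoids the logarithm of 0.\<close>

lemma rootpoly_ge_if_rpot_le:
  assumes m: "0 < m" and le: "\<And>d. 0 < d \<Longrightarrow> rpot d (uniform_on m a) y \<le> c"
  shows "exp (- (m * c)) \<le> cmod (rootpoly m a y)"
proof -
  have *: "exp (- (m * c)) ^ 2 \<le> (\<Prod>i<m. (cmod (a i - y))\<^sup>2 + d)" if d: "0 < d" for d
  proof -
    have p: "0 < (cmod (a i - y))\<^sup>2 + d" for i using d by (rule cmod_sq_add_pos)
    have "(\<Sum>i<m. lker d (a i) y) / m \<le> c" using le[OF d] unfolding uniform_on_rpot[OF m] .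
    hence "(\<Sum>i<m. lker d (a i) y) \<le> m * c" using m by (simp add: field_simps)
    moreover have "(\<Sum>i<m. lker d (a i) y) = - ln (\<Prod>i<m. (cmod (a i - y))\<^sup>2 + d) / 2"
      using p by (subst ln_prod) (auto simp: lker_def sum_negf sum_divide_distrib[symmetric] less_imp_neq[symmetric])
    ultimately have "- (2 * (m * c)) \<le> ln (\<Prod>i<m. (cmod (a i - y))\<^sup>2 + d)" by simp
    moreover have "0 < (\<Prod>i<m. (cmod (a i - y))\<^sup>2 + d)" using p by (intro prod_pos) auto
    ultimately have "exp (- (2 * (m * c))) \<le> (\<Prod>i<m. (cmod (a i - y))\<^sup>2 + d)" by (simp only: ln_ge_iff)
    moreover have "exp (- (m * c)) ^ 2 = exp (- (2 * (m * c)))" by (simp add: exp_of_nat_mult[symmetric])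
    ultimately show ?thesis by simp
  qed
  have "(\<lambda>n. \<Prod>i<m. (cmod (a i - y))\<^sup>2 + inverse (real (Suc n))) \<longlonglongrightarrow> (\<Prod>i<m. (cmod (a i - y))\<^sup>2 + 0)"
    by (intro tendsto_intros LIMSEQ_inverse_real_of_nat)
  hence "exp (- (m * c)) ^ 2 \<le> (\<Prod>i<m. (cmod (a i - y))\<^sup>2 + 0)"
    by (rule LIMSEQ_le_const) (use * in auto)
  also have "\<dots> = (cmod (rootpoly m a y))\<^sup>2"
    unfolding rootpoly_def prod_norm[symmetric] prod_power_distrib by (simp add: norm_minus_commute)
  finally show ?thesis by (rule power2_le_imp_le) simp
qed

lemma rpot_uniform_on_le:
  assumes m: "0 < m" and d: "0 < d" and ne: "rootpoly m a y \<noteq> 0"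
  shows "rpot d (uniform_on m a) y \<le> - ln (cmod (rootpoly m a y)) / m"
proof -
  have n0: "y \<noteq> a i" if "i < m" for i using ne that by (auto simp: rootpoly_def)
  have "(\<Sum>i<m. lker d (a i) y) \<le> (\<Sum>i<m. - ln (cmod (y - a i)))"
  proof (rule sum_mono)
    fix i assume "i \<in> {..<m}"
    hence "0 < cmod (y - a i)" using n0[of i] by simp
    thus "lker d (a i) y \<le> - ln (cmod (y - a i))"
      using lker_le_neg_ln[OF d, of "cmod (y - a i)" "a i" y] by (simp add: norm_minus_commute)
  qed
  also have "\<dots> = - ln (cmod (rootpoly m a y))"
    unfolding rootpoly_def prod_norm[symmetric] using n0 by (subst ln_prod) (auto simp: sum_negf)
  finally show ?thesis unfolding uniform_on_rpot[OF m] using m by (intro divide_right_mono) auto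
qed

text \<open>The lemniscate measure for \<rho> = 1 has potential at most 0, hence energy at most 0,
  and no measure on \<open>K\<close> does better. The last part expresses the exact potential off
  the curve as a lower bound for every upper bound \<open>c\<close>, the form that matches bounds
  through \<open>rpot\<close>.\<close>

theorem lemniscate_equilibrium:
  fixes a :: "nat \<Rightarrow> complex"
  assumes m: "0 < m"
  defines "K \<equiv> {z. cmod (rootpoly m a z) \<le> 1}"
  shows "log_capacity K = 1" "equilibrium_measure K \<in> prob_measures_on K"
    "0 < d \<Longrightarrow> rpot d (equilibrium_measure K) z \<le> - ln (max (cmod (rootpoly m a z)) 1) / m"
    "cmod (rootpoly m a z) \<noteq> 1 \<Longrightarrow> (\<And>d. 0 < d \<Longrightarrow> rpot d (equilibrium_measure K) z \<le> c) \<Longrightarrow>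
      - ln (max (cmod (rootpoly m a z)) 1) / m \<le> c"
proof -
  have K: "compact K" unfolding K_def using compact_lemniscate(1)[OF m, of 1] by simp
  let ?L = "{z. cmod (rootpoly m a z) = 1}"
  have L: "compact ?L" using compact_lemniscate(2)[OF m, of 1] by simp
  obtain \<tau> where \<tau>: "\<tau> \<in> prob_measures_on ?L"
    and T2: "\<And>z d. 0 < d \<Longrightarrow> rpot d \<tau> z \<le> - ln (max (cmod (rootpoly m a z)) 1) / m"
    and T3: "\<And>z. cmod (rootpoly m a z) \<noteq> 1 \<Longrightarrow>
      (\<lambda>n. rpot (inverse (real (Suc n))) \<tau> z) \<longlonglongrightarrow> - ln (max (cmod (rootpoly m a z)) 1) / m"
    using lemniscate_measure[OF m, of 1 a] by (metis zero_less_one)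
  have \<tau>K: "\<tau> \<in> prob_measures_on K"
    by (rule prob_measures_on_mono[OF \<tau> compact_imp_closed[OF L] compact_imp_closed[OF K]]) (auto simp: K_def)
  have neg: "- ln (max (cmod (rootpoly m a z)) 1) / m \<le> 0" for z by simp
  have r0: "rpot d \<tau> z \<le> 0" if "0 < d" for d z using T2[OF that, of z] neg[of z] by linarith
  have le: "log_energy \<tau> \<le> ereal 0" by (rule log_energy_le_if_rpot_le[OF \<tau>K K r0])
  have min: "0 \<le> c" if \<alpha>: "\<alpha> \<in> prob_measures_on K" "log_energy \<alpha> \<le> ereal c" for \<alpha> c
  proof (rule field_le_epsilon)
    fix e :: real assume e: "0 < e"
    \<comment> \<open>The energy bound asks for a strict inequality on \<open>K\<close>, so the
      level is raised slightly above 1; the arbitrary \<open>e\<close> removes the loss.\<close>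
    have "- ln (exp (m * e)) / m \<le> c"
    proof (rule energy_ge_lemniscate[OF m exp_gt_zero K _ \<alpha>])
      fix z assume "z \<in> K"
      hence "cmod (rootpoly m a z) \<le> 1" by (simp add: K_def)
      also have "1 < exp (m * e)" using m e by simp
      finally show "cmod (rootpoly m a z) < exp (m * e)" .
    qed
    thus "0 \<le> c + e" using m by simp
  qed
  have eq: "equilibrium_measure K = \<tau>" by (rule equilibrium_measure_eqI(1)[OF K \<tau>K le min])
  have "log_capacity K = exp (- 0)" by (rule equilibrium_measure_eqI(2)[OF K \<tau>K le min])
  thus "log_capacity K = 1" by simp
  show "equilibrium_measure K \<in> prob_measures_on K" unfolding eq by (rule \<tau>K)
  show "0 < d \<Longrightarrow> rpot d (equilibrium_measure K) z \<le> - ln (max (cmod (rootpoly m a z)) 1) / m" unfolding eq by (rule T2)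
  assume "cmod (rootpoly m a z) \<noteq> 1" "\<And>d. 0 < d \<Longrightarrow> rpot d (equilibrium_measure K) z \<le> c"
  thus "- ln (max (cmod (rootpoly m a z)) 1) / m \<le> c"
    unfolding eq by (intro LIMSEQ_le_const2[OF T3]) auto
qed

text \<open>Hypotheses 1 and 2 say that the two potentials have the same upper bounds at each point,
  hence the same limit as \<open>d\<close> tends to 0. The energy distance is the integral of their
  difference against \<nu> minus that against \<tau>; both tend to 0, with domination by the values
  at \<open>d = 1\<close> and the upper bound 0.\<close>

lemma prob_measures_on_eq_if_potentials_eq:
  assumes \<nu>: "\<nu> \<in> prob_measures_on (cball 0 R)" "\<tau> \<in> prob_measures_on (cball 0 R)"
    and c0: "\<And>z d. 0 < d \<Longrightarrow> rpot d \<nu> z \<le> 0" "\<And>z d. 0 < d \<Longrightarrow> rpot d \<tau> z \<le> 0"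
    and 1: "\<And>z c d. (\<And>d. 0 < d \<Longrightarrow> rpot d \<nu> z \<le> c) \<Longrightarrow> 0 < d \<Longrightarrow> rpot d \<tau> z \<le> c"
    and 2: "\<And>z c d. (\<And>d. 0 < d \<Longrightarrow> rpot d \<tau> z \<le> c) \<Longrightarrow> 0 < d \<Longrightarrow> rpot d \<nu> z \<le> c"
  shows "\<nu> = \<tau>"
proof -
  note K = compact_cball[of "0::complex" R]
  note P = prob_measures_on_P_log[OF \<nu>(1) K] prob_measures_on_P_log[OF \<nu>(2) K]
  define dn where "dn n = inverse (real (Suc n))" for n
  have dn: "0 < dn n" "dn n \<le> 1" for n by (simp_all add: dn_def field_simps)
  have conv: "\<exists>l. (\<lambda>n. rpot (dn n) M z) \<longlonglongrightarrow> l \<and> (\<forall>d>0. rpot d M z \<le> l)"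
    if M: "M \<in> P_log" and M0: "\<And>z d. 0 < d \<Longrightarrow> rpot d M z \<le> 0" for M z
  proof -
    have inc: "incseq (\<lambda>n. rpot (dn n) M z)"
      by (auto simp: incseq_def dn_def intro!: rpot_antimono[OF M] inverse_Suc_decr simp del: of_nat_Suc)
    have "rpot (dn n) M z \<le> 0" for n by (rule M0[OF dn(1)])
    then obtain l where l: "(\<lambda>n. rpot (dn n) M z) \<longlonglongrightarrow> l"
      using incseq_convergent[OF inc, of 0] by blast
    have "rpot d M z \<le> l" if d: "0 < d" for d
    proof -
      obtain n where "dn n < d" unfolding dn_def using reals_Archimedean[OF d] by blast
      hence "rpot d M z \<le> rpot (dn n) M z" by (intro rpot_antimono[OF M] dn) simp
      also have "\<dots> \<le> l" by (rule incseq_le[OF inc l])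
      finally show ?thesis .
    qed
    thus ?thesis using l by blast
  qed
  have diff: "(\<lambda>n. rpot (dn n) \<nu> z - rpot (dn n) \<tau> z) \<longlonglongrightarrow> 0" for z
  proof -
    obtain l where l: "(\<lambda>n. rpot (dn n) \<nu> z) \<longlonglongrightarrow> l" "\<And>d. 0 < d \<Longrightarrow> rpot d \<nu> z \<le> l" using conv[OF P(1) c0(1)] by metis
    obtain l' where l': "(\<lambda>n. rpot (dn n) \<tau> z) \<longlonglongrightarrow> l'" "\<And>d. 0 < d \<Longrightarrow> rpot d \<tau> z \<le> l'" using conv[OF P(2) c0(2)] by metis
    have "l' \<le> l" by (rule LIMSEQ_le_const2[OF l'(1)]) (use 1[OF l(2) dn(1)] in auto)
    moreover have "l \<le> l'" by (rule LIMSEQ_le_const2[OF l(1)]) (use 2[OF l'(2) dn(1)] in auto)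
    ultimately show ?thesis using tendsto_diff[OF l(1) l'(1)] by simp
  qed
  have I: "(\<lambda>n. \<integral>z. rpot (dn n) \<nu> z - rpot (dn n) \<tau> z \<partial>M) \<longlonglongrightarrow> 0" if M: "M \<in> prob_measures_on (cball 0 R)" for M
  proof -
    have m: "rpot (dn n) \<nu> \<in> borel_measurable M" "rpot (dn n) \<tau> \<in> borel_measurable M" for n
      by (intro prob_measures_on_measurable[OF M] borel_measurable_continuous_UNIV continuous_on_rpot P dn)+
    have "(\<lambda>n. \<integral>z. rpot (dn n) \<nu> z - rpot (dn n) \<tau> z \<partial>M) \<longlonglongrightarrow> (\<integral>z. 0 \<partial>M)"
    proof (rule integral_dominated_convergence[where w = "\<lambda>z. \<bar>rpot 1 \<nu> z\<bar> + \<bar>rpot 1 \<tau> z\<bar>"])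
      show "integrable M (\<lambda>z. \<bar>rpot 1 \<nu> z\<bar> + \<bar>rpot 1 \<tau> z\<bar>)"
        using integrable_rpot[OF M K P(1)] integrable_rpot[OF M K P(2)] by auto
      show "AE z in M. norm (rpot (dn n) \<nu> z - rpot (dn n) \<tau> z) \<le> \<bar>rpot 1 \<nu> z\<bar> + \<bar>rpot 1 \<tau> z\<bar>" for n
      proof (rule AE_I2)
        fix z
        have "rpot 1 \<nu> z \<le> rpot (dn n) \<nu> z" "rpot 1 \<tau> z \<le> rpot (dn n) \<tau> z" using rpot_antimono[OF _ dn] P by auto
        thus "norm (rpot (dn n) \<nu> z - rpot (dn n) \<tau> z) \<le> \<bar>rpot 1 \<nu> z\<bar> + \<bar>rpot 1 \<tau> z\<bar>"
          using c0[OF dn(1), of n z] unfolding real_norm_def by linarith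
      qed
    qed (use m diff in auto)
    thus ?thesis by simp
  qed
  have ed: "energy_dist (dn n) \<nu> \<tau> = (\<integral>z. rpot (dn n) \<nu> z - rpot (dn n) \<tau> z \<partial>\<nu>) - (\<integral>z. rpot (dn n) \<nu> z - rpot (dn n) \<tau> z \<partial>\<tau>)" for n
  proof -
    have i: "integrable M (rpot (dn n) \<nu>)" "integrable M (rpot (dn n) \<tau>)" if "M \<in> prob_measures_on (cball 0 R)" for M
      by (intro integrable_rpot[OF that K] P dn)+
    have "renergy (dn n) \<tau> \<nu> = renergy (dn n) \<nu> \<tau>" by (rule renergy_commute[OF \<nu>(2) K \<nu>(1) K dn(1)])
    thus ?thesis unfolding energy_dist_def using i[OF \<nu>(1)] i[OF \<nu>(2)] by (simp add: renergy_def)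
  qed
  have "(\<lambda>n. energy_dist (dn n) \<nu> \<tau>) \<longlonglongrightarrow> 0" unfolding ed using tendsto_diff[OF I[OF \<nu>(1)] I[OF \<nu>(2)]] by simp
  show ?thesis
  proof (rule energy_dist_eq_0[OF \<nu>])
    fix e :: real assume "0 < e"
    from order_tendstoD(2)[OF \<open>(\<lambda>n. energy_dist (dn n) \<nu> \<tau>) \<longlonglongrightarrow> 0\<close> this]
    obtain n where "energy_dist (dn n) \<nu> \<tau> < e" by (auto simp: eventually_sequentially)
    thus "\<exists>d>0. d \<le> 1 \<and> energy_dist d \<nu> \<tau> < e" using dn by blast
  qed
qed

lemma LIMSEQ_if_subsubseq:
  fixes X :: "nat \<Rightarrow> real"
  assumes sub: "\<And>r :: nat \<Rightarrow> nat. strict_mono r \<Longrightarrow> \<exists>s :: nat \<Rightarrow> nat. strict_mono s \<and> (X \<circ> r \<circ> s) \<longlonglongrightarrow> L"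
  shows "X \<longlonglongrightarrow> L"
proof (rule ccontr)
  assume "\<not> X \<longlonglongrightarrow> L"
  then obtain e where e: "0 < e" "\<And>N. \<exists>n\<ge>N. e \<le> \<bar>X n - L\<bar>"
    unfolding LIMSEQ_iff by (auto simp: not_less)
  have "infinite {n. e \<le> \<bar>X n - L\<bar>}" unfolding infinite_nat_iff_unbounded_le using e(2) by auto
  then obtain r :: "nat \<Rightarrow> nat" where r: "strict_mono r" "\<And>n. r n \<in> {n. e \<le> \<bar>X n - L\<bar>}"
    using infinite_enumerate by blast
  obtain s where "strict_mono s" "(X \<circ> r \<circ> s) \<longlonglongrightarrow> L" using sub[OF r(1)] by blast
  from LIMSEQ_D[OF this(2) e(1)] obtain N where "\<bar>X (r (s N)) - L\<bar> < e" by auto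
  thus False using r(2)[of "s N"] by simp
qed

text \<open>By compactness it suffices that every weak limit \<sigma> of a subsequence of the
  equilibrium measures equals \<mu>, and for this that both potentials have the same upper bounds.
  Roots in the disc of radius \<open>R\<close> put all lemniscates into the disc of radius
  \<open>R + 2\<close>.\<close>

theorem compact_lemniscate_approximation:
  assumes R: "0 \<le> R" and \<mu>: "\<mu> \<in> prob_measures_on (cball 0 R)" and le: "\<And>z d. 0 < d \<Longrightarrow> rpot d \<mu> z \<le> 0"
  obtains K where "\<And>n. compact (K n)" "\<And>n. log_capacity (K n) = 1"
    "\<And>n. equilibrium_measure (K n) \<in> prob_measures_on (cball 0 (R + 2))"
    "wconv (\<lambda>n. equilibrium_measure (K n)) \<mu>"
proof -
  let ?B = "cball (0::complex) (R + 2)"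
  obtain m a where m: "\<And>n. 0 < m n" and a: "\<And>n i. a n i \<in> cball 0 R" and conv: "wconv (\<lambda>n. uniform_on (m n) (a n)) \<mu>"
    by (rule uniform_on_wconv[OF compact_cball \<mu>]) (rule that)
  define p where "p n = rootpoly (m n) (a n)" for n
  define K where "K n = {z. cmod (p n z) \<le> 1}" for n
  have K: "compact (K n)" for n unfolding K_def p_def using compact_lemniscate(1)[OF m, of 1] by simp
  have KB: "K n \<subseteq> ?B" for n
  proof
    fix z assume "z \<in> K n"
    hence "cmod z \<le> R + 1 + 1" unfolding K_def p_def using a
      by (intro lemniscate_bounded[OF m[of n], of "a n"]) auto
    thus "z \<in> ?B" by simp
  qed
  have eq: "log_capacity (K n) = 1" "equilibrium_measure (K n) \<in> prob_measures_on (K n)"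
    "0 < d \<Longrightarrow> rpot d (equilibrium_measure (K n)) z \<le> - ln (max (cmod (p n z)) 1) / m n"
    "cmod (p n z) \<noteq> 1 \<Longrightarrow> (\<And>d. 0 < d \<Longrightarrow> rpot d (equilibrium_measure (K n)) z \<le> c) \<Longrightarrow>
      - ln (max (cmod (p n z)) 1) / m n \<le> c" for n d z c
    unfolding K_def p_def by (rule lemniscate_equilibrium[OF m]; assumption)+
  define \<tau> where "\<tau> n = equilibrium_measure (K n)" for n
  define \<nu> where "\<nu> n = uniform_on (m n) (a n)" for n
  have \<tau>: "\<tau> n \<in> prob_measures_on ?B" for n
    unfolding \<tau>_def by (rule prob_measures_on_mono[OF eq(2) compact_imp_closed[OF K] closed_cball KB])
  have \<nu>: "\<nu> n \<in> prob_measures_on ?B" for n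
  proof -
    have "a n i \<in> ?B" for i using a[of n i] by simp
    thus ?thesis unfolding \<nu>_def by (intro uniform_on_prob_measures_on m closed_cball)
  qed
  have \<mu>B: "\<mu> \<in> prob_measures_on ?B" by (rule prob_measures_on_mono[OF \<mu> closed_cball closed_cball]) auto
  note PL = prob_measures_on_P_log[OF _ compact_cball]
  have main: "\<sigma> = \<mu>" if t: "strict_mono t" and \<sigma>: "\<sigma> \<in> prob_measures_on ?B" and w: "wconv (\<tau> \<circ> t) \<sigma>" for t \<sigma>
  proof -
    have w\<nu>: "wconv (\<nu> \<circ> t) \<mu>" using wconv_subseq[OF conv t] by (simp add: \<nu>_def[abs_def])
    have transfer: "rpot d M z \<le> c + 2 * e" if "rpot d M (z + of_real x) \<le> c + e" "\<bar>x\<bar> \<le> e * sqrt d" "M \<in> prob_measures_on ?B" "0 < d"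
      for M z x c d e
    proof -
      have "rpot d M z \<le> rpot d M (z + of_real x) + cmod (z - (z + of_real x)) / sqrt d"
        using rpot_lipschitz[OF PL[OF that(3)] that(4), of z "z + of_real x"] by linarith
      moreover have "cmod (z - (z + of_real x)) / sqrt d \<le> e" using that(2,4) by (simp add: pos_divide_le_eq)
      ultimately show ?thesis using that(1) by linarith
    qed
    \<comment> \<open>At a point near \<open>z\<close> where the root potential is at most
      \<open>c + e\<close>, the polynomial is at least \<open>exp (- m * (c + e))\<close> in
      modulus, and taking the maximum with 1 only lowers the potential; so the lemniscate potential
      is at most \<open>c + e\<close> there too.\<close>
    have up: "rpot d \<sigma> z \<le> c" if c: "\<And>d. 0 < d \<Longrightarrow> rpot d \<mu> z \<le> c" and d: "0 < d" for z c d
    proof (rule field_le_epsilon)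
      fix e' :: real assume "0 < e'"
      define e where "e = e' / 2"
      have e: "0 < e" "0 < e * sqrt d" using \<open>0 < e'\<close> d by (auto simp: e_def)
      have "eventually (\<lambda>n. \<exists>x. \<bar>x\<bar> \<le> e * sqrt d \<and> x \<notin> {} \<and> (\<forall>d>0. rpot d ((\<nu> \<circ> t) n) (z + of_real x) \<le> c + e)) sequentially"
        by (rule wconv_eventually_point[OF compact_cball _ \<mu>B w\<nu> c e]) (use \<nu> in auto)
      hence "eventually (\<lambda>n. rpot d ((\<tau> \<circ> t) n) z \<le> c + 2 * e) sequentially"
      proof eventually_elim
        case (elim n)
        then obtain x where x: "\<bar>x\<bar> \<le> e * sqrt d" "\<And>d. 0 < d \<Longrightarrow> rpot d (\<nu> (t n)) (z + of_real x) \<le> c + e" by auto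
        let ?y = "z + of_real x"
        have "exp (- (m (t n) * (c + e))) \<le> cmod (p (t n) ?y)"
          unfolding p_def by (rule rootpoly_ge_if_rpot_le[OF m]) (use x(2) in \<open>simp add: \<nu>_def\<close>)
        hence "exp (- (m (t n) * (c + e))) \<le> max (cmod (p (t n) ?y)) 1" by simp
        hence "- (m (t n) * (c + e)) \<le> ln (max (cmod (p (t n) ?y)) 1)" by (subst ln_ge_iff) auto
        hence "- ln (max (cmod (p (t n) ?y)) 1) / m (t n) \<le> c + e" using m[of "t n"] by (simp add: field_simps)
        moreover have "rpot d (\<tau> (t n)) ?y \<le> - ln (max (cmod (p (t n) ?y)) 1) / m (t n)" unfolding \<tau>_def by (rule eq(3)[OF d])
        ultimately have "rpot d (\<tau> (t n)) ?y \<le> c + e" by linarith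
        thus ?case using transfer[OF _ x(1) \<tau> d] by simp
      qed
      moreover have "(\<lambda>n. rpot d ((\<tau> \<circ> t) n) z) \<longlonglongrightarrow> rpot d \<sigma> z" by (rule wconv_rpot[OF w d])
      ultimately have "rpot d \<sigma> z \<le> c + 2 * e" by (intro tendsto_upperbound) auto
      thus "rpot d \<sigma> z \<le> c + e'" by (simp add: e_def)
    qed
    have down: "rpot d \<mu> z \<le> c" if c: "\<And>d. 0 < d \<Longrightarrow> rpot d \<sigma> z \<le> c" and d: "0 < d" for z c d
    proof (rule field_le_epsilon)
      fix e' :: real assume "0 < e'"
      define e where "e = e' / 2"
      have e: "0 < e" "0 < e * sqrt d" using \<open>0 < e'\<close> d by (auto simp: e_def)
      show "rpot d \<mu> z \<le> c + e'"
      \<comment> \<open>Nonpositivity of the potential of \<mu> enters here. If \<open>c + e\<close>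
        is negative, so is the lemniscate potential at the chosen point; hence the polynomial
        exceeds 1 in modulus there and the cutoff is inactive.\<close>
      proof (cases "0 \<le> c + e")
        case True thus ?thesis using le[OF d, of z] e by (simp add: e_def)
      next
        case False
        \<comment> \<open>The level curve is avoided because the lemniscate potential is identified
          only off it.\<close>
        have "eventually (\<lambda>n. \<exists>x. \<bar>x\<bar> \<le> e * sqrt d \<and> x \<notin> {x. cmod (p (t n) (z + of_real x)) = 1} \<and> (\<forall>d>0. rpot d ((\<tau> \<circ> t) n) (z + of_real x) \<le> c + e)) sequentially"
          by (rule wconv_eventually_point[OF compact_cball _ \<sigma> w c e])
            (use \<tau> finite_level_on_horizontal_line[OF m] in \<open>auto simp: p_def\<close>)
        hence "eventually (\<lambda>n. rpot d ((\<nu> \<circ> t) n) z \<le> c + 2 * e) sequentially"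
        proof eventually_elim
          case (elim n)
          then obtain x where x: "\<bar>x\<bar> \<le> e * sqrt d" "cmod (p (t n) (z + of_real x)) \<noteq> 1" "\<And>d. 0 < d \<Longrightarrow> rpot d (\<tau> (t n)) (z + of_real x) \<le> c + e" by auto
          let ?y = "z + of_real x"
          have 1: "- ln (max (cmod (p (t n) ?y)) 1) / m (t n) \<le> c + e"
            by (rule eq(4)[OF x(2)]) (use x(3) in \<open>simp add: \<tau>_def\<close>)
          have "1 < cmod (p (t n) ?y)"
          proof (rule ccontr)
            assume "\<not> ?thesis"
            hence "max (cmod (p (t n) ?y)) 1 = 1" by simp
            thus False using 1 False by simp
          qed
          hence "max (cmod (p (t n) ?y)) 1 = cmod (p (t n) ?y)" "p (t n) ?y \<noteq> 0" by auto
          hence "rpot d (\<nu> (t n)) ?y \<le> c + e"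
            using 1 rpot_uniform_on_le[OF m[of "t n"] d, of "a (t n)" ?y] by (simp add: \<nu>_def p_def)
          thus ?case using transfer[OF _ x(1) \<nu> d] by simp
        qed
        moreover have "(\<lambda>n. rpot d ((\<nu> \<circ> t) n) z) \<longlonglongrightarrow> rpot d \<mu> z" by (rule wconv_rpot[OF w\<nu> d])
        ultimately have "rpot d \<mu> z \<le> c + 2 * e" by (intro tendsto_upperbound) auto
        thus ?thesis by (simp add: e_def)
      qed
    qed
    have \<sigma>0: "rpot d \<sigma> z \<le> 0" if "0 < d" for d z by (rule up[OF le that])
    show "\<sigma> = \<mu>" by (rule prob_measures_on_eq_if_potentials_eq[OF \<sigma> \<mu>B \<sigma>0 le down up])
  qed
  have "wconv \<tau> \<mu>"
    unfolding wconv_def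
  proof (intro allI impI LIMSEQ_if_subsubseq)
    fix f :: "complex \<Rightarrow> real" and r :: "nat \<Rightarrow> nat" assume f: "continuous_on UNIV f" and r: "strict_mono r"
    have "(\<tau> \<circ> r) n \<in> prob_measures_on ?B" for n using \<tau> by simp
    from prob_measures_on_wconv_compact[OF compact_cball this]
    obtain s \<sigma> where s: "strict_mono (s :: nat \<Rightarrow> nat)" and \<sigma>: "\<sigma> \<in> prob_measures_on ?B" and w: "wconv (\<tau> \<circ> r \<circ> s) \<sigma>" .
    have "\<sigma> = \<mu>" by (rule main[OF strict_mono_o[OF r s] \<sigma>]) (use w in \<open>simp add: comp_assoc\<close>)
    thus "\<exists>s. strict_mono s \<and> ((\<lambda>n. \<integral>w. f w \<partial>\<tau> n) \<circ> r \<circ> s) \<longlonglongrightarrow> (\<integral>w. f w \<partial>\<mu>)"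
      using s wconvD[OF w f] by (auto simp: comp_def)
  qed
  thus ?thesis using that[of K] K eq(1) \<tau> unfolding \<tau>_def[abs_def] by auto
qed

section \<open>Log-weak approximation\<close>

lemma continuous_on_log_plus [continuous_intros]:
  assumes "continuous_on A f"
  shows "continuous_on A (\<lambda>x. log_plus (cmod (f x)))"
proof -
  have "continuous_on A (\<lambda>x. ln (max 1 (cmod (f x))))" by (intro continuous_intros assms) auto
  thus ?thesis by (simp add: log_plus_alt)
qed

lemma log_plus_mult_le:
  assumes "1 \<le> s" "0 \<le> x"
  shows "log_plus (s * x) \<le> ln s + log_plus x"
proof -
  have "1 * 1 \<le> s * max 1 x" using assms by (intro mult_mono) auto
  moreover have "s * x \<le> s * max 1 x" using assms by (intro mult_left_mono) auto
  ultimately have "max 1 (s * x) \<le> s * max 1 x" by simp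
  hence "ln (max 1 (s * x)) \<le> ln (s * max 1 x)" by (intro ln_mono) auto
  also have "\<dots> = ln s + ln (max 1 x)" using assms by (intro ln_mult_pos) auto
  finally show ?thesis using assms by (simp add: log_plus_alt)
qed

definition cutoff :: "nat \<Rightarrow> complex \<Rightarrow> real" where
  "cutoff M w = max 0 (min 1 (real M + 1 - cmod w))"

lemma cutoff_bounds: "0 \<le> cutoff M w" "cutoff M w \<le> 1"
  by (auto simp: cutoff_def)

lemma cutoff_eq_1: "cmod w \<le> real M \<Longrightarrow> cutoff M w = 1"
  by (simp add: cutoff_def)

lemma cutoff_eq_0: "real M + 1 \<le> cmod w \<Longrightarrow> cutoff M w = 0"
  by (simp add: cutoff_def)

lemma continuous_on_cutoff [continuous_intros]: "continuous_on A f \<Longrightarrow> continuous_on A (\<lambda>x. cutoff M (f x))"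
  unfolding cutoff_def by (intro continuous_intros)

lemma integrable_cutoff_mult:
  assumes \<mu>: "\<mu> \<in> P_log" and f: "continuous_on UNIV f"
  shows "integrable \<mu> (\<lambda>w. cutoff M w * f w)"
proof -
  have "compact (f ` cball 0 (real M + 1))" by (intro compact_continuous_image continuous_on_subset[OF f]) auto
  then obtain B where B: "0 < B" "\<forall>y \<in> f ` cball 0 (real M + 1). norm y \<le> B" using compact_imp_bounded bounded_pos by metis
  have "\<bar>cutoff M w * f w\<bar> \<le> B + 0 * log_plus (cmod w)" for w
  proof (cases "cmod w \<le> real M + 1")
    case True
    hence "\<bar>f w\<bar> \<le> B" using B(2) by simp
    hence "\<bar>cutoff M w\<bar> * \<bar>f w\<bar> \<le> 1 * B" using cutoff_bounds[of M w] by (intro mult_mono) auto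
    thus ?thesis by (simp add: abs_mult)
  qed (use B(1) cutoff_eq_0[of M w] in simp)
  moreover have "(\<lambda>w. cutoff M w * f w) \<in> borel_measurable borel"
    by (intro borel_measurable_continuous_UNIV continuous_intros f)
  ultimately show ?thesis using integrable_log_growth[OF \<mu>] by blast
qed

text \<open>The cutoff vanishes outside the disc of radius \<open>M + 1\<close>, on which
  \<open>f\<close> is uniformly close to a polynomial.\<close>

lemma cutoff_limit:
  assumes \<mu>: "\<mu> \<in> P_log"
    and \<tau>: "\<And>n. \<tau> n \<in> P_log"
    and mono: "\<And>M j k. (\<lambda>n. \<integral>w. cutoff M w * (Re w ^ j * Im w ^ k) \<partial>\<tau> n) \<longlonglongrightarrow> (\<integral>w. cutoff M w * (Re w ^ j * Im w ^ k) \<partial>\<mu>)"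
    and f: "continuous_on UNIV f"
  shows "(\<lambda>n. \<integral>w. cutoff M w * f w \<partial>\<tau> n) \<longlonglongrightarrow> (\<integral>w. cutoff M w * f w \<partial>\<mu>)"
proof -
  have poly: "(\<lambda>n. \<integral>w. cutoff M w * q w \<partial>\<tau> n) \<longlonglongrightarrow> (\<integral>w. cutoff M w * q w \<partial>\<mu>)" if "polyfun q" for q
    using that
  proof induction
    case (monom c j k)
    have "(\<integral>w. cutoff M w * (c * (Re w ^ j * Im w ^ k)) \<partial>N) = c * (\<integral>w. cutoff M w * (Re w ^ j * Im w ^ k) \<partial>N)" for N :: "complex measure"
      unfolding mult.left_commute[of "cutoff M _" c] by (rule integral_mult_right_zero)
    thus ?case by (simp only:) (intro tendsto_intros mono)
  next
    case (add g h)
    have "integrable N (\<lambda>w. cutoff M w * g w)" "integrable N (\<lambda>w. cutoff M w * h w)" if "N \<in> P_log" for N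
      by (intro integrable_cutoff_mult[OF that] polyfun_continuous add.hyps)+
    thus ?case using tendsto_add[OF add.IH] \<tau> \<mu> by (simp add: distrib_left)
  qed
  show ?thesis
  proof (rule LIMSEQ_I)
    fix e :: real assume e: "0 < e"
    obtain q where q: "polyfun q" "\<And>w. w \<in> cball 0 (real M + 1) \<Longrightarrow> \<bar>f w - q w\<bar> < e / 4"
    proof (rule polyfun_dense[OF compact_cball])
      show "continuous_on (cball 0 (real M + 1)) f" using f by (rule continuous_on_subset) simp
      show "0 < e / 4" using e by simp
    qed (rule that)
    have *: "\<bar>(\<integral>w. cutoff M w * f w \<partial>N) - (\<integral>w. cutoff M w * q w \<partial>N)\<bar> \<le> e / 4" if N: "N \<in> P_log" for N
    proof -
      interpret prob_space N by (rule P_logD[OF N])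
      have i: "integrable N (\<lambda>w. cutoff M w * f w)" "integrable N (\<lambda>w. cutoff M w * q w)"
        by (intro integrable_cutoff_mult[OF N] f polyfun_continuous q)+
      have pt: "\<bar>cutoff M w * f w - cutoff M w * q w\<bar> \<le> e / 4" for w
      proof (cases "cmod w \<le> real M + 1")
        case True
        hence "\<bar>cutoff M w\<bar> * \<bar>f w - q w\<bar> \<le> 1 * (e / 4)" using q(2)[of w] cutoff_bounds[of M w] by (intro mult_mono) auto
        thus ?thesis by (simp add: abs_mult[symmetric] right_diff_distrib)
      qed (use e cutoff_eq_0[of M w] in simp)
      have "\<bar>(\<integral>w. cutoff M w * f w \<partial>N) - (\<integral>w. cutoff M w * q w \<partial>N)\<bar> = \<bar>\<integral>w. cutoff M w * f w - cutoff M w * q w \<partial>N\<bar>" using i by simp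
      also have "\<dots> \<le> (\<integral>w. \<bar>cutoff M w * f w - cutoff M w * q w\<bar> \<partial>N)" by (rule integral_abs_bound)
      also have "\<dots> \<le> e / 4" using i pt by (intro integral_le_const) auto
      finally show ?thesis .
    qed
    obtain n0 where n0: "\<And>n. n \<ge> n0 \<Longrightarrow> \<bar>(\<integral>w. cutoff M w * q w \<partial>\<tau> n) - (\<integral>w. cutoff M w * q w \<partial>\<mu>)\<bar> < e / 4"
      using LIMSEQ_D[OF poly[OF q(1)], of "e / 4"] e by auto
    have "\<bar>(\<integral>w. cutoff M w * f w \<partial>\<tau> n) - (\<integral>w. cutoff M w * f w \<partial>\<mu>)\<bar> < e" if "n \<ge> n0" for n
      using *[OF \<tau>[of n]] *[OF \<mu>] n0[OF that] e by linarith
    thus "\<exists>no. \<forall>n\<ge>no. norm ((\<integral>w. cutoff M w * f w \<partial>\<tau> n) - (\<integral>w. cutoff M w * f w \<partial>\<mu>)) < e" by auto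
  qed
qed

text \<open>Log-weak convergence is reduced to countably many test functions, as a diagonal argument
  requires. Convergence of the \<open>log_plus\<close> integrals together with that of truncated
  integrals makes the tails of the growth bound small for all large \<open>n\<close>, so no
  logarithmic mass escapes to infinity.\<close>

theorem log_weakly_convergesI:
  assumes \<mu>: "\<mu> \<in> P_log" and \<tau>: "\<And>n. \<tau> n \<in> P_log"
    and mono: "\<And>M j k. (\<lambda>n. \<integral>w. cutoff M w * (Re w ^ j * Im w ^ k) \<partial>\<tau> n) \<longlonglongrightarrow> (\<integral>w. cutoff M w * (Re w ^ j * Im w ^ k) \<partial>\<mu>)"
    and L: "(\<lambda>n. \<integral>w. log_plus (cmod w) \<partial>\<tau> n) \<longlonglongrightarrow> (\<integral>w. log_plus (cmod w) \<partial>\<mu>)"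
  shows "log_weakly_converges \<tau> \<mu>"
  unfolding log_weakly_converges_def
proof (intro conjI allI impI \<mu> \<tau>)
  fix f :: "complex \<Rightarrow> real" assume f: "continuous_on UNIV f" and ex: "\<exists>A B. \<forall>z. \<bar>f z\<bar> \<le> A + B * log_plus (cmod z)"
  obtain A B where AB: "\<And>z. \<bar>f z\<bar> \<le> A + B * log_plus (cmod z)" using ex by blast
  define g where "g z = A + B * log_plus (cmod z)" for z
  have fg: "\<bar>f z\<bar> \<le> g z" for z using AB by (simp add: g_def)
  have gc: "continuous_on UNIV g" unfolding g_def by (intro continuous_intros)
  have cv: "(\<lambda>n. \<integral>w. cutoff M w * h w \<partial>\<tau> n) \<longlonglongrightarrow> (\<integral>w. cutoff M w * h w \<partial>\<mu>)" if "continuous_on UNIV h" for M h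
    by (rule cutoff_limit[OF \<mu> \<tau> mono that])
  have fi: "integrable N f" if "N \<in> P_log" for N by (rule integrable_log_growth[OF that borel_measurable_continuous_UNIV[OF f] AB])
  have gi: "integrable N g" if N: "N \<in> P_log" for N
  proof -
    interpret prob_space N by (rule P_logD[OF N])
    show ?thesis unfolding g_def using P_logD(4)[OF N] by simp
  qed
  have glim: "(\<lambda>n. \<integral>w. g w \<partial>\<tau> n) \<longlonglongrightarrow> (\<integral>w. g w \<partial>\<mu>)"
  proof -
    have "(\<integral>w. g w \<partial>N) = A + B * (\<integral>w. log_plus (cmod w) \<partial>N)" if N: "N \<in> P_log" for N
    proof -
      interpret prob_space N by (rule P_logD[OF N])
      show ?thesis unfolding g_def using P_logD(4)[OF N] by (simp add: prob_space)
    qed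
    thus ?thesis using \<tau> \<mu> by (simp only:) (intro tendsto_intros L)
  qed
  \<comment> \<open>The part of the integral of the growth bound \<open>g\<close> lost by the
    cutoff; it dominates the loss for \<open>f\<close>.\<close>
  define D where "D N M = (\<integral>w. g w \<partial>N) - (\<integral>w. cutoff M w * g w \<partial>N)" for N M
  have tail: "\<bar>(\<integral>w. f w \<partial>N) - (\<integral>w. cutoff M w * f w \<partial>N)\<bar> \<le> D N M" if N: "N \<in> P_log" for N M
  proof -
    note i = fi[OF N] gi[OF N] integrable_cutoff_mult[OF N f, of M] integrable_cutoff_mult[OF N gc, of M]
    have "\<bar>(\<integral>w. f w \<partial>N) - (\<integral>w. cutoff M w * f w \<partial>N)\<bar> = \<bar>\<integral>w. f w - cutoff M w * f w \<partial>N\<bar>" using i by simp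
    also have "\<dots> \<le> (\<integral>w. \<bar>f w - cutoff M w * f w\<bar> \<partial>N)" by (rule integral_abs_bound)
    also have "\<dots> \<le> (\<integral>w. g w - cutoff M w * g w \<partial>N)"
    proof (rule integral_mono)
      fix w
      have "f w - cutoff M w * f w = (1 - cutoff M w) * f w" by (simp add: left_diff_distrib)
      hence "\<bar>f w - cutoff M w * f w\<bar> = (1 - cutoff M w) * \<bar>f w\<bar>" using cutoff_bounds[of M w] by (simp add: abs_mult)
      also have "\<dots> \<le> (1 - cutoff M w) * g w" using cutoff_bounds[of M w] fg by (intro mult_left_mono) auto
      finally show "\<bar>f w - cutoff M w * f w\<bar> \<le> g w - cutoff M w * g w" by (simp add: left_diff_distrib)
    qed (use i in auto)
    also have "\<dots> = D N M" unfolding D_def using i by simp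
    finally show ?thesis .
  qed
  have "(\<lambda>M. \<integral>w. cutoff M w * g w \<partial>\<mu>) \<longlonglongrightarrow> (\<integral>w. g w \<partial>\<mu>)"
  proof (rule integral_dominated_convergence[OF _ _ integrable_abs[OF gi[OF \<mu>]]])
    show "g \<in> borel_measurable \<mu>" "(\<lambda>w. cutoff M w * g w) \<in> borel_measurable \<mu>" for M
      by (intro P_log_measurable[OF \<mu>] borel_measurable_continuous_UNIV continuous_intros gc)+
    show "AE w in \<mu>. (\<lambda>M. cutoff M w * g w) \<longlonglongrightarrow> g w"
    proof (rule AE_I2)
      fix w
      obtain m :: nat where "cmod w \<le> m" using real_arch_simple by blast
      hence "cutoff M w * g w = g w" if "M \<ge> m" for M using that by (subst cutoff_eq_1) auto
      thus "(\<lambda>M. cutoff M w * g w) \<longlonglongrightarrow> g w" by (intro tendsto_eventually eventually_sequentiallyI[of m])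
    qed
    show "AE w in \<mu>. norm (cutoff M w * g w) \<le> \<bar>g w\<bar>" for M
      using cutoff_bounds[of M] by (intro AE_I2) (simp add: abs_mult mult_left_le_one_le)
  qed
  from tendsto_diff[OF tendsto_const this, of "\<integral>w. g w \<partial>\<mu>"]
  have Dlim: "(\<lambda>M. D \<mu> M) \<longlonglongrightarrow> 0" unfolding D_def by simp
  show "(\<lambda>n. integral\<^sup>L (\<tau> n) f) \<longlonglongrightarrow> integral\<^sup>L \<mu> f"
  proof (rule LIMSEQ_I)
    fix e :: real assume e: "0 < e"
    have "eventually (\<lambda>M. D \<mu> M < e / 4) sequentially" by (rule order_tendstoD(2)[OF Dlim]) (use e in simp)
    then obtain M where M: "D \<mu> M < e / 4" by (auto simp: eventually_sequentially)
    have "(\<lambda>n. D (\<tau> n) M) \<longlonglongrightarrow> D \<mu> M" unfolding D_def by (intro tendsto_diff glim cv gc)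
    hence "eventually (\<lambda>n. D (\<tau> n) M < e / 4) sequentially" using M by (rule order_tendstoD(2))
    moreover have "eventually (\<lambda>n. \<bar>(\<integral>w. cutoff M w * f w \<partial>\<tau> n) - (\<integral>w. cutoff M w * f w \<partial>\<mu>)\<bar> < e / 4) sequentially"
      using tendstoD[OF cv[OF f, of M], of "e / 4"] e by (simp add: dist_real_def)
    ultimately have "eventually (\<lambda>n. norm (integral\<^sup>L (\<tau> n) f - integral\<^sup>L \<mu> f) < e) sequentially"
    proof eventually_elim
      case (elim n)
      show ?case unfolding real_norm_def using elim M tail[OF \<tau>[of n], of M] tail[OF \<mu>, of M] e by linarith
    qed
    thus "\<exists>no. \<forall>n\<ge>no. norm (integral\<^sup>L (\<tau> n) f - integral\<^sup>L \<mu> f) < e" by (simp add: eventually_sequentially)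
  qed
qed

section \<open>Conditioning on a disc and dilating\<close>

definition cond_dilate :: "complex measure \<Rightarrow> real \<Rightarrow> real \<Rightarrow> complex measure" where
  "cond_dilate \<mu> R s = distr (density \<mu> (\<lambda>w. ennreal (indicator (cball 0 R) w / measure \<mu> (cball 0 R)))) borel (\<lambda>w. of_real s * w)"

lemma cond_dilate_integral:
  fixes f :: "complex \<Rightarrow> real"
  assumes \<mu>: "\<mu> \<in> P_log" and f: "f \<in> borel_measurable borel"
  shows "(\<integral>w. f w \<partial>cond_dilate \<mu> R s) = (\<integral>w. indicator (cball 0 R) w * f (of_real s * w) \<partial>\<mu>) / measure \<mu> (cball 0 R)"
proof -
  note [measurable_cong] = P_logD(2)[OF \<mu>]
  note [measurable] = f
  have cs: "cball 0 R \<in> sets \<mu>" by (simp add: P_logD(2)[OF \<mu>])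
  have dm: "(\<lambda>w. indicator (cball 0 R) w / measure \<mu> (cball 0 R)) \<in> borel_measurable \<mu>"
    by (intro borel_measurable_divide borel_measurable_indicator cs borel_measurable_const)
  have "(\<integral>w. f w \<partial>cond_dilate \<mu> R s) = (\<integral>w. (indicator (cball 0 R) w / measure \<mu> (cball 0 R)) *\<^sub>R f (of_real s * w) \<partial>\<mu>)"
    unfolding cond_dilate_def by (subst integral_distr, measurable, subst integral_density) (use dm in auto)
  also have "\<dots> = (\<integral>w. indicator (cball 0 R) w * f (of_real s * w) / measure \<mu> (cball 0 R) \<partial>\<mu>)"
    by (intro Bochner_Integration.integral_cong) auto
  also have "\<dots> = (\<integral>w. indicator (cball 0 R) w * f (of_real s * w) \<partial>\<mu>) / measure \<mu> (cball 0 R)"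
    by (rule integral_divide_zero)
  finally show ?thesis .
qed

lemma cond_dilate_prob_measures_on:
  assumes \<mu>: "\<mu> \<in> P_log" and p: "0 < measure \<mu> (cball 0 R)" and s: "0 \<le> s"
  shows "cond_dilate \<mu> R s \<in> prob_measures_on (cball 0 (s * R))"
proof (rule prob_measures_onI)
  interpret prob_space \<mu> by (rule P_logD[OF \<mu>])
  note [measurable_cong] = P_logD(2)[OF \<mu>]
  have cs[measurable]: "cball 0 R \<in> sets \<mu>" by (simp add: P_logD(2)[OF \<mu>])
  let ?d = "density \<mu> (\<lambda>w. ennreal (indicator (cball 0 R) w / measure \<mu> (cball 0 R)))"
  have dm: "(\<lambda>w. indicator (cball 0 R) w / measure \<mu> (cball 0 R)) \<in> borel_measurable \<mu>"
    by (intro borel_measurable_divide borel_measurable_indicator cs borel_measurable_const)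
  have dm': "(\<lambda>w. ennreal (indicator (cball 0 R) w / measure \<mu> (cball 0 R))) \<in> borel_measurable \<mu>"
    by (rule measurable_compose[OF dm measurable_ennreal])
  have "prob_space ?d"
  proof (rule prob_spaceI)
    have "emeasure ?d (space ?d) = (\<integral>\<^sup>+w. ennreal (indicator (cball 0 R) w / measure \<mu> (cball 0 R)) \<partial>\<mu>)"
      using dm' by (subst emeasure_density) (auto intro!: nn_integral_cong)
    also have "\<dots> = ennreal (\<integral>w. indicator (cball 0 R) w / measure \<mu> (cball 0 R) \<partial>\<mu>)"
      using cs by (intro nn_integral_eq_integral integrable_divide_zero integrable_real_indicator) (auto simp: emeasure_eq_measure)
    also have "(\<integral>w. indicator (cball 0 R) w / measure \<mu> (cball 0 R) \<partial>\<mu>) = 1" using p cs by simp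
    finally show "emeasure ?d (space ?d) = 1" by simp
  qed
  thus "prob_space (cond_dilate \<mu> R s)" unfolding cond_dilate_def by (rule prob_space.prob_space_distr) simp
  have "AE w in \<mu>. 0 < ennreal (indicator (cball 0 R) w / measure \<mu> (cball 0 R)) \<longrightarrow> of_real s * w \<in> cball 0 (s * R)"
    using s by (intro AE_I2) (auto simp: indicator_def norm_mult mult_left_mono)
  thus "AE w in cond_dilate \<mu> R s. w \<in> cball 0 (s * R)"
    unfolding cond_dilate_def by (subst AE_distr_iff) (auto simp: AE_density)
qed (auto simp: cond_dilate_def)

text \<open>Conditioning raises the potential by at most the logarithmic tail, which the dilation compensates.\<close>

lemma cond_dilate_rpot_le:
  assumes \<mu>: "\<mu> \<in> P_log" and p: "0 < measure \<mu> (cball 0 R)" and R: "1 \<le> R"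
    and le: "\<And>z d. 0 < d \<Longrightarrow> rpot d \<mu> z \<le> 0" and d: "0 < d"
    and \<epsilon>: "(\<integral>w. indicator (- cball 0 R) w * (ln 4 + log_plus (cmod w)) \<partial>\<mu>) / measure \<mu> (cball 0 R) \<le> \<epsilon>"
  shows "rpot d (cond_dilate \<mu> R (exp \<epsilon>)) z \<le> 0"
proof -
  interpret prob_space \<mu> by (rule P_logD[OF \<mu>])
  let ?c = "cball (0::complex) R"
  let ?p = "measure \<mu> ?c"
  have cs: "?c \<in> sets \<mu>" "- ?c \<in> sets \<mu>" by (auto simp: P_logD(2)[OF \<mu>])
  have tail_int: "integrable \<mu> (\<lambda>w. indicator (- ?c) w * (ln 4 + log_plus (cmod w)))"
    using cs P_logD(4)[OF \<mu>] by (subst mult.commute, intro integrable_real_mult_indicator) auto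
  have "0 \<le> (\<integral>w. indicator (- ?c) w * (ln 4 + log_plus (cmod w)) \<partial>\<mu>)"
    using log_plus_nonneg by (intro Bochner_Integration.integral_nonneg) (auto simp: indicator_def add_nonneg_nonneg)
  hence e0: "0 \<le> \<epsilon>" using \<epsilon> p by (meson divide_nonneg_pos order_trans)
  define s where "s = exp \<epsilon>"
  have s: "1 \<le> s" "0 < s" using e0 by (auto simp: s_def)
  \<comment> \<open>Capping at 1 keeps \<open>d' \<le> 1\<close> for the tail estimate; by
    antimonotonicity a bound for \<open>d0\<close> covers \<open>d\<close>.\<close>
  define d0 where "d0 = min d 1"
  have d0: "0 < d0" "d0 \<le> d" "d0 \<le> 1" using d by (auto simp: d0_def)
  define d' where "d' = d0 / s\<^sup>2"
  define z' where "z' = z / of_real s"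
  have d': "0 < d'" "d' \<le> 1" using d0 s by (auto simp: d'_def divide_le_eq intro: order_trans[OF d0(3)])
  \<comment> \<open>Dilation by \<open>exp \<epsilon>\<close> lowers the kernel by exactly
    \<epsilon>, up to rescaling the regularisation and \<open>z\<close>.\<close>
  have lk: "lker d0 (of_real s * w) z = - \<epsilon> + lker d' w z'" for w
  proof -
    have "of_real s * w - z = of_real s * (w - z')" using s by (simp add: z'_def right_diff_distrib)
    hence "(cmod (of_real s * w - z))\<^sup>2 + d0 = s\<^sup>2 * ((cmod (w - z'))\<^sup>2 + d')"
      using s by (simp add: norm_mult power_mult_distrib distrib_left d'_def)
    moreover have "ln (s\<^sup>2 * ((cmod (w - z'))\<^sup>2 + d')) = 2 * \<epsilon> + ln ((cmod (w - z'))\<^sup>2 + d')"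
      using s cmod_sq_add_pos[OF d'(1), of "w - z'"] by (simp add: ln_mult_pos ln_realpow s_def)
    ultimately show ?thesis by (simp add: lker_def)
  qed
  have il: "integrable \<mu> (\<lambda>w. lker d' w z')" by (rule integrable_lker[OF \<mu> d'(1)])
  have i1: "integrable \<mu> (\<lambda>w. indicator ?c w * lker d' w z')" "integrable \<mu> (\<lambda>w. indicator (- ?c) w * lker d' w z')"
    by (subst mult.commute, intro integrable_real_mult_indicator cs il)+
  have key: "(\<integral>w. indicator ?c w * lker d' w z' \<partial>\<mu>) \<le> \<epsilon> * ?p"
  \<comment> \<open>For \<open>z'\<close> within \<open>2 * R\<close>, the integral over the disc is
    at most minus that over the complement, since the whole is nonpositive. For \<open>z'\<close>
    farther out, all points of the disc have distance at least \<open>R \<ge> 1\<close> from it, so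
    the kernel is nonpositive there.\<close>
  proof (cases "cmod z' \<le> 2 * R")
    case True
    have "(\<integral>w. indicator ?c w * lker d' w z' \<partial>\<mu>) + (\<integral>w. indicator (- ?c) w * lker d' w z' \<partial>\<mu>) = (\<integral>w. indicator ?c w * lker d' w z' + indicator (- ?c) w * lker d' w z' \<partial>\<mu>)"
      using i1 by simp
    also have "\<dots> = rpot d' \<mu> z'" unfolding rpot_def by (intro Bochner_Integration.integral_cong) (auto simp: indicator_def)
    also have "\<dots> \<le> 0" by (rule le[OF d'(1)])
    finally have "(\<integral>w. indicator ?c w * lker d' w z' \<partial>\<mu>) \<le> (\<integral>w. - (indicator (- ?c) w * lker d' w z') \<partial>\<mu>)" using i1 by simp
    also have "\<dots> \<le> (\<integral>w. indicator (- ?c) w * (ln 4 + log_plus (cmod w)) \<partial>\<mu>)"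
    proof (rule integral_mono)
      fix w
      show "- (indicator (- ?c) w * lker d' w z') \<le> indicator (- ?c) w * (ln 4 + log_plus (cmod w))"
      proof (cases "w \<in> ?c")
        case False
        hence w: "R < cmod w" by simp
        have "cmod (w - z') \<le> cmod w + 2 * R" using norm_triangle_ineq4[of w z'] True by linarith
        hence "(cmod (w - z'))\<^sup>2 + d' \<le> (cmod w + 2 * R)\<^sup>2 + 1" using d'(2) by (intro add_mono power_mono) auto
        also have "\<dots> \<le> (cmod w + 2 * R + 1)\<^sup>2" using R by (simp add: power2_sum)
        \<comment> \<open>Outside the disc both \<open>R\<close> and 1 are at most
          \<open>cmod w\<close>; this is the source of \<open>ln 4\<close>.\<close>
        also have "\<dots> \<le> (4 * cmod w)\<^sup>2" using w R by (intro power_mono) auto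
        finally have "ln ((cmod (w - z'))\<^sup>2 + d') \<le> ln ((4 * cmod w)\<^sup>2)"
          using cmod_sq_add_pos[OF d'(1), of "w - z'"] by (simp add: ln_mono)
        also have "\<dots> = 2 * ln (4 * cmod w)" using w R by (subst ln_realpow) auto
        also have "ln (4 * cmod w) = ln 4 + ln (cmod w)" using w R by (intro ln_mult_pos) auto
        also have "ln (cmod w) \<le> log_plus (cmod w)" by (simp add: log_plus_def)
        finally have "- lker d' w z' \<le> ln 4 + log_plus (cmod w)" by (simp add: lker_def)
        thus ?thesis using False by simp
      qed simp
    qed (use i1 tail_int in auto)
    also have "\<dots> \<le> \<epsilon> * ?p" using \<epsilon> p by (simp add: divide_le_eq)
    finally show ?thesis .
  next
    case False
    have "(\<integral>w. indicator ?c w * lker d' w z' \<partial>\<mu>) \<le> (\<integral>w. 0 \<partial>\<mu>)"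
    proof (rule integral_mono)
      fix w
      show "indicator ?c w * lker d' w z' \<le> 0"
      proof (cases "w \<in> ?c")
        case True
        have "R \<le> cmod (w - z')" using norm_triangle_ineq3[of z' w] True False by (simp add: norm_minus_commute)
        hence "lker d' w z' \<le> - ln R" using R by (intro lker_le_neg_ln[OF d'(1)]) auto
        also have "\<dots> \<le> 0" using R by simp
        finally show ?thesis using True by simp
      qed simp
    qed (use i1 in auto)
    also have "(\<integral>w. 0 \<partial>\<mu>) \<le> \<epsilon> * ?p" using e0 p by simp
    finally show ?thesis .
  qed
  have P: "cond_dilate \<mu> R s \<in> P_log"
    by (rule prob_measures_on_P_log[OF cond_dilate_prob_measures_on[OF \<mu> p less_imp_le[OF s(2)]] compact_cball])
  have "rpot d (cond_dilate \<mu> R s) z \<le> rpot d0 (cond_dilate \<mu> R s) z" by (rule rpot_antimono[OF P d0(1,2)])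
  also have "\<dots> = (\<integral>w. indicator ?c w * lker d0 (of_real s * w) z \<partial>\<mu>) / ?p"
    unfolding rpot_def by (rule cond_dilate_integral[OF \<mu>]) measurable
  also have "(\<integral>w. indicator ?c w * lker d0 (of_real s * w) z \<partial>\<mu>) = (\<integral>w. indicator ?c w * lker d' w z' - \<epsilon> * indicator ?c w \<partial>\<mu>)"
    unfolding lk by (intro Bochner_Integration.integral_cong) (auto simp: algebra_simps)
  also have "\<dots> = (\<integral>w. indicator ?c w * lker d' w z' \<partial>\<mu>) - \<epsilon> * ?p"
    using i1 cs by (subst Bochner_Integration.integral_diff) (auto simp: emeasure_eq_measure)
  also have "\<dots> / ?p \<le> 0" using key p by (simp add: divide_le_0_iff)
  finally show ?thesis by (simp add: s_def)
qed

text \<open>The exponent of the dilation is the logarithmic tail divided by the mass of the disc,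
  just what keeps the potential nonpositive. It tends to 0, and the mass tends to 1, so conditioning
  and dilation disappear in the limit.\<close>

theorem compact_approximation:
  assumes \<mu>: "\<mu> \<in> P_log" and le: "\<And>z d. 0 < d \<Longrightarrow> rpot d \<mu> z \<le> 0"
  obtains \<mu>s :: "nat \<Rightarrow> complex measure" and R where "\<And>n. 0 \<le> R n" "\<And>n. \<mu>s n \<in> prob_measures_on (cball 0 (R n))"
    "\<And>n z d. 0 < d \<Longrightarrow> rpot d (\<mu>s n) z \<le> 0"
    "\<And>f A B. continuous_on UNIV f \<Longrightarrow> (\<And>z. \<bar>f z\<bar> \<le> A + B * log_plus (cmod z)) \<Longrightarrow>
      (\<lambda>n. \<integral>w. (f w :: real) \<partial>\<mu>s n) \<longlonglongrightarrow> (\<integral>w. f w \<partial>\<mu>)"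
proof -
  interpret prob_space \<mu> by (rule P_logD[OF \<mu>])
  have cs: "cball 0 r \<in> sets \<mu>" "- cball 0 r \<in> sets \<mu>" for r :: real by (auto simp: P_logD(2)[OF \<mu>])
  define p where "p n = measure \<mu> (cball 0 (real n))" for n
  define T where "T n = (\<integral>w. indicator (- cball 0 (real n)) w * (ln 4 + log_plus (cmod w)) \<partial>\<mu>)" for n
  have ind: "eventually (\<lambda>n. w \<in> cball 0 (real n)) sequentially" for w :: complex
  proof -
    obtain m :: nat where "cmod w \<le> m" using real_arch_simple by blast
    thus ?thesis by (intro eventually_sequentiallyI[of m]) auto
  qed
  have ind1: "eventually (\<lambda>n. indicat_real (cball 0 (real n)) w = 1) sequentially" for w :: complex
    using ind[of w] by (rule eventually_mono) simp
  have ind0: "eventually (\<lambda>n. indicat_real (- cball 0 (real n)) w * c = 0) sequentially" for w :: complex and c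
    using ind[of w] by (rule eventually_mono) simp
  have "(\<lambda>n. \<integral>w. indicator (cball 0 (real n)) w \<partial>\<mu>) \<longlonglongrightarrow> (\<integral>w. (1::real) \<partial>\<mu>)"
  proof (rule integral_dominated_convergence[where w = "\<lambda>_. 1"])
    show "AE w in \<mu>. (\<lambda>n. indicat_real (cball 0 (real n)) w) \<longlonglongrightarrow> 1"
      by (intro AE_I2 tendsto_eventually ind1)
  qed (use cs in auto)
  hence p1: "p \<longlonglongrightarrow> 1" using cs by (simp add: p_def[abs_def] prob_space)
  have gI: "integrable \<mu> (\<lambda>w. ln 4 + log_plus (cmod w))" using P_logD(4)[OF \<mu>] by simp
  have "T \<longlonglongrightarrow> (\<integral>w. 0 \<partial>\<mu>)"
    unfolding T_def[abs_def]
  proof (rule integral_dominated_convergence[where w = "\<lambda>w. ln 4 + log_plus (cmod w)"])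
    show "AE w in \<mu>. (\<lambda>n. indicator (- cball 0 (real n)) w * (ln 4 + log_plus (cmod w))) \<longlonglongrightarrow> 0"
      by (intro AE_I2 tendsto_eventually ind0)
    show "AE w in \<mu>. norm (indicator (- cball 0 (real n)) w * (ln 4 + log_plus (cmod w))) \<le> ln 4 + log_plus (cmod w)" for n
      using log_plus_nonneg by (intro AE_I2) (auto simp: indicator_def add_nonneg_nonneg)
    show "(\<lambda>w. indicator (- cball 0 (real n)) w * (ln 4 + log_plus (cmod w))) \<in> borel_measurable \<mu>" for n
      using cs gI by (intro borel_measurable_times borel_measurable_indicator) auto
  qed (use gI in auto)
  hence T0: "T \<longlonglongrightarrow> 0" by simp
  define \<epsilon> where "\<epsilon> n = T n / p n" for n
  have \<epsilon>0: "\<epsilon> \<longlonglongrightarrow> 0" unfolding \<epsilon>_def using tendsto_divide[OF T0 p1] by simp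
  have "eventually (\<lambda>n. 0 < p n \<and> 1 \<le> n \<and> \<epsilon> n < 1) sequentially"
    using order_tendstoD(1)[OF p1, of 0] order_tendstoD(2)[OF \<epsilon>0, of 1] eventually_ge_at_top[of 1]
    by (auto simp: eventually_conj_iff)
  then obtain N where N: "\<And>n. n \<ge> N \<Longrightarrow> 0 < p n \<and> 1 \<le> n \<and> \<epsilon> n < 1" by (auto simp: eventually_sequentially)
  \<comment> \<open>Skipping the first \<open>N\<close> radii makes the conditioning mass positive,
    the radius at least 1 and the exponent below 1 at every index.\<close>
  define k where "k n = n + N" for n
  have k: "0 < p (k n)" "1 \<le> k n" "\<epsilon> (k n) < 1" for n using N[of "k n"] by (auto simp: k_def)
  define \<mu>s where "\<mu>s n = cond_dilate \<mu> (real (k n)) (exp (\<epsilon> (k n)))" for n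
  define R where "R n = exp (\<epsilon> (k n)) * real (k n)" for n
  have 1: "0 \<le> R n" for n by (simp add: R_def)
  have 2: "\<mu>s n \<in> prob_measures_on (cball 0 (R n))" for n
    unfolding \<mu>s_def R_def by (rule cond_dilate_prob_measures_on[OF \<mu>]) (use k[of n] in \<open>auto simp: p_def\<close>)
  have 3: "rpot d (\<mu>s n) z \<le> 0" if "0 < d" for n z d
    unfolding \<mu>s_def
  proof (rule cond_dilate_rpot_le[OF \<mu> _ _ le that])
    show "(\<integral>w. indicator (- cball 0 (real (k n))) w * (ln 4 + log_plus (cmod w)) \<partial>\<mu>) / measure \<mu> (cball 0 (real (k n))) \<le> \<epsilon> (k n)"
      by (simp add: \<epsilon>_def T_def p_def)
  qed (use k[of n] in \<open>auto simp: p_def\<close>)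
  have 4: "(\<lambda>n. \<integral>w. f w \<partial>\<mu>s n) \<longlonglongrightarrow> (\<integral>w. f w \<partial>\<mu>)"
    if f: "continuous_on UNIV f" and AB: "\<And>z. \<bar>f z\<bar> \<le> A + B * log_plus (cmod z)" for f :: "complex \<Rightarrow> real" and A B
  proof -
    have fm[measurable]: "f \<in> borel_measurable borel" by (rule borel_measurable_continuous_UNIV[OF f])
    have k\<epsilon>: "(\<lambda>n. \<epsilon> (k n)) \<longlonglongrightarrow> 0" unfolding k_def by (rule LIMSEQ_ignore_initial_segment[OF \<epsilon>0])
    have kp: "(\<lambda>n. p (k n)) \<longlonglongrightarrow> 1" unfolding k_def by (rule LIMSEQ_ignore_initial_segment[OF p1])
    have \<epsilon>pos: "0 \<le> \<epsilon> (k n)" for n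
    proof -
      have "0 \<le> T (k n)" unfolding T_def using log_plus_nonneg by (intro Bochner_Integration.integral_nonneg) (auto simp: indicator_def add_nonneg_nonneg)
      thus ?thesis unfolding \<epsilon>_def using k(1)[of n] by simp
    qed
    have "(\<lambda>n. \<integral>w. indicator (cball 0 (real (k n))) w * f (of_real (exp (\<epsilon> (k n))) * w) \<partial>\<mu>) \<longlonglongrightarrow> (\<integral>w. f w \<partial>\<mu>)"
    \<comment> \<open>The summand 1 absorbs the dilation, which raises \<open>log_plus\<close> by at
      most its exponent, and that is below 1.\<close>
    proof (rule integral_dominated_convergence[where w = "\<lambda>w. \<bar>A\<bar> + \<bar>B\<bar> * (1 + log_plus (cmod w))"])
      show "f \<in> borel_measurable \<mu>" by (rule P_log_measurable[OF \<mu> fm])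
      show "(\<lambda>w. indicator (cball 0 (real (k n))) w * f (of_real (exp (\<epsilon> (k n))) * w)) \<in> borel_measurable \<mu>" for n
      proof (rule P_log_measurable[OF \<mu>], intro borel_measurable_times borel_measurable_indicator borel_closed closed_cball)
        have "continuous_on UNIV (\<lambda>w. f (of_real (exp (\<epsilon> (k n))) * w))"
          by (rule continuous_on_compose2[OF f]) (auto intro!: continuous_intros)
        thus "(\<lambda>w. f (of_real (exp (\<epsilon> (k n))) * w)) \<in> borel_measurable borel" by (rule borel_measurable_continuous_UNIV)
      qed
      show "integrable \<mu> (\<lambda>w. \<bar>A\<bar> + \<bar>B\<bar> * (1 + log_plus (cmod w)))" using P_logD(4)[OF \<mu>] by simp
      show "AE w in \<mu>. (\<lambda>n. indicator (cball 0 (real (k n))) w * f (of_real (exp (\<epsilon> (k n))) * w)) \<longlonglongrightarrow> f w"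
      proof (rule AE_I2)
        fix w :: complex
        have "(\<lambda>n. of_real (exp (\<epsilon> (k n))) * w) \<longlonglongrightarrow> of_real (exp 0) * w" by (intro tendsto_intros k\<epsilon>)
        hence "(\<lambda>n. of_real (exp (\<epsilon> (k n))) * w) \<longlonglongrightarrow> w" by simp
        hence "(\<lambda>n. f (of_real (exp (\<epsilon> (k n))) * w)) \<longlonglongrightarrow> f w"
          by (rule continuous_on_tendsto_compose[OF f]) auto
        moreover have "eventually (\<lambda>n. f (of_real (exp (\<epsilon> (k n))) * w) = indicator (cball 0 (real (k n))) w * f (of_real (exp (\<epsilon> (k n))) * w)) sequentially"
        proof -
          have "eventually (\<lambda>n. w \<in> cball 0 (real (k n))) sequentially"
            unfolding k_def using ind[of w] by (subst eventually_sequentially_seg)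
          thus ?thesis by eventually_elim simp
        qed
        ultimately show "(\<lambda>n. indicator (cball 0 (real (k n))) w * f (of_real (exp (\<epsilon> (k n))) * w)) \<longlonglongrightarrow> f w"
          by (rule Lim_transform_eventually)
      qed
      show "AE w in \<mu>. norm (indicator (cball 0 (real (k n))) w * f (of_real (exp (\<epsilon> (k n))) * w)) \<le> \<bar>A\<bar> + \<bar>B\<bar> * (1 + log_plus (cmod w))" for n
      proof (rule AE_I2)
        fix w :: complex
        let ?u = "of_real (exp (\<epsilon> (k n))) * w"
        have "log_plus (cmod ?u) \<le> \<epsilon> (k n) + log_plus (cmod w)"
          using log_plus_mult_le[of "exp (\<epsilon> (k n))" "cmod w"] \<epsilon>pos[of n] by (simp add: norm_mult)
        hence "log_plus (cmod ?u) \<le> 1 + log_plus (cmod w)" using k(3)[of n] by linarith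
        hence "\<bar>B\<bar> * log_plus (cmod ?u) \<le> \<bar>B\<bar> * (1 + log_plus (cmod w))" by (rule mult_left_mono) simp
        moreover have "B * log_plus (cmod ?u) \<le> \<bar>B\<bar> * log_plus (cmod ?u)" using log_plus_nonneg by (intro mult_right_mono) auto
        ultimately have "\<bar>f ?u\<bar> \<le> \<bar>A\<bar> + \<bar>B\<bar> * (1 + log_plus (cmod w))" using AB[of ?u] by linarith
        moreover have "norm (indicator (cball 0 (real (k n))) w * f ?u) \<le> \<bar>f ?u\<bar>" by (simp add: indicator_def)
        ultimately show "norm (indicator (cball 0 (real (k n))) w * f ?u) \<le> \<bar>A\<bar> + \<bar>B\<bar> * (1 + log_plus (cmod w))" by linarith
      qed
    qed
    from tendsto_divide[OF this kp] show ?thesis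
      unfolding \<mu>s_def cond_dilate_integral[OF \<mu> fm] p_def by simp
  qed
  show ?thesis by (rule that[OF 1 2 3 4])
qed

text \<open>A diagonal choice: for each \<open>n\<close> one compact set of capacity one whose
  equilibrium measure is close to the \<open>n\<close>-th compactly supported approximant on
  \<open>log_plus\<close> and on the finitely many truncated monomials with indices up to
  \<open>n\<close>. Each of these test functions is covered from some \<open>n\<close> on, and
  together they suffice by \<open>log_weakly_convergesI\<close>.\<close>

theorem equilibrium_limit_if_potential_le_0:
  assumes \<mu>: "\<mu> \<in> P_log" and le: "\<And>z. potential \<mu> z \<le> 0"
  shows "\<exists>K. (\<forall>n. compact (K n) \<and> log_capacity (K n) = 1) \<and> log_weakly_converges (\<lambda>n. equilibrium_measure (K n)) \<mu>"
proof -
  have r0: "rpot d \<mu> z \<le> 0" if "0 < d" for z d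
    using le[of z] potential_le_iff[OF \<mu>, of z 0] that by (simp add: zero_ereal_def)
  show ?thesis
  proof (rule compact_approximation[OF \<mu> r0])
    fix \<mu>s :: "nat \<Rightarrow> complex measure" and R
    assume R: "\<And>n. 0 \<le> R n" and \<mu>s: "\<And>n. \<mu>s n \<in> prob_measures_on (cball 0 (R n))"
      and \<mu>s0: "\<And>n z d. 0 < d \<Longrightarrow> rpot d (\<mu>s n) z \<le> 0"
      and conv: "\<And>f A B. continuous_on UNIV f \<Longrightarrow> (\<And>z. \<bar>f z\<bar> \<le> A + B * log_plus (cmod z)) \<Longrightarrow>
        (\<lambda>n. \<integral>w. (f w :: real) \<partial>\<mu>s n) \<longlonglongrightarrow> (\<integral>w. f w \<partial>\<mu>)"
    define g where "g = (\<lambda>(M, j, k) w. cutoff M w * (Re w ^ j * Im w ^ k))"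
    have gc: "continuous_on UNIV (g i)" for i unfolding g_def by (cases i) (auto intro!: continuous_intros)
    have lc: "continuous_on UNIV (\<lambda>w::complex. log_plus (cmod w))" by (intro continuous_intros)
    have "\<exists>K. compact K \<and> log_capacity K = 1 \<and> equilibrium_measure K \<in> P_log \<and>
        (\<forall>i\<in>{..n} \<times> {..n} \<times> {..n}. \<bar>(\<integral>w. g i w \<partial>equilibrium_measure K) - (\<integral>w. g i w \<partial>\<mu>s n)\<bar> < inverse (real (Suc n))) \<and>
        \<bar>(\<integral>w. log_plus (cmod w) \<partial>equilibrium_measure K) - (\<integral>w. log_plus (cmod w) \<partial>\<mu>s n)\<bar> < inverse (real (Suc n))" for n
    proof -
      obtain K where K: "\<And>m. compact (K m)" "\<And>m. log_capacity (K m) = 1"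
        "\<And>m. equilibrium_measure (K m) \<in> prob_measures_on (cball 0 (R n + 2))" and w: "wconv (\<lambda>m. equilibrium_measure (K m)) (\<mu>s n)"
        by (rule compact_lemniscate_approximation[OF R \<mu>s \<mu>s0]) (assumption, rule that)
      have ev: "eventually (\<lambda>m. \<bar>(\<integral>w. f w \<partial>equilibrium_measure (K m)) - (\<integral>w. f w \<partial>\<mu>s n)\<bar> < inverse (real (Suc n))) sequentially"
        if "continuous_on UNIV f" for f
        using tendstoD[OF wconvD[OF w that], of "inverse (real (Suc n))"] by (simp add: dist_real_def)
      have "eventually (\<lambda>m. \<forall>i\<in>{..n} \<times> {..n} \<times> {..n}. \<bar>(\<integral>w. g i w \<partial>equilibrium_measure (K m)) - (\<integral>w. g i w \<partial>\<mu>s n)\<bar> < inverse (real (Suc n))) sequentially"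
        by (intro eventually_ball_finite ballI ev gc) auto
      from eventually_conj[OF this ev[OF lc]] obtain m where
        m: "\<forall>i\<in>{..n} \<times> {..n} \<times> {..n}. \<bar>(\<integral>w. g i w \<partial>equilibrium_measure (K m)) - (\<integral>w. g i w \<partial>\<mu>s n)\<bar> < inverse (real (Suc n))"
          "\<bar>(\<integral>w. log_plus (cmod w) \<partial>equilibrium_measure (K m)) - (\<integral>w. log_plus (cmod w) \<partial>\<mu>s n)\<bar> < inverse (real (Suc n))"
        unfolding eventually_sequentially by blast
      show ?thesis using m K(1,2) prob_measures_on_P_log[OF K(3) compact_cball] by (intro exI[of _ "K m"] conjI)
    qed
    then obtain K where K: "\<And>n. compact (K n)" "\<And>n. log_capacity (K n) = 1" "\<And>n. equilibrium_measure (K n) \<in> P_log"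
      and Kg: "\<And>n i. i \<in> {..n} \<times> {..n} \<times> {..n} \<Longrightarrow> \<bar>(\<integral>w. g i w \<partial>equilibrium_measure (K n)) - (\<integral>w. g i w \<partial>\<mu>s n)\<bar> < inverse (real (Suc n))"
      and Kl: "\<And>n. \<bar>(\<integral>w. log_plus (cmod w) \<partial>equilibrium_measure (K n)) - (\<integral>w. log_plus (cmod w) \<partial>\<mu>s n)\<bar> < inverse (real (Suc n))"
      by metis
    have lim: "(\<lambda>n. \<integral>w. f w \<partial>equilibrium_measure (K n)) \<longlonglongrightarrow> l"
      if l: "(\<lambda>n. \<integral>w. f w \<partial>\<mu>s n) \<longlonglongrightarrow> l"
        and N: "\<And>n. n \<ge> N \<Longrightarrow> \<bar>(\<integral>w. f w \<partial>equilibrium_measure (K n)) - (\<integral>w. f w \<partial>\<mu>s n)\<bar> < inverse (real (Suc n))" for f :: "complex \<Rightarrow> real" and l N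
    proof -
      have "(\<lambda>n. (\<integral>w. f w \<partial>equilibrium_measure (K n)) - (\<integral>w. f w \<partial>\<mu>s n)) \<longlonglongrightarrow> 0"
      proof (rule Lim_null_comparison[OF _ LIMSEQ_inverse_real_of_nat])
        show "\<forall>\<^sub>F n in sequentially. norm ((\<integral>w. f w \<partial>equilibrium_measure (K n)) - (\<integral>w. f w \<partial>\<mu>s n)) \<le> inverse (real (Suc n))"
          using N unfolding real_norm_def by (intro eventually_sequentiallyI[of N] less_imp_le)
      qed
      from tendsto_add[OF this l] show ?thesis by simp
    qed
    have "log_weakly_converges (\<lambda>n. equilibrium_measure (K n)) \<mu>"
    proof (rule log_weakly_convergesI[OF \<mu> K(3)])
      show "(\<lambda>n. \<integral>w. log_plus (cmod w) \<partial>equilibrium_measure (K n)) \<longlonglongrightarrow> (\<integral>w. log_plus (cmod w) \<partial>\<mu>)"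
      proof (rule lim[OF conv[OF lc, of 0 1] Kl])
        show "\<bar>log_plus (cmod z)\<bar> \<le> 0 + 1 * log_plus (cmod z)" for z using log_plus_nonneg[of "cmod z"] by simp
      qed
      fix M j k
      have "compact (g (M, j, k) ` cball 0 (real M + 1))" by (intro compact_continuous_image continuous_on_subset[OF gc]) auto
      then obtain C where C: "0 < C" "\<forall>y \<in> g (M, j, k) ` cball 0 (real M + 1). norm y \<le> C" using compact_imp_bounded bounded_pos by metis
      have "\<bar>g (M, j, k) w\<bar> \<le> C + 0 * log_plus (cmod w)" for w
      proof (cases "cmod w \<le> real M + 1")
        case True thus ?thesis using C(2) by simp
      next
        case False thus ?thesis using C(1) cutoff_eq_0[of M w] by (simp add: g_def)
      qed
      from conv[OF gc this] have "(\<lambda>n. \<integral>w. g (M, j, k) w \<partial>\<mu>s n) \<longlonglongrightarrow> (\<integral>w. g (M, j, k) w \<partial>\<mu>)" .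
      hence "(\<lambda>n. \<integral>w. g (M, j, k) w \<partial>equilibrium_measure (K n)) \<longlonglongrightarrow> (\<integral>w. g (M, j, k) w \<partial>\<mu>)"
        by (rule lim[where N = "max M (max j k)"]) (rule Kg, auto)
      thus "(\<lambda>n. \<integral>w. cutoff M w * (Re w ^ j * Im w ^ k) \<partial>equilibrium_measure (K n)) \<longlonglongrightarrow> (\<integral>w. cutoff M w * (Re w ^ j * Im w ^ k) \<partial>\<mu>)"
        by (simp add: g_def)
    qed
    thus ?thesis using K by blast
  qed
qed

theorem theorem4p4:
  fixes \<mu> :: "complex measure"
  assumes "\<mu> \<in> P_log"
  shows "(\<forall>z. potential \<mu> z \<le> 0) \<longleftrightarrow>
    (\<exists>K :: nat \<Rightarrow> complex set.
       (\<forall>n. compact (K n) \<and> log_capacity (K n) = 1) \<and>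
       log_weakly_converges (\<lambda>n. equilibrium_measure (K n)) \<mu>)"
proof
  assume "\<forall>z. potential \<mu> z \<le> 0"
  thus "\<exists>K. (\<forall>n. compact (K n) \<and> log_capacity (K n) = 1) \<and> log_weakly_converges (\<lambda>n. equilibrium_measure (K n)) \<mu>"
    using equilibrium_limit_if_potential_le_0[OF assms] by blast
next
  assume "\<exists>K. (\<forall>n. compact (K n) \<and> log_capacity (K n) = 1) \<and> log_weakly_converges (\<lambda>n. equilibrium_measure (K n)) \<mu>"
  thus "\<forall>z. potential \<mu> z \<le> 0" using potential_le_0_if_equilibrium_limit by blast
qed

end
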